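(* For $q \in L^1_{\mathbb{R}}[0,\pi]$, $\alpha \in (0,\pi]$, $\beta \in [0,\pi)$, let $\lambda_n^2(q,\alpha,\beta)$, $n = 0,1,2,\dots$, be the eigenvalues of the Sturm-Liouville problem $L(q,\alpha,\beta)$, and let $\lambda_n(q,\alpha,\beta)$ be their square roots. Then: (i) For every triple $(q,\alpha,\beta) \in L^1_{\mathbb{R}}[0,\pi] \times (0,\pi] \times [0,\pi)$ with $(\alpha,\beta) \neq (\pi,0)$, the system $\{\cos(\lambda_n(q,\alpha,\beta)x)\}_{n=0}^\infty$ is a Riesz basis in $L^2[0,\pi]$. (ii) For every $q \in L^1_{\mathbb{R}}[0,\pi]$, in the case $\alpha = \pi$, $\beta = 0$, the system $\{\cos(\lambda_n(q,\pi,0)x)\}_{n=0}^\infty$ is not a basis in $L^2[0,\pi]$; but for every $\lambda \in \mathbb{C}$ such that $\lambda^2 \neq \lambda_n^2(q,\pi,0)$ for all $n = 0,1,2,\dots$, the system $\{f(x)\} \cup \{\cos(\lambda_n(q,\pi,0)x)\}_{n=0}^\infty$ with $f(x) = \cos(\lambda x)$ is a Riesz basis in $L^2[0,\pi]$.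
   Context: $L^1_{\mathbb{R}}[0,\pi]$ is the set of real-valued summable (Lebesgue integrable) functions on $[0,\pi]$. $L^2[0,\pi]$ is the usual (complex) Hilbert space of square-integrable functions. The Sturm-Liouville problem $L(q,\alpha,\beta)$, for $q \in L^1_{\mathbb{R}}[0,\pi]$, $\alpha \in (0,\pi]$, $\beta \in [0,\pi)$, is the boundary-value problem $$-y'' + q(x)y = \mu y, \quad x \in (0,\pi),\ \mu \in \mathbb{C},$$ $$y(0)\cos\alpha + y'(0)\sin\alpha = 0,$$ $$y(\pi)\cos\beta + y'(\pi)\sin\beta = 0,$$ where solutions are understood in the usual sense ($y, y'$ absolutely continuous on $[0,\pi]$, equation satisfied almost everywhere). Its eigenvalues are real and simple, bounded below, and enumerated in increasing order as $\mu_0 < \mu_1 < \mu_2 < \cdots$; write $\mu_n = \mu_n(q,\alpha,\beta) = \lambda_n^2(q,\alpha,\beta)$. Thus $\lambda_n$ is a square root of $\mu_n$: it is taken nonnegative if $\mu_n \ge 0$, and is purely imaginary for the (finitely many) negative $\mu_n$ (the choice of sign of the square root is immaterial for $\cos(\lambda_n x)$). A Riesz basis of a separable Hilbert space $H$ is a sequence $\{f_j\}$ of the form $f_j = A e_j$, where $\{e_j\}$ is an orthonormal basis of $H$ and $A$ is a bounded invertible linear operator on $H$ (with bounded inverse). *)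

theory Defs
  imports "HOL-Analysis.Analysis"
begin

section \<open>The Hilbert space \<open>L\<^sup>2[0,\<pi>]\<close>\<close>

text \<open>Elements of \<open>L\<^sup>2[0,\<pi>]\<close> are represented by functions; two functions represent the same element
  iff they agree almost everywhere on \<open>[0,\<pi>]\<close>, which is the relation \<open>ae_eq\<close>.\<close>

abbreviation leb_pi :: "real measure" where
  "leb_pi \<equiv> lebesgue_on {0..pi}"

definition L2 :: "(real \<Rightarrow> complex) set" where
  "L2 = {f \<in> borel_measurable leb_pi. integrable leb_pi (\<lambda>x. (cmod (f x))\<^sup>2)}"

definition ae_eq :: "(real \<Rightarrow> complex) \<Rightarrow> (real \<Rightarrow> complex) \<Rightarrow> bool" where
  "ae_eq f g \<longleftrightarrow> (AE x in leb_pi. f x = g x)"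

definition l2_inner :: "(real \<Rightarrow> complex) \<Rightarrow> (real \<Rightarrow> complex) \<Rightarrow> complex" where
  "l2_inner f g = (LINT x|leb_pi. f x * cnj (g x))"

definition l2_norm :: "(real \<Rightarrow> complex) \<Rightarrow> real" where
  "l2_norm f = sqrt (LINT x|leb_pi. (cmod (f x))\<^sup>2)"

definition l2_sums :: "(nat \<Rightarrow> real \<Rightarrow> complex) \<Rightarrow> (nat \<Rightarrow> complex) \<Rightarrow> (real \<Rightarrow> complex) \<Rightarrow> bool" where
  "l2_sums f c g \<longleftrightarrow> (\<lambda>N. l2_norm (\<lambda>x. g x - (\<Sum>n<N. c n * f n x))) \<longlonglongrightarrow> 0"

text \<open>``Basis'' means Schauder basis: unique norm-convergent expansions.\<close>

definition l2_basis :: "(nat \<Rightarrow> real \<Rightarrow> complex) \<Rightarrow> bool" where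
  "l2_basis f \<longleftrightarrow> (\<forall>n. f n \<in> L2) \<and> (\<forall>g\<in>L2. \<exists>!c. l2_sums f c g)"

definition l2_orthonormal_basis :: "(nat \<Rightarrow> real \<Rightarrow> complex) \<Rightarrow> bool" where
  "l2_orthonormal_basis e \<longleftrightarrow>
     l2_basis e \<and> (\<forall>m n. l2_inner (e m) (e n) = (if m = n then 1 else 0))"

text \<open>Bounded complex-linear operators, acting on representatives. Linearity is required up to
  \<open>ae_eq\<close>; together with boundedness it gives \<open>ae_eq f g \<Longrightarrow> ae_eq (A f) (A g)\<close>, so that such an
  \<open>A\<close> does define an operator on the space of \<open>ae_eq\<close>-classes.\<close>

definition l2_bounded_operator :: "((real \<Rightarrow> complex) \<Rightarrow> (real \<Rightarrow> complex)) \<Rightarrow> bool" where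
  "l2_bounded_operator A \<longleftrightarrow>
     (\<forall>f\<in>L2. A f \<in> L2) \<and>
     (\<forall>f\<in>L2. \<forall>g\<in>L2. ae_eq (A (\<lambda>x. f x + g x)) (\<lambda>x. A f x + A g x)) \<and>
     (\<forall>f\<in>L2. \<forall>c. ae_eq (A (\<lambda>x. c * f x)) (\<lambda>x. c * A f x)) \<and>
     (\<exists>K. \<forall>f\<in>L2. l2_norm (A f) \<le> K * l2_norm f)"

definition l2_invertible_operator :: "((real \<Rightarrow> complex) \<Rightarrow> (real \<Rightarrow> complex)) \<Rightarrow> bool" where
  "l2_invertible_operator A \<longleftrightarrow>
     l2_bounded_operator A \<and>
     (\<exists>B. l2_bounded_operator B \<and> (\<forall>f\<in>L2. ae_eq (B (A f)) f \<and> ae_eq (A (B f)) f))"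

definition l2_riesz_basis :: "(nat \<Rightarrow> real \<Rightarrow> complex) \<Rightarrow> bool" where
  "l2_riesz_basis f \<longleftrightarrow>
     (\<exists>e A. l2_orthonormal_basis e \<and> l2_invertible_operator A \<and>
            (\<forall>n. f n \<in> L2 \<and> ae_eq (f n) (A (e n))))"

section \<open>The Sturm-Liouville problem\<close>

definition abs_continuous_on :: "real \<Rightarrow> real \<Rightarrow> (real \<Rightarrow> 'a::real_normed_vector) \<Rightarrow> bool" where
  "abs_continuous_on s t f \<longleftrightarrow>
     (\<forall>\<epsilon>>0. \<exists>\<delta>>0. \<forall>n (a::nat \<Rightarrow> real) b.
        (\<forall>i<n. s \<le> a i \<and> a i \<le> b i \<and> b i \<le> t) \<and>
        disjoint_family_on (\<lambda>i. {a i<..<b i}) {..<n} \<and>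
        (\<Sum>i<n. b i - a i) < \<delta> \<longrightarrow>
        (\<Sum>i<n. norm (f (b i) - f (a i))) < \<epsilon>)"

text \<open>\<open>y'\<close> is the derivative of \<open>y\<close> on \<open>[0,\<pi>]\<close> (one-sided at the endpoints), \<open>y''\<close> that of \<open>y'\<close>,
  which exists almost everywhere.\<close>

definition sl_solution ::
  "(real \<Rightarrow> real) \<Rightarrow> complex \<Rightarrow> (real \<Rightarrow> complex) \<Rightarrow> (real \<Rightarrow> complex) \<Rightarrow> bool" where
  "sl_solution q \<mu> y y' \<longleftrightarrow>
     abs_continuous_on 0 pi y \<and> abs_continuous_on 0 pi y' \<and>
     (\<forall>x\<in>{0..pi}. (y has_vector_derivative y' x) (at x within {0..pi})) \<and>
     (AE x in lebesgue_on {0<..<pi}. \<exists>y''. (y' has_vector_derivative y'') (at x) \<and>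
        - y'' + of_real (q x) * y x = \<mu> * y x)"

definition sl_eigenvalue :: "(real \<Rightarrow> real) \<Rightarrow> real \<Rightarrow> real \<Rightarrow> complex \<Rightarrow> bool" where
  "sl_eigenvalue q \<alpha> \<beta> \<mu> \<longleftrightarrow>
     (\<exists>y y'. sl_solution q \<mu> y y' \<and> (\<exists>x\<in>{0..pi}. y x \<noteq> 0) \<and>
        y 0 * of_real (cos \<alpha>) + y' 0 * of_real (sin \<alpha>) = 0 \<and>
        y pi * of_real (cos \<beta>) + y' pi * of_real (sin \<beta>) = 0)"

text \<open>The increasing enumeration \<open>\<mu>\<^sub>0 < \<mu>\<^sub>1 < \<dots>\<close> of all (complex) eigenvalues. Two strictly
  increasing sequences with the same range are equal, so there is at most one such sequence.\<close>

definition sl_mu :: "(real \<Rightarrow> real) \<Rightarrow> real \<Rightarrow> real \<Rightarrow> nat \<Rightarrow> real" where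
  "sl_mu q \<alpha> \<beta> = (THE m. strict_mono m \<and>
     range (\<lambda>n. complex_of_real (m n)) = {\<mu>. sl_eigenvalue q \<alpha> \<beta> \<mu>})"

text \<open>\<open>csqrt\<close> is nonnegative on nonnegative reals and purely imaginary on negative reals.\<close>

definition sl_lambda :: "(real \<Rightarrow> real) \<Rightarrow> real \<Rightarrow> real \<Rightarrow> nat \<Rightarrow> complex" where
  "sl_lambda q \<alpha> \<beta> n = csqrt (of_real (sl_mu q \<alpha> \<beta> n))"

end

theory Submission
  imports Defs "HOL-Complex_Analysis.Complex_Analysis"
begin

text \<open>The eigenvalues are the zeros of the characteristic function
  $\Phi(\mu) = \varphi(\pi,\mu)\cos\beta + \varphi'(\pi,\mu)\sin\beta$, where $\varphi(\cdot,\mu)$ solves the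
  equation and satisfies the boundary condition at $0$. It is entire with simple real zeros, and variation of
  constants gives $\lambda^m \Phi(\lambda^2) = c\lambda t_m(\lambda\pi) + O(e^{\pi|\mathrm{Im}\lambda|})$, where
  $m \in \{0,1,2\}$ counts the Dirichlet conditions among the two and $t_m$ is $\cos$ for $m = 1$ and $\sin$ otherwise.
  Comparison with $q = 0$ by Rouche's theorem yields $\lambda_n = n + m/2 + O(1/n)$.

  If $m \le 1$, then $\cos(\lambda_n x)$ is quadratically close to the orthogonal basis $\cos((n + m/2)x)$.
  It is also complete: when the cosine transform of $h$ vanishes at all $\lambda_n$, its quotient by $\Phi(\lambda^2)$
  is an entire function of $\lambda^2$, bounded on large circles, hence constant, and it tends to $0$ along the
  imaginary axis. By Bari's theorem the system is a Riesz basis. If $m = 2$ the same argument applies to the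
  augmented system $\cos(lx), \cos(\lambda_0 x), \cos(\lambda_1 x), \dots$ with $(\mu - l^2)\Phi(\mu)$ in place of
  $\Phi$; removing one element of a Riesz basis destroys completeness.\<close>

text \<open>Solutions are of Caratheodory type, so facts about the equation are drawn from one
  source, the Lagrange identity; choosing the second function in it gives the Wronskian, variation
  of constants and the derivative of \<Phi>. The entire functions are taken in the variable \<mu>
  and not in \<lambda>: there all zeros are simple, even one at \<mu> = 0, which would be double in
  \<lambda>. Simplicity turns the count in Rouche's theorem into a number of eigenvalues and makes
  the quotient in the completeness argument holomorphic. The number m separates the two cases
  because, away from the zeros, |\<Phi>| is only bounded below by a multiple of |\<lambda>|^(1-m)
  exp(\<pi> |Im \<lambda>|), while a cosine transform may be of order exp(\<pi> |Im \<lambda>|). For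
  m <= 1 the quotient is bounded on the circles. For m = 2 a power of \<lambda> is missing, and the
  additional zero \<mu> = l^2 supplies it. The same element repairs the indexing: the n-th root is
  then close to n + 1, so the constant function has no partner among the eigenvalue cosines until
  one more cosine is put in front.\<close>

hide_const (open) Polynomial.content

section \<open>Absolutely continuous functions\<close>

lemma abs_continuous_tagged:
  fixes f :: "real \<Rightarrow> 'a::real_normed_vector"
  assumes ac: "abs_continuous_on s t f" and e: "0 < e"
  obtains d where "0 < d" and "\<And>p. \<lbrakk>p tagged_partial_division_of {s..t}; (\<Sum>(x,K)\<in>p. content K) < d\<rbrakk>
      \<Longrightarrow> (\<Sum>(x,K)\<in>p. norm (f (Sup K) - f (Inf K))) < e"
proof -
  from ac e obtain d where d: "0 < d" "\<And>n (a::nat\<Rightarrow>real) b. \<lbrakk>\<forall>i<n. s \<le> a i \<and> a i \<le> b i \<and> b i \<le> t;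
      disjoint_family_on (\<lambda>i. {a i<..<b i}) {..<n}; (\<Sum>i<n. b i - a i) < d\<rbrakk>
      \<Longrightarrow> (\<Sum>i<n. norm (f (b i) - f (a i))) < e"
    unfolding abs_continuous_on_def by meson
  show thesis
  proof (rule that[OF d(1)])
    fix p assume p: "p tagged_partial_division_of {s..t}" and c: "(\<Sum>(x,K)\<in>p. content K) < d"
    have fin: "finite p" using p by (rule tagged_partial_division_ofD)
    have iv: "\<exists>u v. u \<le> v \<and> s \<le> u \<and> v \<le> t \<and> snd z = {u..v}" if "z \<in> p" for z
    proof -
      have z: "(fst z, snd z) \<in> p" using that by simp
      obtain u v where uv: "snd z = cbox u v" using tagged_partial_division_ofD(4)[OF p z] by blast
      moreover have "fst z \<in> snd z" "snd z \<subseteq> {s..t}"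
        using tagged_partial_division_ofD(2,3)[OF p z] by auto
      ultimately show ?thesis by auto
    qed
    obtain h where h: "bij_betw h {..<card p} p"
      using ex_bij_betw_nat_finite[OF fin] by (auto simp: atLeast0LessThan)
    define a where "a = (\<lambda>i. Inf (snd (h i)))"
    define b where "b = (\<lambda>i. Sup (snd (h i)))"
    have hp: "h i \<in> p" if "i < card p" for i using h that bij_betwE by blast
    have 1: "\<forall>i<card p. s \<le> a i \<and> a i \<le> b i \<and> b i \<le> t"
      using iv hp unfolding a_def b_def by (metis cInf_atLeastAtMost cSup_atLeastAtMost)
    have io: "interior (snd (h i)) = {a i<..<b i}" "content (snd (h i)) = b i - a i" if "i < card p" for i
      using iv[OF hp[OF that]] unfolding a_def b_def by (auto simp: interior_atLeastAtMost_real)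
    have 2: "disjoint_family_on (\<lambda>i. {a i<..<b i}) {..<card p}"
      unfolding disjoint_family_on_def
    proof (intro ballI impI)
      fix i j assume ij: "i \<in> {..<card p}" "j \<in> {..<card p}" "i \<noteq> j"
      then have "h i \<noteq> h j" using h unfolding bij_betw_def inj_on_def by blast
      then have "interior (snd (h i)) \<inter> interior (snd (h j)) = {}"
        using tagged_partial_division_ofD(5)[OF p, of "fst (h i)" "snd (h i)" "fst (h j)" "snd (h j)"] hp ij by auto
      then show "{a i<..<b i} \<inter> {a j<..<b j} = {}" using io ij by auto
    qed
    have "(\<Sum>i<card p. b i - a i) = (\<Sum>i<card p. content (snd (h i)))"
      by (rule sum.cong) (auto simp: io)
    also have "\<dots> = (\<Sum>z\<in>p. content (snd z))" by (rule sum.reindex_bij_betw[OF h])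
    finally have 3: "(\<Sum>i<card p. b i - a i) < d" using c by (simp add: split_def)
    have "(\<Sum>i<card p. norm (f (b i) - f (a i))) = (\<Sum>z\<in>p. norm (f (Sup (snd z)) - f (Inf (snd z))))"
      unfolding a_def b_def by (rule sum.reindex_bij_betw[OF h])
    with d(2)[OF 1 2 3] show "(\<Sum>(x,K)\<in>p. norm (f (Sup K) - f (Inf K))) < e" by (simp add: split_def)
  qed
qed

text \<open>Two members meet in a convex set with empty interior, which is negligible, so their
  lengths add up to the measure of the union. In this form the total length can be compared with the
  measure of an open set containing the intervals.\<close>

lemma sum_content_tagged_partial:
  fixes p :: "(real \<times> real set) set"
  assumes p: "p tagged_partial_division_of {s..t}"
  shows "(\<Sum>(x,K)\<in>p. content K) = measure lebesgue (\<Union>(snd ` p))"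
proof -
  have "pairwise (\<lambda>x y. negligible (snd x \<inter> snd y)) p"
    unfolding pairwise_def
  proof (intro ballI impI)
    fix x y assume xy: "x \<in> p" "y \<in> p" "x \<noteq> y"
    have x: "(fst x, snd x) \<in> p" "(fst y, snd y) \<in> p" using xy by auto
    obtain u v where 1: "snd x = cbox u v" using tagged_partial_division_ofD(4)[OF p x(1)] by blast
    obtain u' v' where 2: "snd y = cbox u' v'" using tagged_partial_division_ofD(4)[OF p x(2)] by blast
    have "interior (snd x) \<inter> interior (snd y) = {}"
      using tagged_partial_division_ofD(5)[OF p x(1) x(2)] xy by (auto simp: prod_eq_iff)
    then show "negligible (snd x \<inter> snd y)"
      using negligible_convex_interior[of "snd x \<inter> snd y"] unfolding 1 2 by (simp add: convex_Int)
  qed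
  moreover have "snd x \<in> lmeasurable" if "x \<in> p" for x
    using tagged_partial_division_ofD(4)[OF p, of "fst x" "snd x"] that by auto
  ultimately have "measure lebesgue (\<Union>(snd ` p)) = (\<Sum>x\<in>p. measure lebesgue (snd x))"
    using p by (intro measure_negligible_finite_Union_image) (auto simp: tagged_partial_division_of_def)
  also have "\<dots> = (\<Sum>x\<in>p. content (snd x))"
  proof (rule sum.cong)
    fix x assume "x \<in> p"
    then obtain u v where "snd x = cbox u v"
      using tagged_partial_division_ofD(4)[OF p, of "fst x" "snd x"] by auto
    then show "measure lebesgue (snd x) = content (snd x)" by (simp add: measure_completion)
  qed auto
  finally show ?thesis by (simp add: split_def)
qed

text \<open>The tags in the exceptional set $N$ are given gauge balls inside an open set of small measure;
  absolute continuity bounds the increments of $f$ over their intervals. The remaining intervals are handled by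
  differentiability at the tag.\<close>

theorem fundamental_theorem_of_calculus_abs_continuous:
  fixes f g :: "real \<Rightarrow> 'a::banach"
  assumes ac: "abs_continuous_on s t f" and st: "s \<le> t" and N: "negligible N"
    and der: "\<And>x. x \<in> {s<..<t} - N \<Longrightarrow> (f has_vector_derivative g x) (at x)"
  shows "(g has_integral f t - f s) {s..t}"
proof -
  \<comment> \<open>The endpoints are added to the exceptional set because differentiability is
    given only inside. With \<open>g'\<close> zero on \<open>M\<close>, an interval tagged in
    \<open>M\<close> contributes nothing but the increment of \<open>f\<close>.\<close>
  define M where "M = N \<union> {s,t}"
  have M: "negligible M" unfolding M_def using N by (simp add: negligible_Un)
  define g' where "g' = (\<lambda>x. if x \<in> M then 0 else g x)"
  have "(g' has_integral f t - f s) {s..t}"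
    unfolding has_integral_real
  proof (intro allI impI)
    fix e :: real assume e: "0 < e"
    obtain d where d: "0 < d" "\<And>p. \<lbrakk>p tagged_partial_division_of {s..t}; (\<Sum>(x,K)\<in>p. content K) < d\<rbrakk>
      \<Longrightarrow> (\<Sum>(x,K)\<in>p. norm (f (Sup K) - f (Inf K))) < e/2"
      using abs_continuous_tagged[OF ac half_gt_zero[OF e]] by blast
    obtain U where U: "open U" "M \<subseteq> U" "U - M \<in> lmeasurable" "emeasure lebesgue (U - M) < ennreal d"
      using sets_lebesgue_outer_open[OF negligible_imp_sets[OF M] d(1)] by blast
    have Um: "U \<in> lmeasurable" "measure lebesgue U < d"
    proof -
      have Me: "M \<in> lmeasurable" "measure lebesgue M = 0"
        using M by (auto simp: negligible_imp_measurable negligible_imp_measure0)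
      have eq: "U = (U - M) \<union> M" using U by auto
      show "U \<in> lmeasurable" using eq U(3) Me by (metis fmeasurable.Un)
      have "measure lebesgue U \<le> measure lebesgue (U - M) + measure lebesgue M"
        using eq U(3) Me by (metis measure_Un_le fmeasurableD)
      also have "\<dots> < d" using U(3,4) Me d by (simp add: emeasure_eq_measure2 ennreal_less_iff)
      finally show "measure lebesgue U < d" .
    qed
    \<comment> \<open>The good intervals produce an error of at most \<eta> times the length t - s,
      which is below e/2; the summand 1 keeps the quotient meaningful for s = t.\<close>
    define \<eta> where "\<eta> = e / (2 * (t - s + 1))"
    have \<eta>: "0 < \<eta>" using e st by (simp add: \<eta>_def)
    have "\<exists>r>0. if x \<in> M then ball x r \<subseteq> U else x \<in> {s<..<t} \<longrightarrow>
        (\<forall>y. norm (y - x) < r \<longrightarrow> norm (f y - f x - (y - x) *\<^sub>R g x) \<le> \<eta> * norm (y - x))" for x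
    proof (cases "x \<in> M")
      case True then show ?thesis using U openE by (metis subsetD)
    next
      case False
      show ?thesis
      proof (cases "x \<in> {s<..<t}")
        case True
        then have "(f has_vector_derivative g x) (at x)" using der False M_def by auto
        then show ?thesis using \<eta> False unfolding has_vector_derivative_def has_derivative_at_alt by auto
      qed (use False in \<open>auto intro: exI[of _ 1]\<close>)
    qed
    then obtain r where r: "\<And>x. 0 < r x" "\<And>x. if x \<in> M then ball x (r x) \<subseteq> U else x \<in> {s<..<t} \<longrightarrow>
        (\<forall>y. norm (y - x) < r x \<longrightarrow> norm (f y - f x - (y - x) *\<^sub>R g x) \<le> \<eta> * norm (y - x))"
      by metis
    define \<gamma> where "\<gamma> = (\<lambda>x. ball x (r x))"
    show "\<exists>\<gamma>. gauge \<gamma> \<and> (\<forall>\<D>. \<D> tagged_division_of {s..t} \<and> \<gamma> fine \<D> \<longrightarrow>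
           norm ((\<Sum>(x, k)\<in>\<D>. content k *\<^sub>R g' x) - (f t - f s)) < e)"
    proof (intro exI[of _ \<gamma>] conjI allI impI)
      show "gauge \<gamma>" unfolding \<gamma>_def by (rule gauge_ball_dependent) (use r in auto)
      fix p assume "p tagged_division_of {s..t} \<and> \<gamma> fine p"
      then have p: "p tagged_division_of {s..t}" and fine: "\<gamma> fine p" by auto
      have fin: "finite p" using p by auto
      have pp: "p tagged_partial_division_of {s..t}" using p by (simp add: tagged_division_of_def)
      define q where "q = {z\<in>p. fst z \<in> M}"
      have q: "q tagged_partial_division_of {s..t}" "q \<subseteq> p"
        unfolding q_def using tagged_partial_division_subset[OF pp] by auto
      have qU: "\<Union>(snd ` q) \<subseteq> U"
      proof clarify
        fix x K y assume "(x,K) \<in> q" "y \<in> snd (x,K)"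
        then show "y \<in> U" using fine r(2)[of x] unfolding q_def fine_def \<gamma>_def by auto blast
      qed
      have "(\<Sum>(x,K)\<in>q. content K) \<le> measure lebesgue U"
        unfolding sum_content_tagged_partial[OF q(1)]
      proof (rule measure_mono_fmeasurable[OF qU _ Um(1)])
        have "snd z \<in> sets lebesgue" if "z \<in> q" for z
          using tagged_partial_division_ofD(4)[OF q(1), of "fst z" "snd z"] that by auto
        then show "\<Union>(snd ` q) \<in> sets lebesgue" using fin q(2) finite_subset by (blast intro: sets.finite_UN)
      qed
      then have bq: "(\<Sum>(x,K)\<in>q. norm (f (Sup K) - f (Inf K))) < e/2" using d(2)[OF q(1)] Um(2) by simp
      have good: "norm (content (snd z) *\<^sub>R g' (fst z) - (f (Sup (snd z)) - f (Inf (snd z)))) \<le> \<eta> * content (snd z)"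
        if z: "z \<in> p - q" for z
      proof -
        obtain x K where zz: "z = (x,K)" by force
        have xK: "(x,K) \<in> p" "x \<notin> M" using z zz q_def by auto
        obtain u v where K: "K = cbox u v" using tagged_partial_division_ofD(4)[OF pp xK(1)] by blast
        have xuv: "u \<le> x" "x \<le> v" "s \<le> u" "v \<le> t"
          using tagged_partial_division_ofD(2,3)[OF pp xK(1)] K by auto
        have xin: "x \<in> {s<..<t}" using xuv xK(2) by (auto simp: M_def)
        have sub: "{u..v} \<subseteq> ball x (r x)" using fine xK(1) K unfolding fine_def \<gamma>_def by auto
        have *: "norm (f y - f x - (y - x) *\<^sub>R g x) \<le> \<eta> * norm (y - x)" if "y \<in> {u..v}" for y
          using r(2)[of x] xK(2) xin sub that by (auto simp: dist_norm norm_minus_commute subset_iff)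
        have 1: "norm (f v - f x - (v - x) *\<^sub>R g x) \<le> \<eta> * (v - x)" using *[of v] xuv by auto
        have 2: "norm (f u - f x - (u - x) *\<^sub>R g x) \<le> \<eta> * (x - u)" using *[of u] xuv by auto
        have eq: "(v - u) *\<^sub>R g x - (f v - f u) = (f u - f x - (u - x) *\<^sub>R g x) - (f v - f x - (v - x) *\<^sub>R g x)"
          by (simp add: algebra_simps)
        have "norm ((v - u) *\<^sub>R g x - (f v - f u)) \<le> \<eta> * (x - u) + \<eta> * (v - x)"
          unfolding eq by (rule order_trans[OF norm_triangle_ineq4 add_mono[OF 2 1]])
        then show ?thesis using zz K xuv xK(2) by (simp add: g'_def algebra_simps)
      qed
      have bad: "norm (content (snd z) *\<^sub>R g' (fst z) - (f (Sup (snd z)) - f (Inf (snd z)))) = norm (f (Sup (snd z)) - f (Inf (snd z)))"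
        if "z \<in> q" for z using that by (simp add: q_def g'_def norm_minus_commute)
      have "f t - f s = (\<Sum>z\<in>p. f (Sup (snd z)) - f (Inf (snd z)))"
        using additive_tagged_division_1[OF st p, of f] by (simp add: split_def)
      then have "norm ((\<Sum>(x, k)\<in>p. content k *\<^sub>R g' x) - (f t - f s))
          = norm (\<Sum>z\<in>p. content (snd z) *\<^sub>R g' (fst z) - (f (Sup (snd z)) - f (Inf (snd z))))"
        by (simp add: sum_subtractf split_def)
      also have "\<dots> \<le> (\<Sum>z\<in>p. norm (content (snd z) *\<^sub>R g' (fst z) - (f (Sup (snd z)) - f (Inf (snd z)))))"
        by (rule norm_sum)
      also have "\<dots> = (\<Sum>z\<in>p - q. norm (content (snd z) *\<^sub>R g' (fst z) - (f (Sup (snd z)) - f (Inf (snd z)))))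
          + (\<Sum>z\<in>q. norm (content (snd z) *\<^sub>R g' (fst z) - (f (Sup (snd z)) - f (Inf (snd z)))))"
        by (rule sum.subset_diff[OF q(2) fin])
      also have "\<dots> \<le> (\<Sum>z\<in>p - q. \<eta> * content (snd z)) + (\<Sum>z\<in>q. norm (f (Sup (snd z)) - f (Inf (snd z))))"
        using good bad by (intro add_mono sum_mono) auto
      also have "\<dots> < e"
      proof -
        have "(\<Sum>z\<in>p - q. \<eta> * content (snd z)) \<le> (\<Sum>z\<in>p. \<eta> * content (snd z))"
          by (rule sum_mono2[OF fin]) (use \<eta> in auto)
        also have "\<dots> = \<eta> * (\<Sum>(x,K)\<in>p. content K)" by (simp add: sum_distrib_left split_def)
        also have "\<dots> = \<eta> * (t - s)"
          using additive_content_tagged_division[of p s t] p st by simp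
        also have "\<dots> < e/2" using e st by (simp add: \<eta>_def field_simps)
        finally show ?thesis using bq by (simp add: split_def)
      qed
      finally show "norm ((\<Sum>(x, k)\<in>p. content k *\<^sub>R g' x) - (f t - f s)) < e" .
    qed
  qed
  then show ?thesis
    by (rule has_integral_spike[OF M, rotated]) (auto simp: g'_def)
qed


text \<open>The points where the difference quotients of the integral stay away from $g$ have a Vitali cover by
  intervals on which Henstock's lemma makes the total error, hence the total length, small.\<close>

theorem has_vector_derivative_integral_ae:
  fixes g :: "real \<Rightarrow> 'a::euclidean_space"
  assumes g: "g integrable_on {a..b}"
  obtains N where "negligible N"
    "\<And>x. x \<in> {a<..<b} - N \<Longrightarrow> ((\<lambda>x. integral {a..x} g) has_vector_derivative g x) (at x)"
proof -
  \<comment> \<open>Only intervals with \<open>x\<close> as an endpoint are tested, since these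
    carry the increments between \<open>x\<close> and a nearby point. \<open>E k\<close> collects
    the points where arbitrarily short such intervals miss by more than the relative error 1/(k+1);
    outside every \<open>E k\<close> the integral is differentiable.\<close>
  define bad where "bad = (\<lambda>k x u v. (x = u \<or> x = v) \<and> u < v \<and> a < u \<and> v < b \<and>
      (v - u) / real (Suc k) < norm ((v - u) *\<^sub>R g x - integral {u..v} g))"
  define E where "E = (\<lambda>k. {x. \<forall>d>0. \<exists>u v. bad k x u v \<and> v - u < d})"
  have neg: "negligible (E k)" for k
    unfolding negligible_outer_le
  proof (intro allI impI)
    fix e :: real assume e: "0 < e"
    \<comment> \<open>The tolerance e/(k+1) matches \<open>bad\<close>: each bad interval
      contributes more than its length divided by k+1, so disjoint bad intervals have total length
      below e.\<close>
    obtain \<gamma> where \<gamma>: "gauge \<gamma>" "\<And>p. \<lbrakk>p tagged_partial_division_of cbox a b; \<gamma> fine p\<rbrakk>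
            \<Longrightarrow> (\<Sum>(x, k)\<in>p. norm (content k *\<^sub>R g x - integral k g)) < e / real (Suc k)"
      using Henstock_lemma[of g a b "e / real (Suc k)"] g e by auto
    define I where "I = {(u,v). \<exists>x. bad k x u v \<and> {u..v} \<subseteq> \<gamma> x}"
    define c where "c = (\<lambda>(u,v). (u + v) / 2 :: real)"
    define r where "r = (\<lambda>(u,v). (v - u) / 2 :: real)"
    have cb: "cball (c (u,v)) (r (u,v)) = {u..v}" for u v :: real
      by (auto simp: c_def r_def dist_real_def abs_if field_simps split: if_splits)
    have rpos: "0 < r i" if "i \<in> I" for i using that by (auto simp: I_def r_def bad_def)
    have cov: "\<exists>i. i \<in> I \<and> x \<in> cball (c i) (r i) \<and> r i < d" if x: "x \<in> E k" and d: "0 < d" for x d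
    proof -
      obtain s where s: "0 < s" "ball x s \<subseteq> \<gamma> x" using \<gamma>(1) unfolding gauge_def by (meson openE)
      have "0 < min d s" using d s(1) by simp
      then obtain u v where uv: "bad k x u v" "v - u < min d s" using x unfolding E_def by blast
      have "{u..v} \<subseteq> ball x s" using uv by (auto simp: bad_def dist_real_def)
      then have "(u,v) \<in> I" using uv s by (auto simp: I_def)
      moreover have "x \<in> {u..v}" using uv by (auto simp: bad_def)
      moreover have "r (u,v) < d" using uv by (auto simp: r_def bad_def)
      ultimately show ?thesis using cb by blast
    qed
    obtain C where C: "countable C" "C \<subseteq> I"
      "pairwise (\<lambda>i j. disjnt (cball (c i) (r i)) (cball (c j) (r j))) C"
      "negligible (E k - (\<Union>i\<in>C. cball (c i) (r i)))"
      using Vitali_covering_theorem_cballs[of I r "E k" c, OF rpos cov] by blast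
    have bound: "measure lebesgue (\<Union>((\<lambda>i. cball (c i) (r i)) ` F)) \<le> e" if F: "F \<subseteq> C" "finite F" for F
    proof -
      have "\<forall>i\<in>F. \<exists>x. bad k x (fst i) (snd i) \<and> {fst i..snd i} \<subseteq> \<gamma> x" using F C(2) by (force simp: I_def)
      then obtain t where t: "\<And>i. i \<in> F \<Longrightarrow> bad k (t i) (fst i) (snd i) \<and> {fst i..snd i} \<subseteq> \<gamma> (t i)" by metis
      have cb': "cball (c i) (r i) = {fst i..snd i}" for i using cb[of "fst i" "snd i"] by simp
      have dj: "{fst i..snd i} \<inter> {fst j..snd j} = {}" if "i \<in> F" "j \<in> F" "i \<noteq> j" for i j
        using C(3) F that unfolding pairwise_def disjnt_def cb' by blast
      define p where "p = (\<lambda>i. (t i, {fst i..snd i})) ` F"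
      have inj: "inj_on (\<lambda>i. (t i, {fst i..snd i})) F"
      proof (rule inj_onI)
        fix i j assume ij: "i \<in> F" "j \<in> F" "(t i, {fst i..snd i}) = (t j, {fst j..snd j})"
        have "{fst i..snd i} \<noteq> {}" using t[OF ij(1)] by (auto simp: bad_def)
        then show "i = j" using dj[OF ij(1,2)] ij(3) by auto
      qed
      have "p tagged_partial_division_of cbox a b"
        unfolding tagged_partial_division_of_def
      proof (intro conjI allI impI)
        show "finite p" using F by (simp add: p_def)
      next
        fix x K assume "(x,K) \<in> p"
        then obtain i where i: "i \<in> F" "x = t i" "K = {fst i..snd i}" by (auto simp: p_def)
        then show "x \<in> K" "K \<subseteq> cbox a b" "\<exists>a b. K = cbox a b" using t[OF i(1)] by (auto simp: bad_def)
      next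
        fix x1 K1 x2 K2 assume "(x1,K1) \<in> p \<and> (x2,K2) \<in> p \<and> (x1,K1) \<noteq> (x2,K2)"
        then obtain i j where "i \<in> F" "K1 = {fst i..snd i}" "j \<in> F" "K2 = {fst j..snd j}" "i \<noteq> j" by (auto simp: p_def)
        then have "K1 \<inter> K2 = {}" using dj by auto
        then show "interior K1 \<inter> interior K2 = {}" using interior_subset by blast
      qed
      moreover have "\<gamma> fine p" using t by (auto simp: fine_def p_def)
      ultimately have "(\<Sum>(x, k)\<in>p. norm (content k *\<^sub>R g x - integral k g)) < e / real (Suc k)" by (rule \<gamma>(2))
      then have less: "(\<Sum>i\<in>F. norm ((snd i - fst i) *\<^sub>R g (t i) - integral {fst i..snd i} g)) < e / real (Suc k)"
      proof -
        have "(\<Sum>(x, k)\<in>p. norm (content k *\<^sub>R g x - integral k g)) = (\<Sum>i\<in>F. norm (content {fst i..snd i} *\<^sub>R g (t i) - integral {fst i..snd i} g))"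
          unfolding p_def by (subst sum.reindex[OF inj]) auto
        also have "\<dots> = (\<Sum>i\<in>F. norm ((snd i - fst i) *\<^sub>R g (t i) - integral {fst i..snd i} g))"
        proof (rule sum.cong)
          fix i assume "i \<in> F" then have "fst i \<le> snd i" using t[of i] by (simp add: bad_def)
          then show "norm (content {fst i..snd i} *\<^sub>R g (t i) - integral {fst i..snd i} g) = norm ((snd i - fst i) *\<^sub>R g (t i) - integral {fst i..snd i} g)"
            by simp
        qed simp
        finally show ?thesis using \<open>_ < e / real (Suc k)\<close> by simp
      qed
      have "(\<Sum>i\<in>F. (snd i - fst i) / real (Suc k)) \<le> (\<Sum>i\<in>F. norm ((snd i - fst i) *\<^sub>R g (t i) - integral {fst i..snd i} g))"
        using t by (intro sum_mono) (auto simp: bad_def less_imp_le)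
      then have "(\<Sum>i\<in>F. snd i - fst i) / real (Suc k) < e / real (Suc k)"
        using less unfolding sum_divide_distrib by linarith
      then have *: "(\<Sum>i\<in>F. snd i - fst i) < e" by (simp add: divide_less_cancel)
      have "measure lebesgue (\<Union>((\<lambda>i. cball (c i) (r i)) ` F)) = (\<Sum>i\<in>F. measure lebesgue (cball (c i) (r i)))"
        using dj F(2) unfolding cb' by (intro measure_negligible_finite_Union_image) (auto simp: pairwise_def)
      also have "\<dots> = (\<Sum>i\<in>F. snd i - fst i)"
      proof (rule sum.cong)
        fix i assume "i \<in> F" then have "fst i \<le> snd i" using t[of i] by (simp add: bad_def)
        then show "measure lebesgue (cball (c i) (r i)) = snd i - fst i" unfolding cb' by (simp add: measure_completion)
      qed simp
      finally show ?thesis using * by simp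
    qed
    have lm: "cball (c i) (r i) \<in> lmeasurable" for i by simp
    define Z where "Z = E k - (\<Union>i\<in>C. cball (c i) (r i))"
    define V where "V = (\<Union>i\<in>C. cball (c i) (r i))"
    have V: "V \<in> lmeasurable" "measure lebesgue V \<le> e"
      unfolding V_def using fmeasurable_UN_bound[OF C(1) lm bound] measure_UN_bound[OF C(1) lm bound] by auto
    have Z: "Z \<in> lmeasurable" "measure lebesgue Z = 0"
      using C(4) unfolding Z_def by (auto simp: negligible_imp_measurable negligible_imp_measure0)
    have "E k \<subseteq> Z \<union> V" by (auto simp: Z_def V_def)
    moreover have "Z \<union> V \<in> lmeasurable" using Z V by (simp add: fmeasurable.Un)
    moreover have "measure lebesgue (Z \<union> V) \<le> e"
      using measure_Un_le[of Z lebesgue V] Z V by (simp add: fmeasurableD)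
    ultimately show "\<exists>T. E k \<subseteq> T \<and> T \<in> lmeasurable \<and> measure lebesgue T \<le> e" by blast
  qed
  show thesis
  proof (rule that[of "\<Union>k. E k"])
    show "negligible (\<Union>k. E k)" using neg by (intro negligible_countable_Union) auto
    fix x assume x: "x \<in> {a<..<b} - (\<Union>k. E k)"
    show "((\<lambda>x. integral {a..x} g) has_vector_derivative g x) (at x)"
      unfolding has_vector_derivative_def has_derivative_at_alt
    proof (intro conjI allI impI)
      fix e :: real assume e: "0 < e"
      obtain k where k: "inverse (real (Suc k)) < e" using reals_Archimedean[OF e] by blast
      obtain d where d: "0 < d" "\<And>u v. bad k x u v \<Longrightarrow> d \<le> v - u" using x by (force simp: E_def not_less)
      define s where "s = Min {d, x - a, b - x}"
      have s: "0 < s" "s \<le> d" "s \<le> x - a" "s \<le> b - x" using x d by (auto simp: s_def)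
      show "\<exists>d>0. \<forall>y. norm (y - x) < d \<longrightarrow>
           norm (integral {a..y} g - integral {a..x} g - (y - x) *\<^sub>R g x) \<le> e * norm (y - x)"
      proof (intro exI[of _ s] conjI allI impI s(1))
        fix y assume y: "norm (y - x) < s"
        define u v where "u = min x y" and "v = max x y"
        have uv: "a < u" "v < b" "u \<le> v" "v - u < d" "v - u = \<bar>y - x\<bar>" "x = u \<or> x = v"
          using y s by (auto simp: u_def v_def)
        show "norm (integral {a..y} g - integral {a..x} g - (y - x) *\<^sub>R g x) \<le> e * norm (y - x)"
        proof (cases "x = y")
          case False
          then have "u < v" unfolding u_def v_def by linarith
          moreover have "\<not> bad k x u v" using d(2) uv(4) by fastforce
          ultimately have "norm ((v - u) *\<^sub>R g x - integral {u..v} g) \<le> (v - u) / real (Suc k)"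
            using uv by (auto simp: bad_def)
          also have "\<dots> \<le> e * (v - u)" using mult_right_mono[of "inverse (real (Suc k))" e "v - u"] k uv(3) by (simp add: divide_inverse mult.commute)
          finally have *: "norm ((v - u) *\<^sub>R g x - integral {u..v} g) \<le> e * (v - u)" .
          have "integral {a..v} g = integral {a..u} g + integral {u..v} g"
            using uv by (intro Henstock_Kurzweil_Integration.integral_combine[symmetric] integrable_on_subinterval[OF g]) auto
          then have "norm (integral {a..y} g - integral {a..x} g - (y - x) *\<^sub>R g x) = norm ((v - u) *\<^sub>R g x - integral {u..v} g)"
            using False unfolding u_def v_def
            by (cases "x < y") (auto simp: norm_minus_commute algebra_simps min_def max_def)
          then show ?thesis using * uv by simp
        qed simp
      qed
    qed (simp add: bounded_linear_scaleR_left)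
  qed
qed

section \<open>Closure properties of absolute continuity\<close>

text \<open>Common source of the closure properties below: increments of sums, differences,
  products, multiples and C1 functions are bounded by those of absolutely continuous functions. Two
  dominating functions are allowed because sums and products need both operands.\<close>

lemma abs_continuous_dominated:
  fixes f :: "real \<Rightarrow> 'a::real_normed_vector" and u :: "real \<Rightarrow> 'b::real_normed_vector"
    and v :: "real \<Rightarrow> 'c::real_normed_vector"
  assumes u: "abs_continuous_on s t u" and v: "abs_continuous_on s t v" and B: "0 \<le> B"
    and le: "\<And>a b. \<lbrakk>s \<le> a; a \<le> b; b \<le> t\<rbrakk> \<Longrightarrow> norm (f b - f a) \<le> B * (norm (u b - u a) + norm (v b - v a))"
  shows "abs_continuous_on s t f"
  unfolding abs_continuous_on_def
proof (intro allI impI)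
  fix \<epsilon> :: real assume "0 < \<epsilon>"
  \<comment> \<open>The denominator has B + 1 in place of B, so that the final estimate stays
    strict, also for B = 0.\<close>
  then have e: "0 < \<epsilon> / (2 * (B + 1))" using B by simp
  obtain d1 where d1: "0 < d1" "\<And>n (a::nat\<Rightarrow>real) b. \<lbrakk>\<forall>i<n. s \<le> a i \<and> a i \<le> b i \<and> b i \<le> t;
      disjoint_family_on (\<lambda>i. {a i<..<b i}) {..<n}; (\<Sum>i<n. b i - a i) < d1\<rbrakk>
      \<Longrightarrow> (\<Sum>i<n. norm (u (b i) - u (a i))) < \<epsilon> / (2 * (B + 1))"
    using u e unfolding abs_continuous_on_def by meson
  obtain d2 where d2: "0 < d2" "\<And>n (a::nat\<Rightarrow>real) b. \<lbrakk>\<forall>i<n. s \<le> a i \<and> a i \<le> b i \<and> b i \<le> t;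
      disjoint_family_on (\<lambda>i. {a i<..<b i}) {..<n}; (\<Sum>i<n. b i - a i) < d2\<rbrakk>
      \<Longrightarrow> (\<Sum>i<n. norm (v (b i) - v (a i))) < \<epsilon> / (2 * (B + 1))"
    using v e unfolding abs_continuous_on_def by meson
  show "\<exists>\<delta>>0. \<forall>n (a::nat \<Rightarrow> real) b. (\<forall>i<n. s \<le> a i \<and> a i \<le> b i \<and> b i \<le> t) \<and>
        disjoint_family_on (\<lambda>i. {a i<..<b i}) {..<n} \<and> (\<Sum>i<n. b i - a i) < \<delta> \<longrightarrow>
        (\<Sum>i<n. norm (f (b i) - f (a i))) < \<epsilon>"
  proof (intro exI[of _ "min d1 d2"] conjI allI impI)
    show "0 < min d1 d2" using d1 d2 by simp
    fix n and a b :: "nat \<Rightarrow> real"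
    assume A: "(\<forall>i<n. s \<le> a i \<and> a i \<le> b i \<and> b i \<le> t) \<and>
        disjoint_family_on (\<lambda>i. {a i<..<b i}) {..<n} \<and> (\<Sum>i<n. b i - a i) < min d1 d2"
    have 1: "(\<Sum>i<n. norm (u (b i) - u (a i))) < \<epsilon> / (2 * (B + 1))" using A by (intro d1) auto
    have 2: "(\<Sum>i<n. norm (v (b i) - v (a i))) < \<epsilon> / (2 * (B + 1))" using A by (intro d2) auto
    have "(\<Sum>i<n. norm (f (b i) - f (a i))) \<le> (\<Sum>i<n. B * (norm (u (b i) - u (a i)) + norm (v (b i) - v (a i))))"
      using A by (intro sum_mono le) auto
    also have "\<dots> = B * ((\<Sum>i<n. norm (u (b i) - u (a i))) + (\<Sum>i<n. norm (v (b i) - v (a i))))"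
      by (simp add: sum.distrib flip: sum_distrib_left)
    also have "\<dots> \<le> B * (\<epsilon> / (2 * (B + 1)) + \<epsilon> / (2 * (B + 1)))"
      using 1 2 B by (intro mult_left_mono) auto
    also have "\<dots> < (B + 1) * (\<epsilon> / (2 * (B + 1)) + \<epsilon> / (2 * (B + 1)))"
      using e by (intro mult_strict_right_mono) auto
    also have "\<dots> = \<epsilon>"
    proof -
      have "2 * (B + 1) \<noteq> 0" using B by simp
      then have "2 * (B + 1) * (\<epsilon> / (2 * (B + 1))) = \<epsilon>"
        by (simp only: times_divide_eq_right nonzero_mult_div_cancel_left not_False_eq_True)
      then show ?thesis by (simp only: distrib_left mult_2 distrib_right)
    qed
    finally show "(\<Sum>i<n. norm (f (b i) - f (a i))) < \<epsilon>" .
  qed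
qed

lemma abs_continuous_subinterval:
  assumes "abs_continuous_on s t f" "s \<le> s'" "t' \<le> t"
  shows "abs_continuous_on s' t' f"
  unfolding abs_continuous_on_def
proof (intro allI impI)
  fix \<epsilon> :: real assume e: "0 < \<epsilon>"
  then obtain d where d: "0 < d" "\<And>n (a::nat\<Rightarrow>real) b. \<lbrakk>\<forall>i<n. s \<le> a i \<and> a i \<le> b i \<and> b i \<le> t;
      disjoint_family_on (\<lambda>i. {a i<..<b i}) {..<n}; (\<Sum>i<n. b i - a i) < d\<rbrakk>
      \<Longrightarrow> (\<Sum>i<n. norm (f (b i) - f (a i))) < \<epsilon>"
    using assms(1) unfolding abs_continuous_on_def by meson
  have "\<forall>i<n. s \<le> a i \<and> a i \<le> b i \<and> b i \<le> t" if "\<forall>i<n. s' \<le> a i \<and> a i \<le> b i \<and> b i \<le> t'" for n and a b :: "nat \<Rightarrow> real"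
    using that assms(2,3) by force
  then show "\<exists>\<delta>>0. \<forall>n (a::nat \<Rightarrow> real) b. (\<forall>i<n. s' \<le> a i \<and> a i \<le> b i \<and> b i \<le> t') \<and>
        disjoint_family_on (\<lambda>i. {a i<..<b i}) {..<n} \<and> (\<Sum>i<n. b i - a i) < \<delta> \<longrightarrow>
        (\<Sum>i<n. norm (f (b i) - f (a i))) < \<epsilon>"
    using d by (intro exI[of _ d]) auto
qed

lemma abs_continuous_id: "abs_continuous_on s t (\<lambda>x::real. x)"
  unfolding abs_continuous_on_def
proof (intro allI impI)
  fix \<epsilon> :: real assume e: "0 < \<epsilon>"
  have "(\<Sum>i<n. norm (b i - a i)) = (\<Sum>i<n. b i - a i)" if "\<forall>i<n. s \<le> a i \<and> a i \<le> b i \<and> b i \<le> t"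
    for n and a b :: "nat \<Rightarrow> real" using that by (intro sum.cong) auto
  then show "\<exists>\<delta>>0. \<forall>n (a::nat \<Rightarrow> real) b. (\<forall>i<n. s \<le> a i \<and> a i \<le> b i \<and> b i \<le> t) \<and>
        disjoint_family_on (\<lambda>i. {a i<..<b i}) {..<n} \<and> (\<Sum>i<n. b i - a i) < \<delta> \<longrightarrow>
        (\<Sum>i<n. norm (b i - a i)) < \<epsilon>" using e by (intro exI[of _ \<epsilon>]) auto
qed

lemma abs_continuous_imp_continuous:
  fixes f :: "real \<Rightarrow> 'a::real_normed_vector"
  assumes "abs_continuous_on s t f"
  shows "continuous_on {s..t} f"
  unfolding continuous_on_iff
proof (intro ballI allI impI)
  fix x e :: real assume x: "x \<in> {s..t}" and e: "0 < e"
  obtain d where d: "0 < d" "\<And>n (a::nat\<Rightarrow>real) b. \<lbrakk>\<forall>i<n. s \<le> a i \<and> a i \<le> b i \<and> b i \<le> t;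
      disjoint_family_on (\<lambda>i. {a i<..<b i}) {..<n}; (\<Sum>i<n. b i - a i) < d\<rbrakk>
      \<Longrightarrow> (\<Sum>i<n. norm (f (b i) - f (a i))) < e"
    using assms e unfolding abs_continuous_on_def by meson
  have *: "norm (f v - f u) < e" if "s \<le> u" "u \<le> v" "v \<le> t" "v - u < d" for u v
    using d(2)[of 1 "\<lambda>_. u" "\<lambda>_. v"] that by (simp add: disjoint_family_on_def)
  have "dist (f y) (f x) < e" if "y \<in> {s..t}" "dist y x < d" for y
    using *[of x y] *[of y x] x that by (cases "x \<le> y") (auto simp: dist_norm norm_minus_commute)
  then show "\<exists>d>0. \<forall>x'\<in>{s..t}. dist x' x < d \<longrightarrow> dist (f x') (f x) < e" using d(1) by blast
qed

lemma abs_continuous_mult: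
  fixes f g :: "real \<Rightarrow> 'a::real_normed_algebra"
  assumes f: "abs_continuous_on s t f" and g: "abs_continuous_on s t g"
  shows "abs_continuous_on s t (\<lambda>x. f x * g x)"
proof -
  have "bounded (f ` {s..t})" "bounded (g ` {s..t})"
    using f g by (auto intro!: compact_imp_bounded compact_continuous_image abs_continuous_imp_continuous)
  then obtain A B where A: "\<And>x. x \<in> {s..t} \<Longrightarrow> norm (f x) \<le> A" and B: "\<And>x. x \<in> {s..t} \<Longrightarrow> norm (g x) \<le> B"
    unfolding bounded_iff by (metis imageI)
  show ?thesis
  proof (rule abs_continuous_dominated[OF f g, of "\<bar>A\<bar> + \<bar>B\<bar>"])
    fix a b assume ab: "s \<le> a" "a \<le> b" "b \<le> t"
    have "f b * g b - f a * g a = f b * (g b - g a) + (f b - f a) * g a" by (simp add: algebra_simps)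
    then have "norm (f b * g b - f a * g a) \<le> norm (f b * (g b - g a)) + norm ((f b - f a) * g a)"
      using norm_triangle_ineq by metis
    also have "\<dots> \<le> norm (f b) * norm (g b - g a) + norm (f b - f a) * norm (g a)"
      by (intro add_mono norm_mult_ineq)
    also have "\<dots> \<le> (\<bar>A\<bar> + \<bar>B\<bar>) * norm (g b - g a) + norm (f b - f a) * (\<bar>A\<bar> + \<bar>B\<bar>)"
      using A[of b] B[of a] ab by (intro add_mono mult_right_mono mult_left_mono) auto
    finally show "norm (f b * g b - f a * g a) \<le> (\<bar>A\<bar> + \<bar>B\<bar>) * (norm (f b - f a) + norm (g b - g a))"
      by (simp add: algebra_simps)
  qed simp
qed

lemma abs_continuous_diff:
  assumes "abs_continuous_on s t f" "abs_continuous_on s t g"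
  shows "abs_continuous_on s t (\<lambda>x. f x - g x)"
proof (rule abs_continuous_dominated[OF assms, of 1])
  fix a b
  have "f b - g b - (f a - g a) = (f b - f a) - (g b - g a)" by (simp add: algebra_simps)
  then show "norm (f b - g b - (f a - g a)) \<le> 1 * (norm (f b - f a) + norm (g b - g a))"
    by (metis norm_triangle_ineq4 mult_1)
qed simp

lemma abs_continuous_add:
  assumes "abs_continuous_on s t f" "abs_continuous_on s t g"
  shows "abs_continuous_on s t (\<lambda>x. f x + g x)"
  by (rule abs_continuous_dominated[OF assms, of 1]) (use norm_triangle_ineq in \<open>auto simp: add_diff_add\<close>)

lemma abs_continuous_cmult:
  fixes f :: "real \<Rightarrow> 'a::real_normed_algebra"
  assumes "abs_continuous_on s t f"
  shows "abs_continuous_on s t (\<lambda>x. c * f x)"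
proof (rule abs_continuous_dominated[OF assms assms, of "norm c"])
  fix a b
  have "norm (c * f b - c * f a) \<le> norm c * norm (f b - f a)"
    by (metis norm_mult_ineq right_diff_distrib)
  also have "\<dots> \<le> norm c * (norm (f b - f a) + norm (f b - f a))" by (intro mult_left_mono) auto
  finally show "norm (c * f b - c * f a) \<le> norm c * (norm (f b - f a) + norm (f b - f a))" .
qed simp

lemma abs_continuous_C1:
  fixes f :: "real \<Rightarrow> 'a::banach"
  assumes f: "\<And>x. x \<in> {s..t} \<Longrightarrow> (f has_vector_derivative f' x) (at x within {s..t})"
    and c: "continuous_on {s..t} f'"
  shows "abs_continuous_on s t f"
proof -
  have "bounded (f' ` {s..t})" using c by (intro compact_imp_bounded compact_continuous_image) auto
  then obtain B where B: "\<And>x. x \<in> {s..t} \<Longrightarrow> norm (f' x) \<le> B" unfolding bounded_iff by (metis imageI)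
  show ?thesis
  proof (rule abs_continuous_dominated[OF abs_continuous_id abs_continuous_id, of "\<bar>B\<bar>"])
    fix a b assume ab: "s \<le> a" "a \<le> b" "b \<le> t"
    have "(f' has_integral f b - f a) {a..b}"
      using ab by (intro fundamental_theorem_of_calculus)
        (auto intro: has_vector_derivative_within_subset[OF f])
    then have "norm (f b - f a) \<le> \<bar>B\<bar> * content (cbox a b)"
      using B ab by (intro has_integral_bound[where f = f']) (auto intro: order_trans[OF B])
    also have "\<dots> \<le> \<bar>B\<bar> * (norm (b - a) + norm (b - a))" using ab by (intro mult_left_mono) auto
    finally show "norm (f b - f a) \<le> \<bar>B\<bar> * (norm (b - a) + norm (b - a))" .
  qed simp
qed

text \<open>Dominated convergence: at each point the excess over k is zero for all large k, and |w|
  dominates it. This provides the level at which an integrable function is cut.\<close>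

lemma integral_truncation_small:
  fixes w :: "real \<Rightarrow> real"
  assumes w: "w absolutely_integrable_on {s..t}" and e: "0 < e"
  obtains M :: nat where "integral {s..t} (\<lambda>x. max 0 (w x - real M)) < e"
    "(\<lambda>x. max 0 (w x - real M)) integrable_on {s..t}"
proof -
  have ab: "(\<lambda>x. max 0 (w x - real k)) absolutely_integrable_on {s..t}" for k
    using w by (intro absolutely_integrable_max_1 set_integral_diff(1)) (auto intro: absolutely_integrable_continuous_real)
  have "(\<lambda>k. integral {s..t} (\<lambda>x. max 0 (w x - real k))) \<longlonglongrightarrow> integral {s..t} (\<lambda>x. 0)"
  proof (rule dominated_convergence(2)[where h = "\<lambda>x. \<bar>w x\<bar>"])
    show "(\<lambda>x. max 0 (w x - real k)) integrable_on {s..t}" for k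
      using ab by (rule set_lebesgue_integral_eq_integral(1))
    show "(\<lambda>x. \<bar>w x\<bar>) integrable_on {s..t}" using w by (simp add: absolutely_integrable_on_def)
    show "(\<lambda>k. max 0 (w x - real k)) \<longlonglongrightarrow> 0" for x
    proof (rule tendsto_eventually)
      obtain n where "w x \<le> real n" using real_arch_simple by blast
      then show "\<forall>\<^sub>F k in sequentially. max 0 (w x - real k) = 0"
        by (intro eventually_sequentiallyI[of n]) auto
    qed
  qed auto
  then have "\<forall>\<^sub>F k in sequentially. integral {s..t} (\<lambda>x. max 0 (w x - real k)) < e"
    using e by (intro order_tendstoD) auto
  then obtain M where "integral {s..t} (\<lambda>x. max 0 (w x - real M)) < e"
    by (meson eventually_sequentially order_refl)
  then show thesis using that set_lebesgue_integral_eq_integral(1)[OF ab] by blast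
qed

text \<open>Split $|g| \le M + (|g| - M)^+$: the first part contributes $M$ times the total length, and the second
  has small integral for large $M$.\<close>

theorem abs_continuous_integral:
  fixes g :: "real \<Rightarrow> 'a::euclidean_space"
  assumes g: "g absolutely_integrable_on {s..t}"
  shows "abs_continuous_on s t (\<lambda>x. integral {s..x} g)"
  unfolding abs_continuous_on_def
proof (intro allI impI)
  fix \<epsilon> :: real assume e: "0 < \<epsilon>"
  define w where "w = (\<lambda>x. norm (g x))"
  have gi: "g integrable_on {s..t}" and wi: "w integrable_on {s..t}"
    using g by (auto simp: absolutely_integrable_on_def w_def)
  have "w absolutely_integrable_on {s..t}" using g unfolding w_def by (rule set_integrable_norm)
  then obtain M where M: "integral {s..t} (\<lambda>x. max 0 (w x - real M)) < \<epsilon> / 2"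
    "(\<lambda>x. max 0 (w x - real M)) integrable_on {s..t}"
    using integral_truncation_small e half_gt_zero by blast
  define h where "h = (\<lambda>x. max 0 (w x - real M))"
  show "\<exists>\<delta>>0. \<forall>n (a::nat \<Rightarrow> real) b. (\<forall>i<n. s \<le> a i \<and> a i \<le> b i \<and> b i \<le> t) \<and>
        disjoint_family_on (\<lambda>i. {a i<..<b i}) {..<n} \<and> (\<Sum>i<n. b i - a i) < \<delta> \<longrightarrow>
        (\<Sum>i<n. norm (integral {s..b i} g - integral {s..a i} g)) < \<epsilon>"
  proof (intro exI[of _ "\<epsilon> / (2 * (real M + 1))"] conjI allI impI)
    show "0 < \<epsilon> / (2 * (real M + 1))" using e by simp
    fix n and a b :: "nat \<Rightarrow> real"
    assume A: "(\<forall>i<n. s \<le> a i \<and> a i \<le> b i \<and> b i \<le> t) \<and>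
        disjoint_family_on (\<lambda>i. {a i<..<b i}) {..<n} \<and> (\<Sum>i<n. b i - a i) < \<epsilon> / (2 * (real M + 1))"
    \<comment> \<open>Extended by zero, the pieces of \<open>h\<close> can be integrated over the
      whole interval. Disjointness leaves at most one nonzero term at each point, so their sum is
      bounded by \<open>h\<close>.\<close>
    define k where "k = (\<lambda>i x. if x \<in> {a i<..<b i} then h x else 0)"
    have k: "(k i has_integral integral {a i..b i} h) {s..t}" if i: "i < n" for i
    proof -
      have "h integrable_on {a i..b i}" using M(2) A i unfolding h_def by (intro integrable_on_subinterval) auto
      then have "(h has_integral integral {a i..b i} h) {a i<..<b i}"
        by (metis has_integral_open_interval integrable_integral box_real(1) cbox_interval)
      then show ?thesis unfolding k_def using A i by (subst has_integral_restrict) auto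
    qed
    have "norm (integral {s..b i} g - integral {s..a i} g) \<le> real M * (b i - a i) + integral {a i..b i} h" if i: "i < n" for i
    proof -
      have ab: "s \<le> a i" "a i \<le> b i" "b i \<le> t" using A i by auto
      have "integral {s..a i} g + integral {a i..b i} g = integral {s..b i} g"
        using ab by (intro Henstock_Kurzweil_Integration.integral_combine integrable_on_subinterval[OF gi]) auto
      then have "norm (integral {s..b i} g - integral {s..a i} g) = norm (integral {a i..b i} g)" by (metis add_diff_cancel_left')
      also have "\<dots> \<le> integral {a i..b i} (\<lambda>x. real M + h x)"
        using ab integrable_on_subinterval[OF gi, of "a i" "b i"] integrable_on_subinterval[OF M(2), of "a i" "b i"]
        by (intro integral_norm_bound_integral) (auto simp: h_def w_def intro!: integrable_add)
      also have "\<dots> = real M * (b i - a i) + integral {a i..b i} h"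
        using ab integrable_on_subinterval[OF M(2), of "a i" "b i"] by (subst integral_add) (auto simp: h_def)
      finally show ?thesis .
    qed
    then have "(\<Sum>i<n. norm (integral {s..b i} g - integral {s..a i} g)) \<le> (\<Sum>i<n. real M * (b i - a i) + integral {a i..b i} h)"
      by (intro sum_mono) auto
    also have "\<dots> = real M * (\<Sum>i<n. b i - a i) + (\<Sum>i<n. integral {a i..b i} h)"
      by (simp add: sum.distrib sum_distrib_left)
    also have "(\<Sum>i<n. integral {a i..b i} h) \<le> integral {s..t} h"
    proof (rule has_integral_le)
      show "((\<lambda>x. \<Sum>i<n. k i x) has_integral (\<Sum>i<n. integral {a i..b i} h)) {s..t}"
        using k by (intro has_integral_sum) auto
      show "(h has_integral integral {s..t} h) {s..t}" using M(2) by (simp add: h_def integrable_integral)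
      fix x
      show "(\<Sum>i<n. k i x) \<le> h x"
      proof (cases "\<exists>i<n. x \<in> {a i<..<b i}")
        case True
        then obtain i where i: "i < n" "x \<in> {a i<..<b i}" by blast
        have "k j x = 0" if j: "j \<in> {..<n} - {i}" for j
        proof -
          have "{a i<..<b i} \<inter> {a j<..<b j} = {}" using A i(1) j unfolding disjoint_family_on_def by auto
          then have "x \<notin> {a j<..<b j}" using i(2) by blast
          then show ?thesis unfolding k_def by (rule if_not_P)
        qed
        then have "(\<Sum>i<n. k i x) = k i x" using i by (subst sum.remove[of _ i]) auto
        then show ?thesis using i by (simp add: k_def)
      next
        case False
        then have "(\<Sum>i<n. k i x) = 0" by (intro sum.neutral) (auto simp: k_def)
        then show ?thesis by (simp add: h_def)
      qed
    qed
    also have "real M * (\<Sum>i<n. b i - a i) + integral {s..t} h < \<epsilon> / 2 + \<epsilon> / 2"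
    proof (rule add_le_less_mono)
      have "real M * (\<Sum>i<n. b i - a i) \<le> real M * (\<epsilon> / (2 * (real M + 1)))" using A by (intro mult_left_mono) auto
      also have "\<dots> \<le> \<epsilon> / 2" using e by (simp add: field_simps)
      finally show "real M * (\<Sum>i<n. b i - a i) \<le> \<epsilon> / 2" .
      show "integral {s..t} h < \<epsilon> / 2" using M(1) by (simp add: h_def)
    qed
    finally show "(\<Sum>i<n. norm (integral {s..b i} g - integral {s..a i} g)) < \<epsilon>" by simp
  qed
qed

section \<open>Solutions of the equation\<close>

text \<open>The equation in the form y'' = p y with complex p. This covers both q - \<mu> and the
  constant potential of the trigonometric comparison functions. The exceptional set is explicit so
  that it can be handed to the fundamental theorem; absolute continuity of \<open>y\<close> is
  recovered in \<open>solD\<close>, since \<open>y\<close> is continuously differentiable.\<close>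

definition sol :: "(real \<Rightarrow> complex) \<Rightarrow> (real \<Rightarrow> complex) \<Rightarrow> (real \<Rightarrow> complex) \<Rightarrow> bool" where
  "sol p y y' \<longleftrightarrow> abs_continuous_on 0 pi y' \<and>
     (\<forall>x\<in>{0..pi}. (y has_vector_derivative y' x) (at x within {0..pi})) \<and>
     (\<exists>N. negligible N \<and> (\<forall>x\<in>{0<..<pi} - N. (y' has_vector_derivative p x * y x) (at x)))"

lemma solD:
  assumes "sol p y y'"
  shows "abs_continuous_on 0 pi y'" "abs_continuous_on 0 pi y"
    "continuous_on {0..pi} y'" "continuous_on {0..pi} y"
    "\<And>x. x \<in> {0..pi} \<Longrightarrow> (y has_vector_derivative y' x) (at x within {0..pi})"
    "\<And>x. x \<in> {0<..<pi} \<Longrightarrow> (y has_vector_derivative y' x) (at x)"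
proof -
  show 1: "abs_continuous_on 0 pi y'" and 2: "\<And>x. x \<in> {0..pi} \<Longrightarrow> (y has_vector_derivative y' x) (at x within {0..pi})"
    using assms by (auto simp: sol_def)
  show 3: "continuous_on {0..pi} y'" by (rule abs_continuous_imp_continuous[OF 1])
  show 4: "abs_continuous_on 0 pi y" by (rule abs_continuous_C1[OF 2 3])
  show "continuous_on {0..pi} y" by (rule abs_continuous_imp_continuous[OF 4])
  fix x assume "x \<in> {0<..<pi}"
  then show "(y has_vector_derivative y' x) (at x)"
    using 2[of x] by (simp add: at_within_Icc_at)
qed

lemma sl_solution_iff_sol:
  "sl_solution q \<mu> y y' \<longleftrightarrow> sol (\<lambda>x. of_real (q x) - \<mu>) y y'"
proof -
  have ae: "(AE x in lebesgue_on {0<..<pi}. P x) \<longleftrightarrow> (\<exists>N. negligible N \<and> (\<forall>x\<in>{0<..<pi} - N. P x))" for P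
  proof -
    have "(AE x in lebesgue_on {0<..<pi}. P x) \<longleftrightarrow> (AE x in lebesgue. x \<in> {0<..<pi} \<longrightarrow> P x)"
      by (rule AE_restrict_space_iff) simp
    also have "\<dots> \<longleftrightarrow> (\<exists>N. negligible N \<and> (\<forall>x\<in>{0<..<pi} - N. P x))"
    proof
      assume "AE x in lebesgue. x \<in> {0<..<pi} \<longrightarrow> P x"
      then obtain N where "N \<in> null_sets lebesgue" "{x. \<not> (x \<in> {0<..<pi} \<longrightarrow> P x)} \<subseteq> N"
        by (auto simp: eventually_ae_filter)
      then show "\<exists>N. negligible N \<and> (\<forall>x\<in>{0<..<pi} - N. P x)"
        by (intro exI[of _ N]) (auto simp: negligible_iff_null_sets)
    next
      assume "\<exists>N. negligible N \<and> (\<forall>x\<in>{0<..<pi} - N. P x)"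
      then obtain N where "N \<in> null_sets lebesgue" "\<forall>x\<in>{0<..<pi} - N. P x" by (auto simp: negligible_iff_null_sets)
      then show "AE x in lebesgue. x \<in> {0<..<pi} \<longrightarrow> P x" by (intro AE_I'[of N]) auto
    qed
    finally show ?thesis .
  qed
  have eq: "(\<exists>y''. (y' has_vector_derivative y'') (at x) \<and> - y'' + of_real (q x) * y x = \<mu> * y x)
     \<longleftrightarrow> (y' has_vector_derivative (of_real (q x) - \<mu>) * y x) (at x)" for x
  proof -
    have h: "- z + of_real (q x) * y x = \<mu> * y x \<longleftrightarrow> z = (of_real (q x) - \<mu>) * y x" for z
      by (auto simp: algebra_simps)
    show ?thesis
    proof
      assume "\<exists>y''. (y' has_vector_derivative y'') (at x) \<and> - y'' + of_real (q x) * y x = \<mu> * y x"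
      then obtain z where z: "(y' has_vector_derivative z) (at x)" "z = (of_real (q x) - \<mu>) * y x"
        unfolding h by (elim exE conjE)
      show "(y' has_vector_derivative (of_real (q x) - \<mu>) * y x) (at x)" using z(1) unfolding z(2) .
    next
      assume d: "(y' has_vector_derivative (of_real (q x) - \<mu>) * y x) (at x)"
      show "\<exists>y''. (y' has_vector_derivative y'') (at x) \<and> - y'' + of_real (q x) * y x = \<mu> * y x"
        unfolding h by (rule exI, rule conjI, rule d, rule refl)
    qed
  qed
  show ?thesis
    unfolding sl_solution_def ae eq
    using solD(2)[of "\<lambda>x. of_real (q x) - \<mu>" y y'] unfolding sol_def by blast
qed

lemma sol_linear:
  assumes u: "sol p u u'" and v: "sol p v v'"
  shows "sol p (\<lambda>x. c * u x + d * v x) (\<lambda>x. c * u' x + d * v' x)"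
proof -
  obtain M N where M: "negligible M" "\<forall>x\<in>{0<..<pi} - M. (u' has_vector_derivative p x * u x) (at x)"
    and N: "negligible N" "\<forall>x\<in>{0<..<pi} - N. (v' has_vector_derivative p x * v x) (at x)"
    using u v unfolding sol_def by blast
  have "((\<lambda>x. c * u' x + d * v' x) has_vector_derivative p x * (c * u x + d * v x)) (at x)"
    if "x \<in> {0<..<pi} - (M \<union> N)" for x
  proof -
    have "((\<lambda>x. c * u' x + d * v' x) has_vector_derivative c * (p x * u x) + d * (p x * v x)) (at x)"
      using M N that by (intro has_vector_derivative_add has_vector_derivative_mult_right) auto
    then show ?thesis by (simp add: algebra_simps)
  qed
  then show ?thesis
    unfolding sol_def using M(1) N(1) solD(1,5)[OF u] solD(1,5)[OF v]
    by (intro conjI ballI exI[of _ "M \<union> N"] abs_continuous_add abs_continuous_cmult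
        has_vector_derivative_add has_vector_derivative_mult_right) auto
qed

lemma sol_cnj:
  assumes u: "sol p u u'"
  shows "sol (\<lambda>x. cnj (p x)) (\<lambda>x. cnj (u x)) (\<lambda>x. cnj (u' x))"
proof -
  obtain M where M: "negligible M" "\<forall>x\<in>{0<..<pi} - M. (u' has_vector_derivative p x * u x) (at x)"
    using u unfolding sol_def by blast
  have "abs_continuous_on 0 pi (\<lambda>x. cnj (u' x))"
    by (rule abs_continuous_dominated[OF solD(1)[OF u] solD(1)[OF u], of 1]) (simp_all flip: complex_cnj_diff)
  moreover have "((\<lambda>x. cnj (u' x)) has_vector_derivative cnj (p x) * cnj (u x)) (at x)" if "x \<in> {0<..<pi} - M" for x
    using has_vector_derivative_cnj[of u' "p x * u x" x UNIV] M(2) that by simp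
  moreover have "((\<lambda>x. cnj (u x)) has_vector_derivative cnj (u' x)) (at x within {0..pi})" if "x \<in> {0..pi}" for x
    using has_vector_derivative_cnj solD(5)[OF u that] by blast
  ultimately show ?thesis unfolding sol_def using M(1) by blast
qed

text \<open>Off the two exceptional sets the derivative of u'v - uv' is (p - r)uv, and absolute
  continuity permits integration. Later uses take p = r for Wronskians, r = -l^2 for variation of
  constants, and potentials differing by a constant for the dependence on \<mu>.\<close>

lemma lagrange_identity:
  assumes u: "sol p u u'" and v: "sol r v v'" and x: "x \<in> {0..pi}"
  shows "((\<lambda>t. (p t - r t) * u t * v t) has_integral
           (u' x * v x - u x * v' x) - (u' 0 * v 0 - u 0 * v' 0)) {0..x}"
proof -
  obtain M N where M: "negligible M" "\<forall>x\<in>{0<..<pi} - M. (u' has_vector_derivative p x * u x) (at x)"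
    and N: "negligible N" "\<forall>x\<in>{0<..<pi} - N. (v' has_vector_derivative r x * v x) (at x)"
    using u v unfolding sol_def by blast
  have "abs_continuous_on 0 pi (\<lambda>t. u' t * v t - u t * v' t)"
    using solD[OF u] solD[OF v] by (intro abs_continuous_diff abs_continuous_mult)
  then have ac: "abs_continuous_on 0 x (\<lambda>t. u' t * v t - u t * v' t)"
    by (rule abs_continuous_subinterval) (use x in auto)
  show ?thesis
  proof (rule fundamental_theorem_of_calculus_abs_continuous[OF ac, of "M \<union> N"])
    fix t assume t: "t \<in> {0<..<x} - (M \<union> N)"
    then have tp: "t \<in> {0<..<pi}" using x by auto
    have "((\<lambda>t. u' t * v t - u t * v' t) has_vector_derivative
        (u' t * v' t + p t * u t * v t) - (u t * (r t * v t) + u' t * v' t)) (at t)"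
      using t tp M N by (intro has_vector_derivative_diff has_vector_derivative_mult solD(6)[OF u tp] solD(6)[OF v tp]) auto
    then show "((\<lambda>t. u' t * v t - u t * v' t) has_vector_derivative (p t - r t) * u t * v t) (at t)"
      by (simp add: algebra_simps)
  qed (use x M N in \<open>auto simp: negligible_Un\<close>)
qed

lemma absolutely_integrable_mult_continuous:
  fixes p k :: "real \<Rightarrow> complex"
  assumes p: "p absolutely_integrable_on {a..b}" and k: "continuous_on {a..b} k"
  shows "(\<lambda>t. p t * k t) absolutely_integrable_on {a..b}"
proof -
  have "(\<lambda>t. k t * p t) absolutely_integrable_on {a..b}"
    by (intro absolutely_integrable_bounded_measurable_product[OF bilinear_times _ _ _ p]
        continuous_imp_measurable_on_sets_lebesgue k compact_imp_bounded compact_continuous_image) auto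
  then show ?thesis by (simp add: mult.commute)
qed

section \<open>Existence through a Volterra equation\<close>

text \<open>Integrating the weight exp(L s) gains the factor 1/L, and integrating against
  \<open>p\<close> costs at most Q. With L = 2 Q + 1 the factor is at most 1/2, which serves for
  existence here and for dependence on the spectral parameter in \<open>phi_close\<close>.\<close>

lemma volterra_bound:
  fixes p d :: "real \<Rightarrow> complex"
  assumes p: "p absolutely_integrable_on {0..pi}" and Q: "integral {0..pi} (\<lambda>t. norm (p t)) \<le> Q"
    and L: "0 < L" and D: "0 \<le> D" and d: "continuous_on {0..pi} d" and c: "c \<in> {0..pi}"
    and le: "\<And>s. s \<in> {0..c} \<Longrightarrow> norm (d s) \<le> D * exp (L * s)"
  shows "norm (integral {0..c} (\<lambda>t. p t * integral {0..t} d)) \<le> Q / L * D * exp (L * c)"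
proof -
  have di: "d integrable_on {0..t}" if "t \<in> {0..c}" for t
    using d that c by (intro integrable_continuous_interval continuous_on_subset[OF d]) auto
  have cont: "continuous_on {0..pi} (\<lambda>t. integral {0..t} d)"
    by (intro indefinite_integral_continuous_1 integrable_continuous_interval d)
  have 1: "norm (integral {0..t} d) \<le> D / L * exp (L * c)" if t: "t \<in> {0..c}" for t
  proof -
    have ex: "((\<lambda>s. D * exp (L * s)) has_integral D / L * exp (L * t) - D / L * exp (L * 0)) {0..t}"
    proof (rule fundamental_theorem_of_calculus)
      show "0 \<le> t" using t by simp
      fix s show "((\<lambda>s. D / L * exp (L * s)) has_vector_derivative D * exp (L * s)) (at s within {0..t})"
        unfolding has_real_derivative_iff_has_vector_derivative[symmetric]
        by (rule derivative_eq_intros refl | use L in simp)+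
    qed
    have "norm (integral {0..t} d) \<le> integral {0..t} (\<lambda>s. D * exp (L * s))"
      using ex t le by (intro integral_norm_bound_integral di) auto
    also have "\<dots> = D / L * exp (L * t) - D / L" by (subst integral_unique[OF ex]) simp
    also have "\<dots> \<le> D / L * exp (L * c)"
    proof -
      have "D / L * exp (L * t) \<le> D / L * exp (L * c)" using t L D by (intro mult_left_mono) auto
      moreover have "0 \<le> D / L" using L D by simp
      ultimately show ?thesis by linarith
    qed
    finally show ?thesis .
  qed
  have sub: "{0..c} \<subseteq> {0..pi}" using c by auto
  have pk: "(\<lambda>t. p t * integral {0..t} d) absolutely_integrable_on {0..c}"
    by (rule absolutely_integrable_on_subinterval[OF absolutely_integrable_mult_continuous[OF p cont]]) (use c in auto)
  have pn: "(\<lambda>t. norm (p t)) integrable_on {0..pi}" using p by (simp add: absolutely_integrable_on_def)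
  then have pn': "(\<lambda>t. norm (p t)) integrable_on {0..c}" by (rule integrable_on_subinterval[OF _ sub])
  have "norm (integral {0..c} (\<lambda>t. p t * integral {0..t} d)) \<le> integral {0..c} (\<lambda>t. norm (p t) * (D / L * exp (L * c)))"
  proof (rule integral_norm_bound_integral)
    show "(\<lambda>t. p t * integral {0..t} d) integrable_on {0..c}" using pk by (rule set_lebesgue_integral_eq_integral(1))
    show "(\<lambda>t. norm (p t) * (D / L * exp (L * c))) integrable_on {0..c}" by (rule integrable_on_mult_left[OF pn'])
    show "\<And>t. t \<in> {0..c} \<Longrightarrow> norm (p t * integral {0..t} d) \<le> norm (p t) * (D / L * exp (L * c))"
      unfolding norm_mult using 1 by (intro mult_left_mono) auto
  qed
  also have "\<dots> = integral {0..c} (\<lambda>t. norm (p t)) * (D / L * exp (L * c))" by simp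
  also have "\<dots> \<le> Q * (D / L * exp (L * c))"
  proof (rule mult_right_mono)
    have "integral {0..c} (\<lambda>t. norm (p t)) \<le> integral {0..pi} (\<lambda>t. norm (p t))"
      by (rule integral_subset_le[OF sub pn' pn]) auto
    then show "integral {0..c} (\<lambda>t. norm (p t)) \<le> Q" using Q by linarith
  qed (use D L in auto)
  finally show ?thesis by (simp add: field_simps)
qed

text \<open>The unknown is divided by the weight $e^{Lx}$ with $L$ large, so that the Volterra operator becomes a
  contraction of the bounded continuous functions.\<close>

lemma volterra_ex:
  fixes p :: "real \<Rightarrow> complex"
  assumes p: "p absolutely_integrable_on {0..pi}"
  obtains z where "continuous_on {0..pi} z"
    "\<And>x. x \<in> {0..pi} \<Longrightarrow> z x = b + integral {0..x} (\<lambda>t. p t * (a + integral {0..t} z))"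
proof -
  define Q where "Q = integral {0..pi} (\<lambda>t. norm (p t))"
  have Q: "0 \<le> Q" unfolding Q_def
    by (rule integral_nonneg) (use p in \<open>auto simp: absolutely_integrable_on_def\<close>)
  define L where "L = 2 * Q + 1"
  have L: "0 < L" using Q by (simp add: L_def)
  \<comment> \<open>Clamping to [0,\<pi>] extends functions on the interval to bounded continuous
    functions on the line, the type on which the fixed point theorem is applied.\<close>
  define cl :: "real \<Rightarrow> real" where "cl = (\<lambda>x. max 0 (min x pi))"
  have cl: "cl x \<in> {0..pi}" "x \<in> {0..pi} \<Longrightarrow> cl x = x" for x by (auto simp: cl_def)
  have clc: "continuous_on UNIV cl" unfolding cl_def by (intro continuous_intros)
  \<comment> \<open>\<open>e Z\<close> restores the weight removed from the unknown. The function so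
    obtained stands for y', and a plus its integral stands for y.\<close>
  define e where "e = (\<lambda>(Z :: real \<Rightarrow>\<^sub>C complex) s. exp (L * s) *\<^sub>R apply_bcontfun Z s)"
  have ec: "continuous_on S (e Z)" for Z S
    unfolding e_def by (intro continuous_intros continuous_on_apply_bcontfun)
  have ei: "e Z integrable_on {0..t}" for Z t by (intro integrable_continuous_interval ec)
  define g where "g = (\<lambda>Z x. b + integral {0..x} (\<lambda>t. p t * (a + integral {0..t} (e Z))))"
  have ai: "(\<lambda>t. p t * (a + integral {0..t} (e Z))) integrable_on {0..pi}" for Z
    by (intro set_lebesgue_integral_eq_integral(1) absolutely_integrable_mult_continuous[OF p] continuous_intros
        indefinite_integral_continuous_1 ei)
  have gc: "continuous_on {0..pi} (g Z)" for Z
    unfolding g_def by (intro continuous_intros indefinite_integral_continuous_1 ai)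
  define h where "h = (\<lambda>Z x. exp (- L * cl x) *\<^sub>R g Z (cl x))"
  have hb: "h Z \<in> bcontfun" for Z
  proof -
    have c1: "continuous_on {0..pi} (\<lambda>x. exp (- L * x) *\<^sub>R g Z x)" by (intro continuous_intros gc)
    have "continuous_on UNIV (h Z)"
      unfolding h_def by (rule continuous_on_compose2[OF c1 clc]) (use cl in auto)
    moreover have "bounded (range (h Z))"
    proof (rule bounded_subset)
      show "bounded ((\<lambda>x. exp (- L * x) *\<^sub>R g Z x) ` {0..pi})"
        by (intro compact_imp_bounded compact_continuous_image c1) auto
    qed (use cl in \<open>auto simp: h_def\<close>)
    ultimately show ?thesis by (simp add: bcontfun_def)
  qed
  define T where "T = (\<lambda>Z. Bcontfun (h Z))"
  have Tap: "apply_bcontfun (T Z) = h Z" for Z unfolding T_def using hb by (simp add: Bcontfun_inverse)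
  have "dist (T Z) (T Y) \<le> 1/2 * dist Z Y" for Z Y
  proof (rule dist_bound)
    fix x
    define c where "c = cl x"
    have c: "c \<in> {0..pi}" using cl by (simp add: c_def)
    have "g Z c - g Y c = integral {0..c} (\<lambda>t. p t * (a + integral {0..t} (e Z)) - p t * (a + integral {0..t} (e Y)))"
      unfolding g_def using c by (subst Henstock_Kurzweil_Integration.integral_diff) (auto intro!: integrable_on_subinterval[OF ai])
    also have "\<dots> = integral {0..c} (\<lambda>t. p t * integral {0..t} (\<lambda>s. e Z s - e Y s))"
      by (intro integral_cong) (simp add: Henstock_Kurzweil_Integration.integral_diff ei algebra_simps)
    finally have eq: "g Z c - g Y c = \<dots>" .
    have "norm (g Z c - g Y c) \<le> Q / L * dist Z Y * exp (L * c)"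
      unfolding eq
    proof (rule volterra_bound[OF p _ L _ _ c])
      fix s :: real
      have "norm (e Z s - e Y s) = exp (L * s) * dist (apply_bcontfun Z s) (apply_bcontfun Y s)"
        by (simp add: e_def dist_norm flip: scaleR_diff_right)
      also have "\<dots> \<le> exp (L * s) * dist Z Y" by (intro mult_left_mono dist_bounded) auto
      finally show "norm (e Z s - e Y s) \<le> dist Z Y * exp (L * s)" by (simp add: mult.commute)
    qed (auto simp: Q_def intro!: continuous_intros ec)
    then have "exp (- L * c) * norm (g Z c - g Y c) \<le> exp (- L * c) * (Q / L * dist Z Y * exp (L * c))"
      by (intro mult_left_mono) auto
    also have "\<dots> = Q / L * dist Z Y" by (simp add: exp_minus field_simps)
    also have "\<dots> \<le> 1/2 * dist Z Y" by (intro mult_right_mono) (use Q in \<open>auto simp: L_def field_simps\<close>)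
    finally show "dist (apply_bcontfun (T Z) x) (apply_bcontfun (T Y) x) \<le> 1/2 * dist Z Y"
      unfolding Tap h_def c_def[symmetric] by (simp add: dist_norm flip: scaleR_diff_right)
  qed
  then have "\<exists>!Z. T Z = Z" by (intro banach_fix_type[of "1/2"]) auto
  then obtain Z where Z: "T Z = Z" by blast
  show thesis
  proof (rule that[of "e Z"])
    show "continuous_on {0..pi} (e Z)" by (rule ec)
    fix x assume x: "x \<in> {0..pi}"
    have "apply_bcontfun Z x = h Z x" using Tap Z by metis
    then have "e Z x = exp (L * x) *\<^sub>R (exp (- L * x) *\<^sub>R g Z x)" using cl(2)[OF x] by (simp add: e_def h_def)
    then have "e Z x = g Z x" by (simp flip: exp_add)
    then show "e Z x = b + integral {0..x} (\<lambda>t. p t * (a + integral {0..t} (e Z)))" by (simp add: g_def)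
  qed
qed

lemma sol_ex:
  assumes p: "p absolutely_integrable_on {0..pi}"
  obtains y y' where "sol p y y'" "y 0 = a" "y' 0 = b"
proof -
  obtain z where z: "continuous_on {0..pi} z"
    "\<And>x. x \<in> {0..pi} \<Longrightarrow> z x = b + integral {0..x} (\<lambda>t. p t * (a + integral {0..t} z))"
    using volterra_ex[OF p] by blast
  define y where "y = (\<lambda>x. a + integral {0..x} z)"
  \<comment> \<open>\<open>w\<close> equals \<open>z\<close> on the interval, but as an indefinite
    integral it is visibly absolutely continuous, with derivative p y almost everywhere.\<close>
  define w where "w = (\<lambda>x. b + integral {0..x} (\<lambda>t. p t * y t))"
  have wz: "w x = z x" if "x \<in> {0..pi}" for x using z(2)[OF that] by (simp add: w_def y_def)
  have yc: "continuous_on {0..pi} y"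
    unfolding y_def by (intro continuous_intros indefinite_integral_continuous_1 integrable_continuous_interval z)
  have py: "(\<lambda>t. p t * y t) absolutely_integrable_on {0..pi}" by (rule absolutely_integrable_mult_continuous[OF p yc])
  obtain N where N: "negligible N" "\<And>x. x \<in> {0<..<pi} - N \<Longrightarrow>
      ((\<lambda>x. integral {0..x} (\<lambda>t. p t * y t)) has_vector_derivative p x * y x) (at x)"
    using has_vector_derivative_integral_ae[OF set_lebesgue_integral_eq_integral(1)[OF py]] by blast
  have "sol p y w"
    unfolding sol_def
  proof (intro conjI ballI exI[of _ N])
    show "abs_continuous_on 0 pi w"
      by (rule abs_continuous_dominated[OF abs_continuous_integral[OF py] abs_continuous_integral[OF py], of 1])
        (auto simp: w_def)
    fix x assume x: "x \<in> {0..pi}"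
    show "(y has_vector_derivative w x) (at x within {0..pi})"
      unfolding wz[OF x] y_def
      using has_vector_derivative_add[OF has_vector_derivative_const integral_has_vector_derivative[OF z(1) x]]
      by (simp only: add_0_left)
  next
    fix x assume "x \<in> {0<..<pi} - N"
    then show "(w has_vector_derivative p x * y x) (at x)"
      unfolding w_def using has_vector_derivative_add[OF has_vector_derivative_const N(2)] by simp
  qed (rule N)
  moreover have "y 0 = a" "w 0 = b" by (auto simp: y_def w_def)
  ultimately show thesis using that by blast
qed

section \<open>Wronskians and uniqueness\<close>

lemma wronskian_const:
  assumes u: "sol p u u'" and v: "sol p v v'" and x: "x \<in> {0..pi}"
  shows "u' x * v x - u x * v' x = u' 0 * v 0 - u 0 * v' 0"
proof -
  have "((\<lambda>t. 0) has_integral (u' x * v x - u x * v' x) - (u' 0 * v 0 - u 0 * v' 0)) {0..x}"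
    using lagrange_identity[OF u v x] by simp
  from has_integral_unique[OF this has_integral_0] show ?thesis by simp
qed

text \<open>The solutions with initial data (1,0) and (0,1). Since their Wronskian is 1 at every
  point, Cramer's rule expresses a solution through its value and derivative anywhere, which gives
  uniqueness and solvability from an arbitrary point.\<close>

lemma sol_basis:
  assumes p: "p absolutely_integrable_on {0..pi}"
  obtains c c' s s' where "sol p c c'" "sol p s s'" "\<And>x. x \<in> {0..pi} \<Longrightarrow> c x * s' x - c' x * s x = 1"
proof -
  obtain c c' where c: "sol p c c'" "c 0 = 1" "c' 0 = 0" using sol_ex[OF p] by blast
  obtain s s' where s: "sol p s s'" "s 0 = 0" "s' 0 = 1" using sol_ex[OF p] by blast
  show thesis
  proof (rule that[OF c(1) s(1)])
    fix x assume "x \<in> {0..pi}"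
    from wronskian_const[OF c(1) s(1) this] show "c x * s' x - c' x * s x = 1" using c s by (simp add: algebra_simps)
  qed
qed

text \<open>The difference of the solutions has constant Wronskians with both basis solutions. They
  vanish at \<open>a\<close>, hence everywhere, and the unit Wronskian of the basis lets the
  difference and its derivative be recovered from them.\<close>

lemma sol_unique:
  assumes p: "p absolutely_integrable_on {0..pi}" and u: "sol p u u'" and v: "sol p v v'"
    and a: "a \<in> {0..pi}" "u a = v a" "u' a = v' a" and x: "x \<in> {0..pi}"
  shows "u x = v x" "u' x = v' x"
proof -
  obtain c c' s s' where b: "sol p c c'" "sol p s s'" "\<And>x. x \<in> {0..pi} \<Longrightarrow> c x * s' x - c' x * s x = 1"
    using sol_basis[OF p] by blast
  define d d' where "d = (\<lambda>x. 1 * u x + (-1) * v x)" and "d' = (\<lambda>x. 1 * u' x + (-1) * v' x)"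
  have d: "sol p d d'" unfolding d_def d'_def by (rule sol_linear[OF u v])
  have d0: "d a = 0" "d' a = 0" using a by (auto simp: d_def d'_def)
  have 1: "d' x * c x - d x * c' x = 0"
    using wronskian_const[OF d b(1) x] wronskian_const[OF d b(1) a(1)] d0 by simp
  have 2: "d' x * s x - d x * s' x = 0"
    using wronskian_const[OF d b(2) x] wronskian_const[OF d b(2) a(1)] d0 by simp
  have "d x = d x * (c x * s' x - c' x * s x)" using b(3)[OF x] by simp
  also have "\<dots> = (d' x * c x - d x * c' x) * s x - (d' x * s x - d x * s' x) * c x" by (simp add: algebra_simps)
  finally have "d x = 0" using 1 2 by simp
  have "d' x = d' x * (c x * s' x - c' x * s x)" using b(3)[OF x] by simp
  also have "\<dots> = (d' x * c x - d x * c' x) * s' x - (d' x * s x - d x * s' x) * c' x" by (simp add: algebra_simps)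
  finally have "d' x = 0" using 1 2 by simp
  show "u x = v x" "u' x = v' x" using \<open>d x = 0\<close> \<open>d' x = 0\<close> by (auto simp: d_def d'_def)
qed

lemma sol_ex_at:
  assumes p: "p absolutely_integrable_on {0..pi}" and x: "x \<in> {0..pi}"
  obtains y y' where "sol p y y'" "y x = a" "y' x = b"
proof -
  obtain c c' s s' where v: "sol p c c'" "sol p s s'" "\<And>x. x \<in> {0..pi} \<Longrightarrow> c x * s' x - c' x * s x = 1"
    using sol_basis[OF p] by blast
  have W: "c x * s' x - c' x * s x = 1" by (rule v(3)[OF x])
  show thesis
  proof (rule that[OF sol_linear[OF v(1,2), of "a * s' x - b * s x" "b * c x - a * c' x"]])
    have "(a * s' x - b * s x) * c x + (b * c x - a * c' x) * s x = a * (c x * s' x - c' x * s x)"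
      by (simp add: algebra_simps)
    then show "(a * s' x - b * s x) * c x + (b * c x - a * c' x) * s x = a" using W by simp
    have "(a * s' x - b * s x) * c' x + (b * c x - a * c' x) * s' x = b * (c x * s' x - c' x * s x)"
      by (simp add: algebra_simps)
    then show "(a * s' x - b * s x) * c' x + (b * c x - a * c' x) * s' x = b" using W by simp
  qed
qed

lemma sol_has_integral:
  assumes u: "sol p u u'" and x: "x \<in> {0..pi}"
  shows "((\<lambda>t. p t * u t) has_integral u' x - u' 0) {0..x}"
    and "(u' has_integral u x - u 0) {0..x}"
proof -
  obtain N where N: "negligible N" "\<forall>x\<in>{0<..<pi} - N. (u' has_vector_derivative p x * u x) (at x)"
    using u unfolding sol_def by blast
  have ac: "abs_continuous_on 0 x u'"
    by (rule abs_continuous_subinterval[OF solD(1)[OF u]]) (use x in auto)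
  show "((\<lambda>t. p t * u t) has_integral u' x - u' 0) {0..x}"
    by (rule fundamental_theorem_of_calculus_abs_continuous[OF ac _ N(1)]) (use x N in auto)
  show "(u' has_integral u x - u 0) {0..x}"
    by (rule fundamental_theorem_of_calculus)
      (use x in \<open>auto intro: has_vector_derivative_within_subset[OF solD(5)[OF u]]\<close>)
qed

section \<open>The characteristic function\<close>

locale sl_potential =
  fixes q :: "real \<Rightarrow> real"
  assumes q: "q absolutely_integrable_on {0..pi}"
begin

abbreviation pot :: "complex \<Rightarrow> real \<Rightarrow> complex" where
  "pot \<mu> \<equiv> (\<lambda>x. of_real (q x) - \<mu>)"

lemma q_complex: "(\<lambda>x. complex_of_real (q x)) absolutely_integrable_on {0..pi}"
  using absolutely_integrable_linear[OF q bounded_linear_of_real] by (simp add: o_def)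

lemma pot: "pot \<mu> absolutely_integrable_on {0..pi}"
  by (intro set_integral_diff(1) q_complex absolutely_integrable_continuous_real) auto

text \<open>Solution and derivative are chosen together, so that they belong to each other. The
  initial vector (sin \<alpha>, -cos \<alpha>) is a unit vector spanning the data allowed by the
  boundary condition at 0.\<close>

definition phi_pair :: "real \<Rightarrow> complex \<Rightarrow> (real \<Rightarrow> complex) \<times> (real \<Rightarrow> complex)" where
  "phi_pair \<alpha> \<mu> = (SOME z. sol (pot \<mu>) (fst z) (snd z) \<and> fst z 0 = of_real (sin \<alpha>) \<and> snd z 0 = - of_real (cos \<alpha>))"

definition phi where "phi \<alpha> \<mu> = fst (phi_pair \<alpha> \<mu>)"
definition dphi where "dphi \<alpha> \<mu> = snd (phi_pair \<alpha> \<mu>)"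

lemma phi: "sol (pot \<mu>) (phi \<alpha> \<mu>) (dphi \<alpha> \<mu>)"
  "phi \<alpha> \<mu> 0 = of_real (sin \<alpha>)" "dphi \<alpha> \<mu> 0 = - of_real (cos \<alpha>)"
proof -
  obtain y y' where "sol (pot \<mu>) y y'" "y 0 = of_real (sin \<alpha>)" "y' 0 = - of_real (cos \<alpha>)"
    using sol_ex[OF pot] by blast
  then have "\<exists>z. sol (pot \<mu>) (fst z) (snd z) \<and> fst z 0 = of_real (sin \<alpha>) \<and> snd z 0 = - of_real (cos \<alpha>)"
    by (intro exI[of _ "(y,y')"]) auto
  from someI_ex[OF this] show "sol (pot \<mu>) (phi \<alpha> \<mu>) (dphi \<alpha> \<mu>)"
    "phi \<alpha> \<mu> 0 = of_real (sin \<alpha>)" "dphi \<alpha> \<mu> 0 = - of_real (cos \<alpha>)"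
    by (auto simp: phi_def dphi_def phi_pair_def)
qed

definition chr :: "real \<Rightarrow> real \<Rightarrow> complex \<Rightarrow> complex" where
  "chr \<alpha> \<beta> \<mu> = phi \<alpha> \<mu> pi * of_real (cos \<beta>) + dphi \<alpha> \<mu> pi * of_real (sin \<beta>)"

lemma phi_nontrivial: "\<exists>x\<in>{0..pi}. phi \<alpha> \<mu> x \<noteq> 0"
proof (rule ccontr)
  assume "\<not> ?thesis"
  then have z: "\<And>x. x \<in> {0..pi} \<Longrightarrow> phi \<alpha> \<mu> x = 0" by auto
  have "(phi \<alpha> \<mu> has_vector_derivative dphi \<alpha> \<mu> 0) (at 0 within {0..pi})"
    by (rule solD(5)[OF phi(1)]) auto
  then have "((\<lambda>x. 0) has_vector_derivative dphi \<alpha> \<mu> 0) (at 0 within {0..pi})"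
    by (rule has_vector_derivative_transform[rotated 2]) (use z in auto)
  moreover have "((\<lambda>x. 0::complex) has_vector_derivative 0) (at 0 within {0..pi})" by simp
  ultimately have "dphi \<alpha> \<mu> 0 = 0"
    using vector_derivative_unique_within_closed_interval[of 0 pi 0 "\<lambda>x. 0" "dphi \<alpha> \<mu> 0" 0] by simp
  then have "cos \<alpha> = 0" "sin \<alpha> = 0" using phi(2,3)[of \<alpha> \<mu>] z[of 0] by auto
  then show False using sin_cos_squared_add[of \<alpha>] by simp
qed

lemma eigenvalue_iff_chr: "sl_eigenvalue q \<alpha> \<beta> \<mu> \<longleftrightarrow> chr \<alpha> \<beta> \<mu> = 0"
proof
  assume "chr \<alpha> \<beta> \<mu> = 0"
  then show "sl_eigenvalue q \<alpha> \<beta> \<mu>"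
    unfolding sl_eigenvalue_def sl_solution_iff_sol
    using phi phi_nontrivial by (intro exI[of _ "phi \<alpha> \<mu>"] exI[of _ "dphi \<alpha> \<mu>"]) (simp add: chr_def)
next
  assume "sl_eigenvalue q \<alpha> \<beta> \<mu>"
  then obtain y y' where y: "sol (pot \<mu>) y y'" "\<exists>x\<in>{0..pi}. y x \<noteq> 0"
    "y 0 * of_real (cos \<alpha>) + y' 0 * of_real (sin \<alpha>) = 0" "y pi * of_real (cos \<beta>) + y' pi * of_real (sin \<beta>) = 0"
    unfolding sl_eigenvalue_def sl_solution_iff_sol by blast
  \<comment> \<open>The component of the initial vector of \<open>y\<close> along (sin \<alpha>,
    -cos \<alpha>); the boundary condition says that the orthogonal component is zero, so
    \<open>y\<close> is k times \<open>phi\<close>.\<close>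
  define k where "k = y 0 * of_real (sin \<alpha>) - y' 0 * of_real (cos \<alpha>)"
  define S C where "S = complex_of_real (sin \<alpha>)" and "C = complex_of_real (cos \<alpha>)"
  have SC: "S * S + C * C = 1"
    unfolding S_def C_def of_real_mult[symmetric] of_real_add[symmetric] using sin_cos_squared_add3[of \<alpha>] by (simp add: add.commute)
  have bc: "y 0 * C + y' 0 * S = 0" using y(3) by (simp add: S_def C_def)
  have "k * S = y 0 * (S * S + C * C) - C * (y 0 * C + y' 0 * S)" unfolding k_def S_def[symmetric] C_def[symmetric]
    by (simp add: algebra_simps)
  then have k1: "y 0 = k * S" using SC bc by simp
  have "- (k * C) = y' 0 * (S * S + C * C) - S * (y 0 * C + y' 0 * S)" unfolding k_def S_def[symmetric] C_def[symmetric]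
    by (simp add: algebra_simps)
  then have k2: "y' 0 = - (k * C)" using SC bc by simp
  have s: "sol (pot \<mu>) (\<lambda>x. k * phi \<alpha> \<mu> x + 0 * phi \<alpha> \<mu> x) (\<lambda>x. k * dphi \<alpha> \<mu> x + 0 * dphi \<alpha> \<mu> x)"
    by (rule sol_linear[OF phi(1) phi(1)])
  have eq: "y x = k * phi \<alpha> \<mu> x + 0 * phi \<alpha> \<mu> x" "y' x = k * dphi \<alpha> \<mu> x + 0 * dphi \<alpha> \<mu> x" if "x \<in> {0..pi}" for x
    using sol_unique[OF pot y(1) s _ _ _ that, of 0] k1 k2 by (auto simp: phi S_def C_def)
  have "k \<noteq> 0" using y(2) eq(1) by auto
  moreover have "k * chr \<alpha> \<beta> \<mu> = 0" using y(4) eq[of pi] by (simp add: chr_def algebra_simps)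
  ultimately show "chr \<alpha> \<beta> \<mu> = 0" by simp
qed

text \<open>A solution normalized at the right end. In the Lagrange identity it turns the boundary
  term of \<open>phi\<close> at \<pi> into the characteristic function.\<close>

lemma terminal_ex:
  obtains \<psi> \<psi>' where "sol (pot \<mu>) \<psi> \<psi>'" "\<psi> pi = of_real (sin \<beta>)" "\<psi>' pi = - of_real (cos \<beta>)"
  using sol_ex_at[OF pot, where x = pi and a = "of_real (sin \<beta>)" and b = "- of_real (cos \<beta>)"] that by auto

text \<open>In the Lagrange identity for \<open>phi\<close> at \<nu> and \<psi> at \<mu>, the term
  at \<pi> is \<open>chr\<close> at \<nu> and the term at 0 is a number K not depending on \<nu>.
  Subtracting the cases \<nu> and \<nu> = \<mu> removes K.\<close>

lemma chr_diff:
  assumes \<psi>: "sol (pot \<mu>) \<psi> \<psi>'" "\<psi> pi = of_real (sin \<beta>)" "\<psi>' pi = - of_real (cos \<beta>)"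
  shows "chr \<alpha> \<beta> \<nu> - chr \<alpha> \<beta> \<mu> = - (\<nu> - \<mu>) * integral {0..pi} (\<lambda>t. phi \<alpha> \<nu> t * \<psi> t)"
proof -
  define K where "K = - of_real (cos \<alpha>) * \<psi> 0 - of_real (sin \<alpha>) * \<psi>' 0"
  have *: "chr \<alpha> \<beta> \<nu> = K - (\<nu> - \<mu>) * integral {0..pi} (\<lambda>t. phi \<alpha> \<nu> t * \<psi> t)" for \<nu>
  proof -
    have "((\<lambda>t. (\<mu> - \<nu>) * (phi \<alpha> \<nu> t * \<psi> t)) has_integral chr \<alpha> \<beta> \<nu> - K) {0..pi}"
      using lagrange_identity[OF phi(1)[of \<nu> \<alpha>] \<psi>(1), of pi] \<psi>(2,3) phi(2,3)[of \<alpha> \<nu>]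
      by (simp add: chr_def K_def algebra_simps)
    then have "chr \<alpha> \<beta> \<nu> - K = integral {0..pi} (\<lambda>t. (\<mu> - \<nu>) * (phi \<alpha> \<nu> t * \<psi> t))" by (rule integral_unique[symmetric])
    then have "chr \<alpha> \<beta> \<nu> - K = (\<mu> - \<nu>) * integral {0..pi} (\<lambda>t. phi \<alpha> \<nu> t * \<psi> t)"
      by (simp only: integral_mult_right)
    then show ?thesis by (simp add: algebra_simps)
  qed
  show ?thesis using *[of \<nu>] *[of \<mu>] by (simp add: algebra_simps)
qed

text \<open>Lipschitz dependence on the spectral parameter, uniform in x. The difference
  \<open>d\<close> of the derivatives satisfies a Volterra equation with a forcing term of size
  |\<nu> - \<mu>|. At the point c where exp(-L s)|d(s)| is largest, the integral term is at most
  half of the left side and can be absorbed.\<close>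

lemma phi_close:
  obtains B where "0 \<le> B" "\<And>\<nu> x. \<lbrakk>norm (\<nu> - \<mu>) \<le> 1; x \<in> {0..pi}\<rbrakk> \<Longrightarrow> norm (phi \<alpha> \<nu> x - phi \<alpha> \<mu> x) \<le> B * norm (\<nu> - \<mu>)"
proof -
  obtain M where M: "\<And>x. x \<in> {0..pi} \<Longrightarrow> norm (phi \<alpha> \<mu> x) \<le> M"
    using compact_imp_bounded[OF compact_continuous_image[OF solD(4)[OF phi(1)] compact_Icc]]
    unfolding bounded_iff by (metis imageI)
  have M0: "0 \<le> M" using M[of 0] norm_ge_zero by (metis atLeastAtMost_iff order_refl order_trans pi_ge_zero)
  \<comment> \<open>Bounds the L1 norm of \<open>pot \<nu>\<close> for all \<nu> within distance 1
    of \<mu>, so that one L works for all of them.\<close>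
  define Q where "Q = integral {0..pi} (\<lambda>t. \<bar>q t\<bar> + (norm \<mu> + 1))"
  have qi: "(\<lambda>t. \<bar>q t\<bar> + (norm \<mu> + 1)) integrable_on {0..pi}"
    using q by (intro integrable_add) (auto simp: absolutely_integrable_on_def)
  have Q0: "0 \<le> Q" unfolding Q_def by (rule integral_nonneg[OF qi]) auto
  define L where "L = 2 * Q + 1"
  have L: "0 < L" "1 \<le> L" using Q0 by (auto simp: L_def)
  show thesis
  proof (rule that[of "pi * (2 * pi * M) * exp (L * pi)"])
    show "0 \<le> pi * (2 * pi * M) * exp (L * pi)" using M0 by simp
    fix \<nu> x assume nu: "norm (\<nu> - \<mu>) \<le> 1" and x: "x \<in> {0..pi}"
    have Q: "integral {0..pi} (\<lambda>t. norm (pot \<nu> t)) \<le> Q"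
      unfolding Q_def
    proof (rule integral_le)
      show "(\<lambda>t. norm (pot \<nu> t)) integrable_on {0..pi}" using pot by (simp add: absolutely_integrable_on_def)
      fix t
      have "norm (pot \<nu> t) \<le> \<bar>q t\<bar> + norm \<nu>" by (metis norm_triangle_ineq4 norm_of_real)
      moreover have "norm \<nu> \<le> norm \<mu> + 1" using nu norm_triangle_ineq2[of \<nu> \<mu>] by linarith
      ultimately show "norm (pot \<nu> t) \<le> \<bar>q t\<bar> + (norm \<mu> + 1)" by linarith
    qed (rule qi)
    define d where "d = (\<lambda>x. dphi \<alpha> \<nu> x - dphi \<alpha> \<mu> x)"
    have dc: "continuous_on {0..pi} d" unfolding d_def by (intro continuous_intros solD(3)[OF phi(1)])
    have dI: "integral {0..t} d = phi \<alpha> \<nu> t - phi \<alpha> \<mu> t" if "t \<in> {0..pi}" for t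
      using integral_unique[OF has_integral_diff[OF sol_has_integral(2)[OF phi(1)[of \<nu> \<alpha>] that] sol_has_integral(2)[OF phi(1)[of \<mu> \<alpha>] that]]]
      unfolding d_def by (simp add: phi)
    have "continuous_on {0..pi} (\<lambda>s. norm (d s) * exp (- (L * s)))" by (intro continuous_intros dc)
    then obtain c where c: "c \<in> {0..pi}" "\<And>s. s \<in> {0..pi} \<Longrightarrow> norm (d s) * exp (- (L * s)) \<le> norm (d c) * exp (- (L * c))"
      using continuous_attains_sup[OF compact_Icc, of 0 pi "\<lambda>s. norm (d s) * exp (- (L * s))"] by auto
    define D where "D = norm (d c) * exp (- (L * c))"
    have D0: "0 \<le> D" by (simp add: D_def)
    have Dc: "norm (d c) = D * exp (L * c)" by (simp add: D_def flip: exp_add)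
    have Ds: "norm (d s) \<le> D * exp (L * s)" if "s \<in> {0..pi}" for s
    proof -
      have "norm (d s) = (norm (d s) * exp (- (L * s))) * exp (L * s)" by (simp flip: exp_add)
      also have "\<dots> \<le> D * exp (L * s)" using c(2)[OF that] unfolding D_def by (intro mult_right_mono) auto
      finally show ?thesis .
    qed
    have vb: "norm (integral {0..c} (\<lambda>t. pot \<nu> t * integral {0..t} d)) \<le> Q / L * D * exp (L * c)"
      by (rule volterra_bound[OF pot Q L(1) D0 dc c(1)]) (use Ds c(1) in auto)
    have h1: "((\<lambda>t. pot \<nu> t * phi \<alpha> \<nu> t - pot \<mu> t * phi \<alpha> \<mu> t) has_integral d c) {0..c}"
      using has_integral_diff[OF sol_has_integral(1)[OF phi(1)[of \<nu> \<alpha>] c(1)] sol_has_integral(1)[OF phi(1)[of \<mu> \<alpha>] c(1)]]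
      by (simp add: d_def phi)
    have ci: "phi \<alpha> \<mu> integrable_on {0..c}"
      using c(1) by (intro integrable_continuous_interval continuous_on_subset[OF solD(4)[OF phi(1)]]) auto
    have h2: "((\<lambda>t. (\<nu> - \<mu>) * phi \<alpha> \<mu> t) has_integral (\<nu> - \<mu>) * integral {0..c} (phi \<alpha> \<mu>)) {0..c}"
      by (intro has_integral_mult_right integrable_integral ci)
    have "((\<lambda>t. pot \<nu> t * (phi \<alpha> \<nu> t - phi \<alpha> \<mu> t)) has_integral d c + (\<nu> - \<mu>) * integral {0..c} (phi \<alpha> \<mu>)) {0..c}"
      using has_integral_add[OF h1 h2] by (simp add: algebra_simps)
    then have "d c + (\<nu> - \<mu>) * integral {0..c} (phi \<alpha> \<mu>) = integral {0..c} (\<lambda>t. pot \<nu> t * (phi \<alpha> \<nu> t - phi \<alpha> \<mu> t))"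
      by (simp add: integral_unique)
    also have "\<dots> = integral {0..c} (\<lambda>t. pot \<nu> t * integral {0..t} d)"
      by (rule integral_cong) (use dI c(1) in auto)
    finally have dd: "d c = integral {0..c} (\<lambda>t. pot \<nu> t * integral {0..t} d) - (\<nu> - \<mu>) * integral {0..c} (phi \<alpha> \<mu>)"
      by (simp add: algebra_simps)
    have mm: "norm (integral {0..c} (phi \<alpha> \<mu>)) \<le> M * pi"
    proof -
      have "norm (integral {0..c} (phi \<alpha> \<mu>)) \<le> M * (c - 0)"
        by (rule integral_bound) (use c(1) M in \<open>auto intro!: continuous_on_subset[OF solD(4)[OF phi(1)]]\<close>)
      also have "\<dots> \<le> M * pi" using c(1) M0 by (intro mult_left_mono) auto
      finally show ?thesis .
    qed
    have "D * exp (L * c) \<le> Q / L * D * exp (L * c) + norm (\<nu> - \<mu>) * (M * pi)"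
    proof -
      have "norm (d c) \<le> norm (integral {0..c} (\<lambda>t. pot \<nu> t * integral {0..t} d)) + norm (\<nu> - \<mu>) * norm (integral {0..c} (phi \<alpha> \<mu>))"
        by (subst dd, subst norm_mult[symmetric], rule norm_triangle_ineq4)
      also have "\<dots> \<le> Q / L * D * exp (L * c) + norm (\<nu> - \<mu>) * (M * pi)"
        by (intro add_mono vb mult_left_mono mm) auto
      finally show ?thesis using Dc by simp
    qed
    moreover have "Q / L * (D * exp (L * c)) \<le> 1/2 * (D * exp (L * c))"
      using Q0 D0 by (intro mult_right_mono) (auto simp: L_def field_simps)
    moreover have "D \<le> D * exp (L * c)" using D0 L c(1) by (simp add: mult_le_cancel_left1)
    ultimately have DD: "D \<le> 2 * (norm (\<nu> - \<mu>) * (M * pi))" unfolding mult.assoc by linarith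
    have "norm (phi \<alpha> \<nu> x - phi \<alpha> \<mu> x) = norm (integral {0..x} d)" using dI[OF x] by simp
    also have "\<dots> \<le> D * exp (L * pi) * (x - 0)"
    proof (rule integral_bound)
      fix t assume "t \<in> {0..x}"
      then have t: "t \<in> {0..pi}" using x by auto
      have "norm (d t) \<le> D * exp (L * t)" by (rule Ds[OF t])
      also have "\<dots> \<le> D * exp (L * pi)" using t D0 L by (intro mult_left_mono) auto
      finally show "norm (d t) \<le> D * exp (L * pi)" .
    qed (use x in \<open>auto intro!: continuous_on_subset[OF dc]\<close>)
    also have "\<dots> \<le> (2 * (norm (\<nu> - \<mu>) * (M * pi))) * exp (L * pi) * pi"
      using x DD D0 by (intro mult_mono) auto
    finally show "norm (phi \<alpha> \<nu> x - phi \<alpha> \<mu> x) \<le> pi * (2 * pi * M) * exp (L * pi) * norm (\<nu> - \<mu>)"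
      by (simp add: algebra_simps)
  qed
qed

text \<open>By \<open>chr_diff\<close> the difference quotient is exactly an integral of
  \<open>phi \<alpha> \<nu>\<close> against a fixed function, so only continuity in \<nu> remains,
  and \<open>phi_close\<close> gives it. No differentiation of \<open>phi\<close> in the parameter
  occurs.\<close>

lemma chr_deriv:
  assumes \<psi>: "sol (pot \<mu>) \<psi> \<psi>'" "\<psi> pi = of_real (sin \<beta>)" "\<psi>' pi = - of_real (cos \<beta>)"
  shows "(chr \<alpha> \<beta> has_field_derivative - integral {0..pi} (\<lambda>t. phi \<alpha> \<mu> t * \<psi> t)) (at \<mu>)"
proof -
  obtain B where B: "0 \<le> B" "\<And>\<nu> x. \<lbrakk>norm (\<nu> - \<mu>) \<le> 1; x \<in> {0..pi}\<rbrakk> \<Longrightarrow> norm (phi \<alpha> \<nu> x - phi \<alpha> \<mu> x) \<le> B * norm (\<nu> - \<mu>)"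
    using phi_close by blast
  obtain M where M: "\<And>x. x \<in> {0..pi} \<Longrightarrow> norm (\<psi> x) \<le> M"
    using compact_imp_bounded[OF compact_continuous_image[OF solD(4)[OF \<psi>(1)] compact_Icc]]
    unfolding bounded_iff by (metis imageI)
  have ci: "(\<lambda>t. phi \<alpha> \<nu> t * \<psi> t) integrable_on {0..pi}" for \<nu>
    by (intro integrable_continuous_interval continuous_intros solD(4)[OF phi(1)] solD(4)[OF \<psi>(1)])
  define I where "I = (\<lambda>\<nu>. integral {0..pi} (\<lambda>t. phi \<alpha> \<nu> t * \<psi> t))"
  have "\<forall>\<^sub>F \<nu> in at \<mu>. norm (I \<nu> - I \<mu>) \<le> norm (\<nu> - \<mu>) * (B * M * pi)"
    unfolding eventually_at
  proof (intro exI[of _ 1] conjI ballI impI)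
    fix \<nu> assume "\<nu> \<noteq> \<mu> \<and> dist \<nu> \<mu> < 1"
    then have nu: "norm (\<nu> - \<mu>) \<le> 1" by (simp add: dist_norm)
    have "I \<nu> - I \<mu> = integral {0..pi} (\<lambda>t. (phi \<alpha> \<nu> t - phi \<alpha> \<mu> t) * \<psi> t)"
      using Henstock_Kurzweil_Integration.integral_diff[OF ci[of \<nu>] ci[of \<mu>]]
      unfolding I_def by (simp add: left_diff_distrib)
    also have "norm \<dots> \<le> (B * norm (\<nu> - \<mu>)) * M * (pi - 0)"
    proof (rule integral_bound)
      fix t assume t: "t \<in> {0..pi}"
      show "norm ((phi \<alpha> \<nu> t - phi \<alpha> \<mu> t) * \<psi> t) \<le> (B * norm (\<nu> - \<mu>)) * M"
        unfolding norm_mult using B(2)[OF nu t] M[OF t] B(1) by (intro mult_mono) auto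
    qed (auto intro!: continuous_intros solD(4)[OF phi(1)] solD(4)[OF \<psi>(1)])
    finally show "norm (I \<nu> - I \<mu>) \<le> norm (\<nu> - \<mu>) * (B * M * pi)" by (simp add: algebra_simps)
  qed simp
  moreover have "((\<lambda>\<nu>. norm (\<nu> - \<mu>) * (B * M * pi)) \<longlongrightarrow> 0) (at \<mu>)"
    by (rule tendsto_eq_intros refl | simp)+
  ultimately have "((\<lambda>\<nu>. I \<nu> - I \<mu>) \<longlongrightarrow> 0) (at \<mu>)" by (rule Lim_null_comparison)
  then have "(I \<longlongrightarrow> I \<mu>) (at \<mu>)" by (simp add: LIM_zero_iff)
  then have lim: "((\<lambda>\<nu>. - I \<nu>) \<longlongrightarrow> - integral {0..pi} (\<lambda>t. phi \<alpha> \<mu> t * \<psi> t)) (at \<mu>)"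
    unfolding I_def by (rule tendsto_minus)
  show ?thesis
    unfolding has_field_derivative_iff
  proof (rule Lim_transform_eventually[OF lim])
    have "- I \<nu> = (chr \<alpha> \<beta> \<nu> - chr \<alpha> \<beta> \<mu>) / (\<nu> - \<mu>)" if "\<nu> \<noteq> \<mu>" for \<nu>
      using that unfolding chr_diff[OF \<psi>] I_def by (simp add: field_simps)
    then show "\<forall>\<^sub>F \<nu> in at \<mu>. - I \<nu> = (chr \<alpha> \<beta> \<nu> - chr \<alpha> \<beta> \<mu>) / (\<nu> - \<mu>)"
      unfolding eventually_at by (intro exI[of _ 1]) auto
  qed
qed

lemma chr_holomorphic: "chr \<alpha> \<beta> holomorphic_on S"
proof -
  have "chr \<alpha> \<beta> field_differentiable (at \<mu>)" for \<mu>
  proof -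
    obtain \<psi> \<psi>' where \<psi>: "sol (pot \<mu>) \<psi> \<psi>'" "\<psi> pi = of_real (sin \<beta>)" "\<psi>' pi = - of_real (cos \<beta>)"
      using terminal_ex by blast
    show ?thesis unfolding field_differentiable_def by (rule exI, rule chr_deriv[OF \<psi>])
  qed
  then show ?thesis by (simp add: holomorphic_on_def field_differentiable_at_within)
qed

section \<open>Reality and simplicity of the zeros\<close>

lemma phi_cnj:
  assumes "x \<in> {0..pi}"
  shows "phi \<alpha> (cnj \<mu>) x = cnj (phi \<alpha> \<mu> x)" "dphi \<alpha> (cnj \<mu>) x = cnj (dphi \<alpha> \<mu> x)"
proof -
  have s: "sol (pot (cnj \<mu>)) (\<lambda>x. cnj (phi \<alpha> \<mu> x)) (\<lambda>x. cnj (dphi \<alpha> \<mu> x))"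
    using sol_cnj[OF phi(1)[of \<mu> \<alpha>]] by simp
  show "phi \<alpha> (cnj \<mu>) x = cnj (phi \<alpha> \<mu> x)" "dphi \<alpha> (cnj \<mu>) x = cnj (dphi \<alpha> \<mu> x)"
    using sol_unique[OF pot phi(1)[of "cnj \<mu>" \<alpha>] s _ _ _ assms, of 0] by (auto simp: phi)
qed

lemma phi_norm_integral:
  "integral {0..pi} (\<lambda>t. phi \<alpha> \<mu> t * cnj (phi \<alpha> \<mu> t)) \<noteq> 0"
proof
  assume z: "integral {0..pi} (\<lambda>t. phi \<alpha> \<mu> t * cnj (phi \<alpha> \<mu> t)) = 0"
  define f where "f = (\<lambda>t. (norm (phi \<alpha> \<mu> t))\<^sup>2)"
  have c: "continuous_on {0..pi} f" unfolding f_def by (intro continuous_intros solD(4)[OF phi(1)])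
  have "(f has_integral integral {0..pi} f) {0..pi}" by (intro integrable_integral integrable_continuous_interval c)
  then have "((\<lambda>t. complex_of_real (f t)) has_integral of_real (integral {0..pi} f)) {0..pi}"
    by (rule has_integral_of_real)
  then have "((\<lambda>t. phi \<alpha> \<mu> t * cnj (phi \<alpha> \<mu> t)) has_integral of_real (integral {0..pi} f)) {0..pi}"
    unfolding f_def complex_norm_square .
  then have "integral {0..pi} (\<lambda>t. phi \<alpha> \<mu> t * cnj (phi \<alpha> \<mu> t)) = of_real (integral {0..pi} f)"
    by (rule integral_unique)
  then have "integral {0..pi} f = 0" using z by simp
  then have "f x = 0" if "x \<in> {0..pi}" for x
    using integral_eq_0_iff[OF c] that by (auto simp: f_def)
  then show False using phi_nontrivial[of \<alpha> \<mu>] by (auto simp: f_def)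
qed

text \<open>At a zero \<open>phi\<close> also satisfies the right boundary condition, so its data at
  \<pi> are a multiple of those of \<psi>, and uniqueness from the right end carries the
  proportionality to the whole interval.\<close>

lemma chr_terminal:
  assumes "chr \<alpha> \<beta> \<mu> = 0"
  obtains k \<psi> \<psi>' where "sol (pot \<mu>) \<psi> \<psi>'" "\<psi> pi = of_real (sin \<beta>)" "\<psi>' pi = - of_real (cos \<beta>)"
    "k \<noteq> 0" "\<And>x. x \<in> {0..pi} \<Longrightarrow> phi \<alpha> \<mu> x = k * \<psi> x"
proof -
  obtain \<psi> \<psi>' where \<psi>: "sol (pot \<mu>) \<psi> \<psi>'" "\<psi> pi = of_real (sin \<beta>)" "\<psi>' pi = - of_real (cos \<beta>)"
    using terminal_ex by blast
  define S C where "S = complex_of_real (sin \<beta>)" and "C = complex_of_real (cos \<beta>)"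
  have SC: "S * S + C * C = 1"
    unfolding S_def C_def of_real_mult[symmetric] of_real_add[symmetric] using sin_cos_squared_add3[of \<beta>] by (simp add: add.commute)
  have bc: "phi \<alpha> \<mu> pi * C + dphi \<alpha> \<mu> pi * S = 0" using assms by (simp add: S_def C_def chr_def)
  define k where "k = phi \<alpha> \<mu> pi * S - dphi \<alpha> \<mu> pi * C"
  have "k * S = phi \<alpha> \<mu> pi * (S * S + C * C) - C * (phi \<alpha> \<mu> pi * C + dphi \<alpha> \<mu> pi * S)" unfolding k_def
    by (simp add: algebra_simps)
  then have k1: "phi \<alpha> \<mu> pi = k * S" using SC bc by simp
  have "- (k * C) = dphi \<alpha> \<mu> pi * (S * S + C * C) - S * (phi \<alpha> \<mu> pi * C + dphi \<alpha> \<mu> pi * S)" unfolding k_def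
    by (simp add: algebra_simps)
  then have k2: "dphi \<alpha> \<mu> pi = - (k * C)" using SC bc by simp
  have s: "sol (pot \<mu>) (\<lambda>x. k * \<psi> x + 0 * \<psi> x) (\<lambda>x. k * \<psi>' x + 0 * \<psi>' x)"
    by (rule sol_linear[OF \<psi>(1) \<psi>(1)])
  have eq: "phi \<alpha> \<mu> x = k * \<psi> x + 0 * \<psi> x" if "x \<in> {0..pi}" for x
    using sol_unique(1)[OF pot phi(1) s _ _ _ that, of pi] k1 k2 \<psi> by (auto simp: S_def C_def)
  then have "k \<noteq> 0" using phi_nontrivial[of \<alpha> \<mu>] by auto
  then show thesis using that[OF \<psi>] eq by auto
qed

text \<open>All data are real, so the conjugate of a zero is a zero. Comparing the two by
  \<open>chr_diff\<close> makes their difference times the integral of |phi|^2 vanish.\<close>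

lemma chr_zero_real:
  assumes z: "chr \<alpha> \<beta> \<mu> = 0"
  shows "\<mu> \<in> \<real>"
proof -
  obtain k \<psi> \<psi>' where \<psi>: "sol (pot \<mu>) \<psi> \<psi>'" "\<psi> pi = of_real (sin \<beta>)" "\<psi>' pi = - of_real (cos \<beta>)"
    "k \<noteq> 0" "\<And>x. x \<in> {0..pi} \<Longrightarrow> phi \<alpha> \<mu> x = k * \<psi> x" using chr_terminal[OF z] by blast
  have "chr \<alpha> \<beta> (cnj \<mu>) = cnj (chr \<alpha> \<beta> \<mu>)" by (simp add: chr_def phi_cnj)
  then have "0 = - (cnj \<mu> - \<mu>) * integral {0..pi} (\<lambda>t. phi \<alpha> (cnj \<mu>) t * \<psi> t)"
    using chr_diff[OF \<psi>(1-3), of \<alpha> "cnj \<mu>"] z by simp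
  then have "(cnj \<mu> - \<mu>) * (k * integral {0..pi} (\<lambda>t. phi \<alpha> (cnj \<mu>) t * \<psi> t)) = 0" by auto
  also have "k * integral {0..pi} (\<lambda>t. phi \<alpha> (cnj \<mu>) t * \<psi> t) = integral {0..pi} (\<lambda>t. k * (phi \<alpha> (cnj \<mu>) t * \<psi> t))"
    by simp
  also have "\<dots> = integral {0..pi} (\<lambda>t. phi \<alpha> \<mu> t * cnj (phi \<alpha> \<mu> t))"
    by (rule integral_cong) (simp add: \<psi>(5) phi_cnj)
  finally have "cnj \<mu> = \<mu>" using phi_norm_integral by simp
  then show ?thesis by (simp add: Reals_cnj_iff)
qed

text \<open>At an eigenvalue the derivative is, up to the factor -1/k, the integral of phi^2;
  \<open>phi\<close> is real there because the eigenvalue is, so this is the integral of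
  |phi|^2.\<close>

lemma chr_zero_simple:
  assumes z: "chr \<alpha> \<beta> \<mu> = 0"
  shows "deriv (chr \<alpha> \<beta>) \<mu> \<noteq> 0"
proof -
  obtain k \<psi> \<psi>' where \<psi>: "sol (pot \<mu>) \<psi> \<psi>'" "\<psi> pi = of_real (sin \<beta>)" "\<psi>' pi = - of_real (cos \<beta>)"
    "k \<noteq> 0" "\<And>x. x \<in> {0..pi} \<Longrightarrow> phi \<alpha> \<mu> x = k * \<psi> x" using chr_terminal[OF z] by blast
  have "cnj \<mu> = \<mu>" using chr_zero_real[OF z] by (simp add: Reals_cnj_iff)
  then have re: "cnj (phi \<alpha> \<mu> x) = phi \<alpha> \<mu> x" if "x \<in> {0..pi}" for x using phi_cnj(1)[OF that, of \<alpha> \<mu>] by simp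
  have "k * integral {0..pi} (\<lambda>t. phi \<alpha> \<mu> t * \<psi> t) = integral {0..pi} (\<lambda>t. k * (phi \<alpha> \<mu> t * \<psi> t))" by simp
  also have "\<dots> = integral {0..pi} (\<lambda>t. phi \<alpha> \<mu> t * cnj (phi \<alpha> \<mu> t))"
  proof (rule integral_cong)
    fix t :: real assume t: "t \<in> {0..pi}"
    have "cnj (phi \<alpha> \<mu> t) = k * \<psi> t" using re[OF t] \<psi>(5)[OF t] by (rule trans)
    then show "k * (phi \<alpha> \<mu> t * \<psi> t) = phi \<alpha> \<mu> t * cnj (phi \<alpha> \<mu> t)" by (simp only: mult.left_commute)
  qed
  finally have "k * integral {0..pi} (\<lambda>t. phi \<alpha> \<mu> t * \<psi> t) \<noteq> 0" using phi_norm_integral by simp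
  then show ?thesis using DERIV_imp_deriv[OF chr_deriv[OF \<psi>(1-3)]] by auto
qed

end

section \<open>Growth of solutions for large spectral parameter\<close>

lemma cmod_cos_le: "cmod (cos z) \<le> exp \<bar>Im z\<bar>" and cmod_sin_le: "cmod (sin z) \<le> exp \<bar>Im z\<bar>"
proof -
  have e: "cmod (exp (\<i> * z)) \<le> exp \<bar>Im z\<bar>" "cmod (exp (- (\<i> * z))) \<le> exp \<bar>Im z\<bar>" by auto
  have "cmod (cos z) = cmod (exp (\<i> * z) + exp (- (\<i> * z))) / 2" by (simp add: cos_exp_eq norm_divide)
  also have "\<dots> \<le> exp \<bar>Im z\<bar>" using e norm_triangle_ineq[of "exp (\<i> * z)" "exp (- (\<i> * z))"] by linarith
  finally show "cmod (cos z) \<le> exp \<bar>Im z\<bar>" .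
  have "cmod (sin z) = cmod (exp (\<i> * z) - exp (- (\<i> * z))) / 2" by (simp add: sin_exp_eq norm_divide norm_mult)
  also have "\<dots> \<le> exp \<bar>Im z\<bar>" using e norm_triangle_ineq4[of "exp (\<i> * z)" "exp (- (\<i> * z))"] by linarith
  finally show "cmod (sin z) \<le> exp \<bar>Im z\<bar>" .
qed

text \<open>The kernels of variation of constants as functions of t with x fixed. At t = x the sine
  has data (0, -l) and the cosine (1, 0), so the boundary terms of the Lagrange identity there
  reduce to l y(x) and y'(x).\<close>

lemma sol_trig:
  fixes l :: complex and x :: real
  shows sol_sin: "sol (\<lambda>_. - l\<^sup>2) (\<lambda>t. sin (l * (of_real x - of_real t))) (\<lambda>t. - (l * cos (l * (of_real x - of_real t))))"
    and sol_cos: "sol (\<lambda>_. - l\<^sup>2) (\<lambda>t. cos (l * (of_real x - of_real t))) (\<lambda>t. l * sin (l * (of_real x - of_real t)))"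
proof -
  have s: "((\<lambda>t. sin (l * (of_real x - of_real t))) has_vector_derivative - (l * cos (l * (of_real x - of_real t)))) (at t within S)" for t S
    by (rule has_vector_derivative_real_field) (auto intro!: derivative_eq_intros)
  have c: "((\<lambda>t. cos (l * (of_real x - of_real t))) has_vector_derivative l * sin (l * (of_real x - of_real t))) (at t within S)" for t S
    by (rule has_vector_derivative_real_field) (auto intro!: derivative_eq_intros)
  have s': "((\<lambda>t. l * sin (l * (of_real x - of_real t))) has_vector_derivative - l\<^sup>2 * cos (l * (of_real x - of_real t))) (at t within S)" for t S
    by (rule has_vector_derivative_real_field) (auto intro!: derivative_eq_intros simp: power2_eq_square)
  have c': "((\<lambda>t. - (l * cos (l * (of_real x - of_real t)))) has_vector_derivative - l\<^sup>2 * sin (l * (of_real x - of_real t))) (at t within S)" for t S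
    by (rule has_vector_derivative_real_field) (auto intro!: derivative_eq_intros simp: power2_eq_square)
  show "sol (\<lambda>_. - l\<^sup>2) (\<lambda>t. sin (l * (of_real x - of_real t))) (\<lambda>t. - (l * cos (l * (of_real x - of_real t))))"
    unfolding sol_def by (intro conjI ballI exI[of _ "{}"] negligible_empty s c' abs_continuous_C1[OF c'] continuous_intros)
  show "sol (\<lambda>_. - l\<^sup>2) (\<lambda>t. cos (l * (of_real x - of_real t))) (\<lambda>t. l * sin (l * (of_real x - of_real t)))"
    unfolding sol_def by (intro conjI ballI exI[of _ "{}"] negligible_empty c s' abs_continuous_C1[OF s'] continuous_intros)
qed

text \<open>The growth of the characteristic function only depends on the number $m$ of Dirichlet conditions
  (\<open>bc_order\<close>), which are the cases $\alpha = \pi$ and $\beta = 0$: the leading term of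
  $l^m \Phi(l^2)$ is \<open>bc_coeff\<close> times $l t_m(l\pi)$, where $t_m(l\pi)$ is \<open>trig m l\<close>.\<close>

definition trig :: "nat \<Rightarrow> complex \<Rightarrow> complex" where
  "trig m l = (if m = 1 then cos (l * of_real pi) else sin (l * of_real pi))"

definition bc_order :: "real \<Rightarrow> real \<Rightarrow> nat" where
  "bc_order \<alpha> \<beta> = (if \<alpha> = pi then 1 else 0) + (if \<beta> = 0 then 1 else 0)"

definition bc_coeff :: "real \<Rightarrow> real \<Rightarrow> real" where
  "bc_coeff \<alpha> \<beta> = (if \<alpha> = pi then 1 else if \<beta> = 0 then sin \<alpha> else - sin \<alpha>) * (if \<beta> = 0 then 1 else sin \<beta>)"

lemma bc_coeff_nonzero:
  assumes "\<alpha> \<in> {0<..pi}" "\<beta> \<in> {0..<pi}"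
  shows "bc_coeff \<alpha> \<beta> \<noteq> 0"
proof -
  have "sin \<alpha> \<noteq> 0" if "\<alpha> \<noteq> pi" using assms that sin_gt_zero[of \<alpha>] by force
  moreover have "sin \<beta> \<noteq> 0" if "\<beta> \<noteq> 0" using assms that sin_gt_zero[of \<beta>] by force
  ultimately show ?thesis by (auto simp: bc_coeff_def)
qed

context sl_potential
begin

definition qnorm :: real where "qnorm = integral {0..pi} (\<lambda>t. \<bar>q t\<bar>)"

lemma q_abs_integrable: "(\<lambda>t. \<bar>q t\<bar>) integrable_on {0..pi}"
  using q by (simp add: absolutely_integrable_on_def)

lemma qnorm_nonneg: "0 \<le> qnorm"
  unfolding qnorm_def by (rule integral_nonneg[OF q_abs_integrable]) auto

text \<open>The growth exp(\<tau> t) of the solution and exp(\<tau> (x - t)) of the kernel multiply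
  to the same exp(\<tau> x) for every t, so only the L1 norm of q remains.\<close>

lemma kernel_bound:
  fixes y k :: "real \<Rightarrow> complex"
  assumes x: "x \<in> {0..pi}" and I: "((\<lambda>t. of_real (q t) * y t * k t) has_integral I) {0..x}" and M: "0 \<le> M"
    and y: "\<And>t. t \<in> {0..x} \<Longrightarrow> norm (y t) \<le> M * exp (\<tau> * t)"
    and k: "\<And>t. t \<in> {0..x} \<Longrightarrow> norm (k t) \<le> exp (\<tau> * (x - t))"
  shows "norm I \<le> qnorm * M * exp (\<tau> * x)"
proof -
  have qi: "(\<lambda>t. \<bar>q t\<bar>) integrable_on {0..x}"
    by (rule integrable_on_subinterval[OF q_abs_integrable]) (use x in auto)
  have "norm (integral {0..x} (\<lambda>t. of_real (q t) * y t * k t)) \<le> integral {0..x} (\<lambda>t. \<bar>q t\<bar> * (M * exp (\<tau> * x)))"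
  proof (rule integral_norm_bound_integral)
    show "(\<lambda>t. of_real (q t) * y t * k t) integrable_on {0..x}" using I by blast
    show "(\<lambda>t. \<bar>q t\<bar> * (M * exp (\<tau> * x))) integrable_on {0..x}" by (rule integrable_on_mult_left[OF qi])
    fix t assume t: "t \<in> {0..x}"
    have "norm (y t) * norm (k t) \<le> (M * exp (\<tau> * t)) * exp (\<tau> * (x - t))"
      using y[OF t] k[OF t] M by (intro mult_mono) auto
    also have "\<dots> = M * exp (\<tau> * x)" by (simp add: mult.assoc algebra_simps flip: exp_add)
    finally show "norm (of_real (q t) * y t * k t) \<le> \<bar>q t\<bar> * (M * exp (\<tau> * x))"
      by (simp add: norm_mult mult.assoc mult_left_mono)
  qed
  also have "\<dots> = integral {0..x} (\<lambda>t. \<bar>q t\<bar>) * (M * exp (\<tau> * x))" by simp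
  also have "\<dots> \<le> qnorm * (M * exp (\<tau> * x))"
    unfolding qnorm_def using M x by (intro mult_right_mono integral_subset_le qi q_abs_integrable) auto
  finally show ?thesis using I by (simp add: integral_unique mult.assoc)
qed

context
  fixes l :: complex and y y' :: "real \<Rightarrow> complex"
  assumes y: "sol (pot (l\<^sup>2)) y y'"
begin

lemma variation_of_constants:
  assumes x: "x \<in> {0..pi}"
  shows "((\<lambda>t. of_real (q t) * y t * sin (l * (of_real x - of_real t))) has_integral
      l * (y x - y 0 * cos (l * of_real x)) - y' 0 * sin (l * of_real x)) {0..x}"
    and "((\<lambda>t. of_real (q t) * y t * cos (l * (of_real x - of_real t))) has_integral
      y' x - (y' 0 * cos (l * of_real x) - y 0 * l * sin (l * of_real x))) {0..x}"
  using lagrange_identity[OF y sol_sin[of l x] x] lagrange_identity[OF y sol_cos[of l x] x]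
  by (simp_all add: algebra_simps)

lemma trig_kernel:
  assumes "t \<in> {0..x}"
  shows "norm (sin (l * (of_real x - of_real t))) \<le> exp (\<bar>Im l\<bar> * (x - t))"
    "norm (cos (l * (of_real x - of_real t))) \<le> exp (\<bar>Im l\<bar> * (x - t))"
proof -
  have "\<bar>Im (l * (of_real x - of_real t))\<bar> = \<bar>Im l\<bar> * (x - t)"
    using assms by (simp flip: of_real_diff) (simp add: abs_mult)
  then show "norm (sin (l * (of_real x - of_real t))) \<le> exp (\<bar>Im l\<bar> * (x - t))"
    "norm (cos (l * (of_real x - of_real t))) \<le> exp (\<bar>Im l\<bar> * (x - t))"
    using cmod_sin_le[of "l * (of_real x - of_real t)"] cmod_cos_le[of "l * (of_real x - of_real t)"] by simp_all
qed

text \<open>Variation of constants is read at the point c where exp(-|Im l| s)|y(s)| attains its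
  maximum M. Since 2 \<open>qnorm\<close> is at most |l|, the integral term is at most half of |l| M
  and is absorbed.\<close>

lemma solution_growth:
  assumes l: "l \<noteq> 0" "2 * qnorm \<le> norm l" and x: "x \<in> {0..pi}"
  shows "norm (y x) \<le> 2 * (norm (y 0) + norm (y' 0) / norm l) * exp (\<bar>Im l\<bar> * x)"
proof -
  let ?\<tau> = "\<bar>Im l\<bar>"
  have "continuous_on {0..pi} (\<lambda>s. norm (y s) * exp (- (?\<tau> * s)))" by (intro continuous_intros solD(4)[OF y])
  then obtain c where c: "c \<in> {0..pi}" "\<And>s. s \<in> {0..pi} \<Longrightarrow> norm (y s) * exp (- (?\<tau> * s)) \<le> norm (y c) * exp (- (?\<tau> * c))"
    using continuous_attains_sup[OF compact_Icc, of 0 pi "\<lambda>s. norm (y s) * exp (- (?\<tau> * s))"] by auto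
  define M where "M = norm (y c) * exp (- (?\<tau> * c))"
  have M0: "0 \<le> M" by (simp add: M_def)
  have Mc: "norm (y c) = M * exp (?\<tau> * c)" by (simp add: M_def flip: exp_add)
  have Ms: "norm (y s) \<le> M * exp (?\<tau> * s)" if "s \<in> {0..pi}" for s
  proof -
    have "norm (y s) = (norm (y s) * exp (- (?\<tau> * s))) * exp (?\<tau> * s)" by (simp flip: exp_add)
    also have "\<dots> \<le> M * exp (?\<tau> * s)" using c(2)[OF that] unfolding M_def by (intro mult_right_mono) auto
    finally show ?thesis .
  qed
  have 1: "norm (l * (y c - y 0 * cos (l * of_real c)) - y' 0 * sin (l * of_real c)) \<le> qnorm * M * exp (?\<tau> * c)"
    by (rule kernel_bound[OF c(1) variation_of_constants(1)[OF c(1)] M0]) (use Ms c(1) trig_kernel in auto)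
  have t: "norm (sin (l * of_real c)) \<le> exp (?\<tau> * c)" "norm (cos (l * of_real c)) \<le> exp (?\<tau> * c)"
    using trig_kernel[of 0 c] c(1) by auto
  have "l * y c = (l * (y c - y 0 * cos (l * of_real c)) - y' 0 * sin (l * of_real c)) + l * y 0 * cos (l * of_real c) + y' 0 * sin (l * of_real c)"
    by (simp add: algebra_simps)
  then have "norm (l * y c) \<le> norm (l * (y c - y 0 * cos (l * of_real c)) - y' 0 * sin (l * of_real c)) + norm (l * y 0 * cos (l * of_real c)) + norm (y' 0 * sin (l * of_real c))"
    using norm_triangle_ineq[of "(l * (y c - y 0 * cos (l * of_real c)) - y' 0 * sin (l * of_real c)) + l * y 0 * cos (l * of_real c)" "y' 0 * sin (l * of_real c)"]
      norm_triangle_ineq[of "l * (y c - y 0 * cos (l * of_real c)) - y' 0 * sin (l * of_real c)" "l * y 0 * cos (l * of_real c)"] by simp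
  also have "\<dots> \<le> qnorm * M * exp (?\<tau> * c) + norm (l * y 0) * exp (?\<tau> * c) + norm (y' 0) * exp (?\<tau> * c)"
    unfolding norm_mult[of "l * y 0"] norm_mult[of "y' 0"] using 1 t by (intro add_mono mult_left_mono) auto
  finally have "norm l * (M * exp (?\<tau> * c)) \<le> (qnorm * M + norm (l * y 0) + norm (y' 0)) * exp (?\<tau> * c)"
    by (simp only: norm_mult[of l "y c"] Mc distrib_right)
  then have "norm l * M \<le> qnorm * M + norm l * norm (y 0) + norm (y' 0)"
    by (simp add: norm_mult flip: mult.assoc)
  moreover have "qnorm * M \<le> norm l * M / 2" using mult_right_mono[OF l(2) M0] by simp
  ultimately have "norm l * M \<le> 2 * (norm l * norm (y 0)) + 2 * norm (y' 0)" by linarith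
  also have "\<dots> = norm l * (2 * (norm (y 0) + norm (y' 0) / norm l))" using l(1) by (simp add: algebra_simps)
  finally have "norm l * M \<le> norm l * (2 * (norm (y 0) + norm (y' 0) / norm l))" .
  then have "M \<le> 2 * (norm (y 0) + norm (y' 0) / norm l)" using l(1) by (simp only: mult_le_cancel_left_pos zero_less_norm_iff not_False_eq_True)
  then have "M * exp (?\<tau> * x) \<le> 2 * (norm (y 0) + norm (y' 0) / norm l) * exp (?\<tau> * x)" by (intro mult_right_mono) auto
  then show ?thesis using Ms[OF x] by linarith
qed

text \<open>The quotient by |l| is kept inside \<open>M\<close>: for y(0) = 0 it makes
  \<open>M\<close> of order 1/|l|, which pays for the extra factor l that a Dirichlet condition at 0
  brings into \<open>chr_asymptotics\<close>.\<close>

lemma solution_asymptotics: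
  assumes l: "l \<noteq> 0" "2 * qnorm \<le> norm l"
  defines "M \<equiv> 2 * (norm (y 0) + norm (y' 0) / norm l)" and "E \<equiv> exp (\<bar>Im l\<bar> * pi)"
  shows "norm (l * y pi - (y 0 * l * cos (l * of_real pi) + y' 0 * sin (l * of_real pi))) \<le> qnorm * M * E"
    "norm (y' pi - (y' 0 * cos (l * of_real pi) - y 0 * l * sin (l * of_real pi))) \<le> qnorm * M * E"
    "norm (y pi) \<le> M * E"
    "norm (sin (l * of_real pi)) \<le> E" "norm (cos (l * of_real pi)) \<le> E"
proof -
  have M: "0 \<le> M" by (simp add: M_def)
  have pi: "pi \<in> {0..pi}" by simp
  note g = solution_growth[OF l, folded M_def]
  have "norm (l * (y pi - y 0 * cos (l * of_real pi)) - y' 0 * sin (l * of_real pi)) \<le> qnorm * M * exp (\<bar>Im l\<bar> * pi)"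
    by (rule kernel_bound[OF pi variation_of_constants(1)[OF pi] M]) (use g trig_kernel in auto)
  then show "norm (l * y pi - (y 0 * l * cos (l * of_real pi) + y' 0 * sin (l * of_real pi))) \<le> qnorm * M * E"
    by (simp add: E_def algebra_simps)
  show "norm (y' pi - (y' 0 * cos (l * of_real pi) - y 0 * l * sin (l * of_real pi))) \<le> qnorm * M * E"
    unfolding E_def
    by (rule kernel_bound[OF pi variation_of_constants(2)[OF pi] M]) (use g trig_kernel in auto)
  show "norm (y pi) \<le> M * E" unfolding E_def by (rule g[OF pi])
  show "norm (sin (l * of_real pi)) \<le> E" "norm (cos (l * of_real pi)) \<le> E"
    using trig_kernel[of 0 pi] by (auto simp: E_def)
qed

end

text \<open>In each combination of boundary conditions the difference is written as a sum of the
  errors of \<open>solution_asymptotics\<close> and bounded multiples of sine and cosine. The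
  leading part comes from the derivative at \<pi> when \<beta> is not 0 and from the value at \<pi>
  otherwise. The constant is one common bound for all cases.\<close>

lemma chr_asymptotics:
  fixes l :: complex
  assumes l: "1 \<le> norm l" "2 * qnorm \<le> norm l"
  shows "norm (l ^ bc_order \<alpha> \<beta> * chr \<alpha> \<beta> (l\<^sup>2) - of_real (bc_coeff \<alpha> \<beta>) * l * trig (bc_order \<alpha> \<beta>) l)
    \<le> (8 * qnorm + 8) * exp (\<bar>Im l\<bar> * pi)"
proof -
  have l0: "l \<noteq> 0" using l by auto
  define E where "E = exp (\<bar>Im l\<bar> * pi)"
  define y y' a b where "y = phi \<alpha> (l\<^sup>2) pi" and "y' = dphi \<alpha> (l\<^sup>2) pi"
    and "a = complex_of_real (sin \<alpha>)" and "b = - complex_of_real (cos \<alpha>)"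
  define s c where "s = sin (l * of_real pi)" and "c = cos (l * of_real pi)"
  define M where "M = 2 * (norm a + norm b / norm l)"
  have ab: "norm a \<le> 1" "norm b \<le> 1" by (auto simp: a_def b_def)
  have E: "0 < E" by (simp add: E_def)
  note as = solution_asymptotics[OF phi(1)[of "l\<^sup>2" \<alpha>] l0 l(2), unfolded phi, folded E_def y_def y'_def a_def b_def s_def c_def, folded M_def]
  have bl: "norm b / norm l \<le> 1" using ab(2) l(1) l0 by (simp add: divide_le_eq)
  have M: "0 \<le> M" "M \<le> 4" using ab bl by (auto simp: M_def)
  have QM: "qnorm * M * E \<le> 4 * qnorm * E"
    using mult_right_mono[OF mult_left_mono[OF M(2) qnorm_nonneg], of E] E by simp
  have ME: "M * E \<le> 4 * E" using M E by simp
  have Q0: "0 \<le> qnorm * E" using qnorm_nonneg E by simp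
  define u v where "u = complex_of_real (cos \<beta>)" and "v = complex_of_real (sin \<beta>)"
  have uv: "norm u \<le> 1" "norm v \<le> 1" by (auto simp: u_def v_def)
  have chr: "chr \<alpha> \<beta> (l\<^sup>2) = y * u + y' * v" by (simp add: chr_def y_def y'_def u_def v_def)
  have le1: "norm (w * z) \<le> B" if "norm w \<le> 1" "norm z \<le> B" for w z :: complex and B
    using mult_mono[OF that(1) that(2)] that by (simp add: norm_mult) 
  have ?thesis if \<alpha>: "\<alpha> \<noteq> pi" and \<beta>: "\<beta> \<noteq> 0"
  proof -
    have m: "bc_order \<alpha> \<beta> = 0" and A: "of_real (bc_coeff \<alpha> \<beta>) = - a * v"
      using \<alpha> \<beta> by (auto simp: bc_order_def bc_coeff_def a_def v_def)
    have "norm (u * y + v * (y' - (b * c - a * l * s)) + v * (b * c)) \<le> 4 * E + 4 * qnorm * E + E"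
      using as(2,3,5) QM ME uv ab
      by (intro norm_triangle_mono le1) auto
    also have "u * y + v * (y' - (b * c - a * l * s)) + v * (b * c) = l ^ 0 * (y * u + y' * v) - (- a * v) * l * s"
      by (simp add: algebra_simps)
    finally show ?thesis unfolding m A chr E_def[symmetric] using Q0 E by (simp add: trig_def s_def[symmetric] algebra_simps)
  qed
  moreover have ?thesis if \<alpha>: "\<alpha> \<noteq> pi" and \<beta>: "\<beta> = 0"
  proof -
    have m: "bc_order \<alpha> \<beta> = 1" and A: "of_real (bc_coeff \<alpha> \<beta>) = a" and uv': "u = 1" "v = 0"
      using \<alpha> \<beta> by (auto simp: bc_order_def bc_coeff_def a_def v_def u_def)
    have "norm ((l * y - (a * l * c + b * s)) + b * s) \<le> 4 * qnorm * E + E"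
      using as(1,4) QM ab by (intro norm_triangle_mono le1) auto
    also have "(l * y - (a * l * c + b * s)) + b * s = l ^ 1 * (y * 1 + y' * 0) - a * l * c"
      by (simp add: algebra_simps)
    finally show ?thesis unfolding m A chr uv' E_def[symmetric] using Q0 E by (simp add: trig_def c_def[symmetric] algebra_simps)
  qed
  moreover have ?thesis if \<alpha>: "\<alpha> = pi"
  proof -
    have ab': "a = 0" "b = 1" using \<alpha> by (auto simp: a_def b_def)
    have lM: "norm l * M = 2" using l0 by (simp add: M_def ab')
    have l2: "norm (l * z) \<le> 2 * qnorm * E" if "norm z \<le> qnorm * M * E" for z
    proof -
      have "norm (l * z) \<le> norm l * (qnorm * M * E)" unfolding norm_mult by (rule mult_left_mono[OF that]) simp
      also have "\<dots> = (norm l * M) * (qnorm * E)" by (simp only: mult_ac)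
      finally show ?thesis unfolding lM by (simp add: mult.assoc)
    qed
    show ?thesis
    proof (cases "\<beta> = 0")
      case True
      have m: "bc_order \<alpha> \<beta> = 2" and A: "of_real (bc_coeff \<alpha> \<beta>) = (1::complex)" and uv': "u = 1" "v = 0"
        using \<alpha> True by (auto simp: bc_order_def bc_coeff_def a_def v_def u_def)
      have "norm (l * (l * y - (a * l * c + b * s))) \<le> 2 * qnorm * E" by (rule l2[OF as(1)])
      also have "l * (l * y - (a * l * c + b * s)) = l ^ 2 * (y * 1 + y' * 0) - 1 * l * s"
        by (simp add: algebra_simps ab' power2_eq_square)
      finally show ?thesis unfolding m A chr uv' E_def[symmetric] using Q0 E by (simp add: trig_def s_def[symmetric] algebra_simps)
    next
      case False
      have m: "bc_order \<alpha> \<beta> = 1" and A: "of_real (bc_coeff \<alpha> \<beta>) = v"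
        using \<alpha> False by (auto simp: bc_order_def bc_coeff_def a_def v_def u_def)
      have "norm (u * (l * y - (a * l * c + b * s)) + u * s + v * (l * (y' - (b * c - a * l * s)))) \<le> 4 * qnorm * E + E + 2 * qnorm * E"
        using as(1,2,4) QM uv by (intro norm_triangle_mono le1 l2) auto
      also have "u * (l * y - (a * l * c + b * s)) + u * s + v * (l * (y' - (b * c - a * l * s))) = l ^ 1 * (y * u + y' * v) - v * l * c"
        by (simp add: algebra_simps ab')
      finally show ?thesis unfolding m A chr E_def[symmetric] using Q0 E by (simp add: trig_def c_def[symmetric] algebra_simps)
    qed
  qed
  ultimately show ?thesis by blast
qed

end

section \<open>Lower bounds for sine and cosine away from their zeros\<close>

lemma cmod_trig_squared:
  "(cmod (trig m l))\<^sup>2 = (exp (2 * (pi * Im l)) + exp (- (2 * (pi * Im l))) + (if m = 1 then 2 else -2) * cos (2 * (pi * Re l))) / 4"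
proof -
  define x y where "x = pi * Re l" and "y = pi * Im l"
  have xy: "Re (l * of_real pi) = x" "Im (l * of_real pi) = y" by (simp_all add: x_def y_def)
  show ?thesis
    unfolding x_def[symmetric] y_def[symmetric]
  proof (cases "m = 1")
    case True
    have n: "(cmod (trig m l))\<^sup>2 = (cos x)\<^sup>2 + (exp y - inverse (exp y))\<^sup>2 / 4"
      unfolding trig_def norm_cos_squared[of "l * of_real pi", unfolded xy, symmetric] using True by simp
    have 1: "(cos x)\<^sup>2 = (1 + cos (2 * x)) / 2" using cos_double_cos[of x] by simp
    have 2: "(exp y - inverse (exp y))\<^sup>2 = exp (2 * y) + exp (- (2 * y)) - 2"
      by (simp add: power2_diff exp_minus exp_double power_inverse)
    show "(cmod (trig m l))\<^sup>2 = (exp (2 * y) + exp (- (2 * y)) + (if m = 1 then 2 else - 2) * cos (2 * x)) / 4"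
      unfolding n 1 2 using True by (simp add: add_divide_distrib diff_divide_distrib)
  next
    case False
    then show "(cmod (trig m l))\<^sup>2 = (exp (2 * y) + exp (- (2 * y)) + (if m = 1 then 2 else - 2) * cos (2 * x)) / 4"
      using norm_sin_squared[of "l * of_real pi", unfolded xy] by (simp add: trig_def exp_minus)
  qed
qed

text \<open>In the formula for the square the oscillating term is at least -2. It is harmless when
  its sign is favourable, and for \<pi>|Im l| >= 1 it is dominated by exp(2\<pi>|Im l|), which is
  then at least 4.\<close>

lemma cmod_trig_ge:
  assumes "1 \<le> pi * \<bar>Im l\<bar> \<or> (if m = 1 then 0 \<le> cos (2 * (pi * Re l)) else cos (2 * (pi * Re l)) \<le> 0)"
  shows "exp (\<bar>Im l\<bar> * pi) / 4 \<le> cmod (trig m l)"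
proof (rule power2_le_imp_le)
  define t where "t = pi * \<bar>Im l\<bar>"
  define c where "c = (if m = 1 then 2 else -2) * cos (2 * (pi * Re l))"
  have e: "exp (2 * (pi * Im l)) + exp (- (2 * (pi * Im l))) = exp (2 * t) + exp (- (2 * t))"
    by (cases "0 \<le> Im l") (auto simp: t_def)
  have "(exp (\<bar>Im l\<bar> * pi) / 4)\<^sup>2 = exp (2 * t) / 16"
    by (simp add: t_def power_divide exp_double mult.commute)
  also have "\<dots> \<le> (cmod (trig m l))\<^sup>2"
    unfolding cmod_trig_squared e c_def[symmetric]
  proof (cases "1 \<le> t")
    case True
    have "2 \<le> exp t" using True exp_ge_add_one_self[of t] by linarith
    then have "2 * 2 \<le> exp t * exp t" by (intro mult_mono) auto
    then have 4: "4 \<le> exp (2 * t)" by (simp add: exp_double power2_eq_square)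
    have "-2 \<le> c"
      unfolding c_def using cos_le_one[of "2 * (pi * Re l)"] cos_ge_minus_one[of "2 * (pi * Re l)"] by (simp split: if_splits)
    moreover have "0 < exp (- (2 * t))" by simp
    moreover note 4
    ultimately have "exp (2 * t) / 16 \<le> exp (2 * t) / 4 + exp (- (2 * t)) / 4 + c / 4" by linarith
    then show "exp (2 * t) / 16 \<le> (exp (2 * t) + exp (- (2 * t)) + c) / 4"
      by (simp add: add_divide_distrib)
  next
    case False
    then have "0 \<le> c" using assms by (auto simp: t_def c_def split: if_splits)
    moreover have "0 < exp (- (2 * t))" "0 < exp (2 * t)" by auto
    ultimately have "exp (2 * t) / 16 \<le> exp (2 * t) / 4 + exp (- (2 * t)) / 4 + c / 4" by linarith
    then show "exp (2 * t) / 16 \<le> (exp (2 * t) + exp (- (2 * t)) + c) / 4"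
      by (simp add: add_divide_distrib)
  qed
  finally show "(exp (\<bar>Im l\<bar> * pi) / 4)\<^sup>2 \<le> (cmod (trig m l))\<^sup>2" .
qed simp

text \<open>The circles pass midway between consecutive zeros $k + m/2$ of \<open>trig m\<close>.\<close>

definition radius :: "nat \<Rightarrow> nat \<Rightarrow> real" where "radius m k = real k + real m / 2 + 1/2"

lemma radius_mono: "i \<le> j \<Longrightarrow> radius m i \<le> radius m j" by (simp add: radius_def)

lemma radius_ge: "1/2 \<le> radius m k" "real k \<le> radius m k" by (simp_all add: radius_def)

lemma cos_near_int:
  fixes k :: nat
  assumes "0 \<le> d" "d \<le> 1/4"
  shows "0 \<le> cos (2 * (pi * (real k - d)))" "cos (2 * (pi * (real k + 1/2 - d))) \<le> 0"
proof -
  have "0 \<le> pi * d" "pi * d \<le> pi * (1/4)" using assms by (auto intro!: mult_left_mono simp del: times_divide_eq_right)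
  then have 1: "0 \<le> cos (2 * pi * d)" using pi_gt_zero by (intro cos_ge_zero) linarith+
  have "2 * (pi * (real k - d)) = real k * (2 * pi) - 2 * pi * d" by (simp add: algebra_simps)
  then have c: "cos (2 * (pi * (real k - d))) = cos (2 * pi * d)"
    by (metis cos_2npi cos_diff mult_1 mult_zero_left add_0_right sin_2npi mult.assoc mult.commute)
  then show "0 \<le> cos (2 * (pi * (real k - d)))" using 1 by simp
  have "2 * (pi * (real k + 1/2 - d)) = 2 * (pi * (real k - d)) + pi" by (simp add: algebra_simps)
  then show "cos (2 * (pi * (real k + 1/2 - d))) \<le> 0" using 1 c by simp
qed

text \<open>Either \<pi>|Im l| >= 1, or l lies so near the real axis that |Re l| differs from the
  radius by at most 1/4. The radius is midway between two zeros, so the oscillating term then has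
  the favourable sign.\<close>

lemma cmod_trig_circle:
  assumes m: "m \<le> 2" and l: "cmod l = radius m k"
  shows "exp (\<bar>Im l\<bar> * pi) / 4 \<le> cmod (trig m l)"
proof (rule cmod_trig_ge, rule disjCI)
  assume "\<not> (if m = 1 then 0 \<le> cos (2 * (pi * Re l)) else cos (2 * (pi * Re l)) \<le> 0)"
  show "1 \<le> pi * \<bar>Im l\<bar>"
  proof (rule ccontr)
    assume "\<not> 1 \<le> pi * \<bar>Im l\<bar>"
    then have "pi * \<bar>Im l\<bar> < 1" by simp
    moreover have "3 * \<bar>Im l\<bar> \<le> pi * \<bar>Im l\<bar>" using pi_gt3 by (intro mult_right_mono) auto
    ultimately have "\<bar>Im l\<bar> < 1/3" by linarith
    then have i: "(Im l)\<^sup>2 \<le> 1/9" using power_mono[of "\<bar>Im l\<bar>" "1/3" 2] by (simp add: power_divide)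
    define r where "r = \<bar>Re l\<bar>"
    define d where "d = radius m k - r"
    have R: "1/2 \<le> radius m k" by (rule radius_ge)
    have sq: "r\<^sup>2 + (Im l)\<^sup>2 = (radius m k)\<^sup>2" using l cmod_power2[of l] by (simp add: r_def)
    have rle: "r \<le> radius m k" using abs_Re_le_cmod[of l] l by (simp add: r_def)
    have "d * (1/2) \<le> d * (radius m k + r)" using rle R by (intro mult_left_mono) (auto simp: d_def r_def)
    also have "\<dots> = (Im l)\<^sup>2" using sq by (simp add: d_def algebra_simps power2_eq_square)
    finally have d: "0 \<le> d" "d \<le> 1/4" using i rle by (auto simp: d_def)
    have c: "cos (2 * (pi * Re l)) = cos (2 * (pi * r))" by (cases "0 \<le> Re l") (auto simp: r_def)
    have rd: "r = radius m k - d" by (simp add: d_def)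
    consider "m = 0" | "m = 1" | "m = 2" using m by linarith
    then have "if m = 1 then 0 \<le> cos (2 * (pi * Re l)) else cos (2 * (pi * Re l)) \<le> 0"
    proof cases
      case 1
      then have "r = real k + 1/2 - d" using rd by (simp add: radius_def)
      then have "cos (2 * (pi * Re l)) \<le> 0" unfolding c using cos_near_int(2)[OF d] by metis
      then show ?thesis using 1 by simp
    next
      case 2
      then have "r = real (Suc k) - d" using rd by (simp add: radius_def)
      then have "0 \<le> cos (2 * (pi * Re l))" unfolding c using cos_near_int(1)[OF d] by metis
      then show ?thesis using 2 by simp
    next
      case 3
      then have "r = real (Suc k) + 1/2 - d" using rd by (simp add: radius_def)
      then have "cos (2 * (pi * Re l)) \<le> 0" unfolding c using cos_near_int(2)[OF d] by metis
      then show ?thesis using 3 by simp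
    qed
    then show False using \<open>\<not> (if m = 1 then _ else _)\<close> by blast
  qed
qed

section \<open>Localization of the eigenvalues\<close>

lemma simple_zeros_finite:
  assumes hol: "F holomorphic_on UNIV" and simple: "\<And>z. F z = 0 \<Longrightarrow> deriv F z \<noteq> 0" and K: "compact K"
  shows "finite {z\<in>K. F z = 0}"
proof (cases "F constant_on UNIV")
  case True
  then obtain c where c: "\<And>z. F z = c" by (auto simp: constant_on_def)
  then have "F = (\<lambda>_. c)" by auto
  then have "deriv F z = 0" for z by simp
  then show ?thesis using simple by (metis (mono_tags, lifting) empty_Collect_eq finite.emptyI)
next
  case False
  then show ?thesis using holomorphic_compact_finite_zeros[OF hol _ _ K] by auto
qed

text \<open>The library count weights each zero by winding number and order. Simple zeros have order
  1, the winding number is 1 inside and 0 outside the circle, and the strict inequality keeps zeros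
  off the circle, so the weighted sums are cardinalities.\<close>

lemma rouche_simple_zeros:
  fixes F G :: "complex \<Rightarrow> complex"
  assumes F: "F holomorphic_on UNIV" "\<And>z. F z = 0 \<Longrightarrow> deriv F z \<noteq> 0"
    and G: "G holomorphic_on UNIV" "\<And>z. G z = 0 \<Longrightarrow> deriv G z \<noteq> 0"
    and r: "0 < r" and less: "\<And>z. cmod z = r \<Longrightarrow> cmod (G z - F z) < cmod (F z)"
  shows "card {z. G z = 0 \<and> cmod z < r} = card {z. F z = 0 \<and> cmod z < r}"
proof -
  define s where "s = ball (0::complex) (r + 1)"
  have fin: "finite {p\<in>s. H p = 0}" if "H holomorphic_on UNIV" "\<And>z. H z = 0 \<Longrightarrow> deriv H z \<noteq> 0" for H
    by (rule finite_subset[OF _ simple_zeros_finite[OF that, of "cball 0 (r + 1)"]]) (auto simp: s_def)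
  have zo: "zorder H z = 1" if "H holomorphic_on UNIV" "H z = 0" "deriv H z \<noteq> 0" for H z
    by (rule zorder_zero_eqI[OF that(1)]) (use that in auto)
  have sum: "(\<Sum>p\<in>{p\<in>s. H p = 0}. winding_number (circlepath 0 r) p * zorder H p) = of_nat (card {z. H z = 0 \<and> cmod z < r})"
    if H: "H holomorphic_on UNIV" "\<And>z. H z = 0 \<Longrightarrow> deriv H z \<noteq> 0" and nz: "\<And>z. cmod z = r \<Longrightarrow> H z \<noteq> 0" for H
  proof -
    have "winding_number (circlepath 0 r) p * zorder H p = (if cmod p < r then 1 else 0)" if p: "p \<in> {p\<in>s. H p = 0}" for p
    proof -
      have z: "zorder H p = 1" using zo H p by auto
      show ?thesis
      proof (cases "cmod p < r")
        case True then show ?thesis using z winding_number_circlepath[of p 0 r] by simp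
      next
        case False
        then have "r < cmod p" using nz[of p] p by fastforce
        then have "winding_number (circlepath 0 r) p = 0"
          by (intro winding_number_zero_outside[of _ "cball 0 r"]) (use r in auto)
        then show ?thesis using False by simp
      qed
    qed
    then have "(\<Sum>p\<in>{p\<in>s. H p = 0}. winding_number (circlepath 0 r) p * zorder H p) = (\<Sum>p\<in>{p\<in>s. H p = 0}. if cmod p < r then 1 else 0)"
      by (intro sum.cong) auto
    also have "\<dots> = (\<Sum>p\<in>{p\<in>{p\<in>s. H p = 0}. cmod p < r}. 1)"
      by (rule sum.inter_filter[symmetric]) (rule fin[OF H])
    also have "{p\<in>{p\<in>s. H p = 0}. cmod p < r} = {z. H z = 0 \<and> cmod z < r}" by (auto simp: s_def)
    finally show ?thesis by simp
  qed
  have Gz: "G z \<noteq> 0" if "cmod z = r" for z using less[OF that] by auto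
  have Fz: "F z \<noteq> 0" if "cmod z = r" for z using less[OF that] by auto
  have "(\<Sum>p\<in>{p\<in>s. F p + (G p - F p) = 0}. winding_number (circlepath 0 r) p * zorder (\<lambda>p. F p + (G p - F p)) p) =
      (\<Sum>p\<in>{p\<in>s. F p = 0}. winding_number (circlepath 0 r) p * zorder F p)"
  proof (rule Rouche_theorem)
    show "finite {p\<in>s. F p + (G p - F p) = 0}" using fin[OF G] by simp
    show "F holomorphic_on s" "(\<lambda>p. G p - F p) holomorphic_on s"
      using F(1) G(1) by (auto intro!: holomorphic_intros intro: holomorphic_on_subset)
    show "\<forall>z. z \<notin> s \<longrightarrow> winding_number (circlepath 0 r) z = 0"
    proof (intro allI impI)
      fix z assume "z \<notin> s"
      then show "winding_number (circlepath 0 r) z = 0"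
        by (intro winding_number_zero_outside[of _ "cball 0 r"]) (use r in \<open>auto simp: s_def\<close>)
    qed
  qed (use r less fin[OF F] in \<open>auto simp: s_def\<close>)
  then have "(of_nat (card {z. G z = 0 \<and> cmod z < r}) :: complex) = of_nat (card {z. F z = 0 \<and> cmod z < r})"
    using sum[OF F Fz] sum[OF G Gz] by simp
  then show ?thesis by (simp only: of_nat_eq_iff)
qed

text \<open>The number of smaller elements ranks \<open>Z\<close> bijectively onto the naturals, and
  f is the inverse of the rank. Exactly the ranks 0 to k lie below \<open>r k\<close>, which places
  the element with index k + 1 between \<open>r k\<close> and \<open>r (Suc k)\<close>.\<close>

lemma enumeration:
  fixes Z :: "real set" and r :: "nat \<Rightarrow> real"
  assumes mono: "\<And>i j. i \<le> j \<Longrightarrow> r i \<le> r j" and unb: "\<And>x. \<exists>k. x < r k"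
    and fin: "\<And>k. K \<le> k \<Longrightarrow> finite {x\<in>Z. x < r k}" and card: "\<And>k. K \<le> k \<Longrightarrow> card {x\<in>Z. x < r k} = Suc k"
  obtains f :: "nat \<Rightarrow> real" where "strict_mono f" "range f = Z" "\<And>k. K \<le> k \<Longrightarrow> r k \<le> f (Suc k) \<and> f (Suc k) < r (Suc k)"
proof -
  define rank where "rank = (\<lambda>x. card {y\<in>Z. y < x})"
  have finx: "finite {y\<in>Z. y < x}" for x
  proof -
    obtain k where "x < r k" using unb by blast
    then have "x < r (max k K)" using mono[of k "max k K"] by simp
    then show ?thesis by (intro finite_subset[OF _ fin[of "max k K"]]) auto
  qed
  have rank_less: "rank x < rank y" if "x < y" "x \<in> Z" for x y
    unfolding rank_def by (rule psubset_card_mono[OF finx]) (use that in force)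
  have rank_le: "rank x \<le> rank y" if "x \<le> y" for x y
    unfolding rank_def by (rule card_mono[OF finx]) (use that in force)
  have ex: "\<exists>x\<in>Z. rank x = n" for n
  proof -
    define k where "k = max n K"
    define A where "A = {x\<in>Z. x < r k}"
    have A: "finite A" "card A = Suc k" using fin[of k] card[of k] by (auto simp: A_def k_def)
    define h where "h = (\<lambda>j. sorted_list_of_set A ! j)"
    have h: "bij_betw h {..<card A} A" "strict_mono_on {..<card A} h"
      unfolding h_def using A(1)
      by (auto intro!: bij_betw_nth strict_mono_onI sorted_wrt_nth_less[OF strict_sorted_list_of_set])
    have n: "n \<in> {..<card A}" using A by (simp add: k_def)
    then have hn: "h n \<in> A" using h(1) bij_betwE by blast
    have "{y\<in>Z. y < h n} = h ` {0..<n}"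
    proof
      show "{y\<in>Z. y < h n} \<subseteq> h ` {0..<n}"
      proof
        fix y assume y: "y \<in> {y\<in>Z. y < h n}"
        then have "y \<in> A" using hn by (auto simp: A_def)
        then obtain j where j: "j \<in> {..<card A}" "y = h j" using h(1) unfolding bij_betw_def by (metis imageE)
        then have "j < n" using y n h(2) strict_mono_on_leD[OF h(2) n j(1)] by force
        then show "y \<in> h ` {0..<n}" using j by auto
      qed
      show "h ` {0..<n} \<subseteq> {y\<in>Z. y < h n}"
      proof
        fix y assume "y \<in> h ` {0..<n}"
        then obtain j where j: "j < n" "y = h j" by auto
        then have jA: "j \<in> {..<card A}" using n by auto
        then have "h j \<in> A" using h(1) bij_betwE by blast
        moreover have "h j < h n" using strict_mono_onD[OF h(2) jA n j(1)] .
        ultimately show "y \<in> {y\<in>Z. y < h n}" using j by (auto simp: A_def)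
      qed
    qed
    moreover have "card (h ` {0..<n}) = n"
    proof -
      have "{0..<n} \<subseteq> {..<card A}" using n by auto
      then have "inj_on h {0..<n}" by (rule inj_on_subset[OF bij_betw_imp_inj_on[OF h(1)]])
      from card_image[OF this] show ?thesis by simp
    qed
    ultimately have "rank (h n) = n" by (simp add: rank_def)
    then show ?thesis using hn by (auto simp: A_def)
  qed
  then obtain f where f: "\<And>n. f n \<in> Z" "\<And>n. rank (f n) = n" by metis
  have "strict_mono f"
  proof (rule strict_monoI)
    fix i j :: nat assume "i < j"
    then show "f i < f j" using rank_le[of "f j" "f i"] f(2)[of i] f(2)[of j] by (cases "f j \<le> f i") auto
  qed
  moreover have "range f = Z"
  proof
    show "range f \<subseteq> Z" using f by auto
    show "Z \<subseteq> range f"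
    proof
      fix x assume x: "x \<in> Z"
      have "\<not> x < f (rank x)" "\<not> f (rank x) < x"
        using rank_less[OF _ x, of "f (rank x)"] rank_less[OF _ f(1), of "rank x" x] f(2)[of "rank x"] by auto
      then have "x = f (rank x)" by simp
      then show "x \<in> range f" by blast
    qed
  qed
  moreover have "r k \<le> f (Suc k) \<and> f (Suc k) < r (Suc k)" if k: "K \<le> k" for k
  proof
    show "r k \<le> f (Suc k)"
    proof (rule ccontr)
      assume "\<not> r k \<le> f (Suc k)"
      then have "rank (f (Suc k)) < rank (r k)" by (intro rank_less f) simp
      then show False using card[OF k] f(2) by (simp add: rank_def)
    qed
    show "f (Suc k) < r (Suc k)"
    proof (rule ccontr)
      assume "\<not> f (Suc k) < r (Suc k)"
      then have "rank (r (Suc k)) \<le> rank (f (Suc k))" by (intro rank_le) simp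
      then show False using card[of "Suc k"] k f(2) by (simp add: rank_def)
    qed
  qed
  ultimately show thesis using that by blast
qed

text \<open>Needed to evaluate the definite description in \<open>sl_mu\<close>.\<close>

lemma strict_mono_range_unique:
  fixes f g :: "nat \<Rightarrow> 'a::linorder"
  assumes f: "strict_mono f" and g: "strict_mono g" and fg: "range f = range g"
  shows "f = g"
proof
  fix n
  have le: "f n \<le> g n" if eq: "\<And>k. k < n \<Longrightarrow> f k = g k" and sm: "strict_mono f" "strict_mono g" and ra: "range f = range g" for f g :: "nat \<Rightarrow> 'a" and n
  proof -
    obtain j where j: "g n = f j" using ra by (metis rangeI imageE)
    have "\<not> j < n"
    proof
      assume "j < n"
      then have "g n = g j" using eq[of j] j by simp
      then show False using strict_mono_less[OF sm(2), of j n] \<open>j < n\<close> by simp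
    qed
    then show ?thesis using j sm(1) by (simp add: strict_mono_less_eq)
  qed
  show "f n = g n"
  proof (induction n rule: less_induct)
    case (less n)
    have eq: "\<And>k. k < n \<Longrightarrow> f k = g k" "\<And>k. k < n \<Longrightarrow> g k = f k" using less by auto
    show ?case
      by (rule antisym[OF le[OF eq(1) f g fg] le[OF eq(2) g f fg[symmetric]]])
  qed
qed

text \<open>The Taylor remainder |t|^3/6 is at most |t|/2, since t^2 <= 3 on this interval.\<close>

lemma sin_abs_ge_half:
  fixes t :: real
  assumes "\<bar>t\<bar> \<le> pi / 2"
  shows "\<bar>t\<bar> / 2 \<le> \<bar>sin t\<bar>"
proof -
  have "\<bar>sin t - t\<bar> \<le> \<bar>t\<bar> ^ 3 / 6"
    using Maclaurin_sin_bound[of t 3] by (simp add: eval_nat_numeral sin_coeff_def field_simps)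
  moreover have "\<bar>t\<bar> ^ 3 / 6 \<le> \<bar>t\<bar> / 2"
  proof -
    have "\<bar>t\<bar> \<le> 1.7" using assms pi_less_4 pi_approx by simp
    then have "\<bar>t\<bar> * \<bar>t\<bar> \<le> 1.7 * 1.7" by (intro mult_mono) auto
    then have "\<bar>t\<bar> * (\<bar>t\<bar> * \<bar>t\<bar>) \<le> \<bar>t\<bar> * 3" by (intro mult_left_mono) auto
    then show ?thesis by (simp add: power3_eq_cube mult.assoc)
  qed
  ultimately show ?thesis by linarith
qed

lemma norm_trig_near:
  fixes n :: nat and d :: real
  assumes "m \<le> 2"
  shows "cmod (trig m (of_real (real n + real m / 2 + d))) = \<bar>sin (pi * d)\<bar>"
proof -
  have e: "\<bar>sin (pi * (real j + d))\<bar> = \<bar>sin (pi * d)\<bar>" for j :: nat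
  proof (induction j)
    case (Suc j)
    have "pi * (real (Suc j) + d) = pi * (real j + d) + pi" by (simp add: algebra_simps)
    then have "sin (pi * (real (Suc j) + d)) = - sin (pi * (real j + d))" by simp
    then show ?case using Suc by simp
  qed simp
  have *: "trig m (of_real x) = of_real (if m = 1 then cos (x * pi) else sin (x * pi))" for x
    by (simp add: trig_def flip: of_real_mult cos_of_real sin_of_real)
  consider "m = 0" | "m = 1" | "m = 2" using assms by linarith
  then show ?thesis
  proof cases
    case 1 then show ?thesis unfolding * using e[of n] by (simp add: mult.commute)
  next
    case 2
    have "cos ((real n + 1 / 2 + d) * pi) = - sin (pi * (real n + d))"
      by (simp add: algebra_simps cos_add sin_add cos_diff)
    then show ?thesis unfolding * using 2 e[of n] by simp
  next
    case 3 then show ?thesis unfolding * using e[of "Suc n"] by (simp add: algebra_simps)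
  qed
qed

section \<open>The comparison problem with zero potential\<close>

interpretation zero: sl_potential "\<lambda>_. 0"
  by unfold_locales simp

text \<open>One representative of the boundary conditions for each value of \<open>bc_order\<close>; with $q = 0$ its
  eigenvalues are explicit and serve as the comparison problem in Rouche's theorem.\<close>

definition std_bc :: "nat \<Rightarrow> real \<times> real" where
  "std_bc m = (if m = 0 then (pi/2, pi/2) else if m = 1 then (pi/2, 0) else (pi, 0))"

text \<open>As a characteristic function of the same kind, the comparison function inherits
  holomorphy and simplicity of its zeros from the general theory, as Rouche's theorem requires
  here.\<close>

definition std_chr :: "nat \<Rightarrow> complex \<Rightarrow> complex" where
  "std_chr m = zero.chr (fst (std_bc m)) (snd (std_bc m))"

lemma std_bc:
  assumes "m \<le> 2"
  shows "bc_order (fst (std_bc m)) (snd (std_bc m)) = m"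
    "bc_coeff (fst (std_bc m)) (snd (std_bc m)) = (if m = 0 then -1 else 1)"
proof -
  consider "m = 0" | "m = 1" | "m = 2" using assms by linarith
  then show "bc_order (fst (std_bc m)) (snd (std_bc m)) = m"
    "bc_coeff (fst (std_bc m)) (snd (std_bc m)) = (if m = 0 then -1 else 1)"
    by cases (auto simp: std_bc_def bc_order_def bc_coeff_def)
qed

text \<open>For q = 0 the integrals in variation of constants vanish, so the leading term is exact.
  The formula for the value at \<pi> determines only l times it, whence the exclusion of 0.\<close>

lemma std_chr_nonzero:
  assumes m: "m \<le> 2" and l: "l \<noteq> 0"
  shows "l ^ m * std_chr m (l\<^sup>2) = (if m = 0 then -1 else 1) * l * trig m l"
proof -
  have pi: "pi \<in> {0..pi}" by simp
  define \<alpha> \<beta> where "\<alpha> = fst (std_bc m)" and "\<beta> = snd (std_bc m)"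
  have 1: "l * zero.phi \<alpha> (l\<^sup>2) pi = l * of_real (sin \<alpha>) * cos (l * of_real pi) - of_real (cos \<alpha>) * sin (l * of_real pi)"
    using zero.variation_of_constants(1)[OF zero.phi(1)[of "l\<^sup>2" \<alpha>] pi] zero.phi(2,3)[of \<alpha> "l\<^sup>2"]
    by (simp add: algebra_simps)
  have 2: "zero.dphi \<alpha> (l\<^sup>2) pi = - of_real (cos \<alpha>) * cos (l * of_real pi) - of_real (sin \<alpha>) * l * sin (l * of_real pi)"
  proof -
    have "zero.dphi \<alpha> (l\<^sup>2) pi - (zero.dphi \<alpha> (l\<^sup>2) 0 * cos (l * of_real pi) - zero.phi \<alpha> (l\<^sup>2) 0 * l * sin (l * of_real pi)) = 0"
      using zero.variation_of_constants(2)[OF zero.phi(1)[of "l\<^sup>2" \<alpha>] pi] by simp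
    then show ?thesis unfolding eq_iff_diff_eq_0[symmetric] zero.phi(2,3) .
  qed
  have chr: "std_chr m (l\<^sup>2) = zero.phi \<alpha> (l\<^sup>2) pi * of_real (cos \<beta>) + zero.dphi \<alpha> (l\<^sup>2) pi * of_real (sin \<beta>)"
    by (simp add: std_chr_def zero.chr_def \<alpha>_def \<beta>_def)
  consider "m = 0" | "m = 1" | "m = 2" using m by linarith
  then show ?thesis
  proof cases
    case 1 then show ?thesis unfolding chr using 2 by (simp add: \<alpha>_def \<beta>_def std_bc_def trig_def)
  next
    case 2 then show ?thesis unfolding chr using 1 by (simp add: \<alpha>_def \<beta>_def std_bc_def trig_def)
  next
    case 3
    then have "l * zero.phi \<alpha> (l\<^sup>2) pi = sin (l * of_real pi)" using 1 by (simp add: \<alpha>_def std_bc_def)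
    then show ?thesis unfolding chr using 3 by (simp add: \<beta>_def std_bc_def trig_def power2_eq_square mult.assoc)
  qed
qed

text \<open>At \<mu> = 0 the solution is the affine function sin \<alpha> - x cos \<alpha>,
  evaluated directly. Only for two Neumann conditions is 0 an eigenvalue.\<close>

lemma std_chr_0:
  assumes m: "m \<le> 2"
  shows "std_chr m 0 = 0 \<longleftrightarrow> m = 0"
proof -
  have pi: "pi \<in> {0..pi}" by simp
  define \<alpha> \<beta> where "\<alpha> = fst (std_bc m)" and "\<beta> = snd (std_bc m)"
  have d: "zero.dphi \<alpha> 0 x = - of_real (cos \<alpha>)" if "x \<in> {0..pi}" for x
  proof -
    have "((\<lambda>t. 0) has_integral zero.dphi \<alpha> 0 x - zero.dphi \<alpha> 0 0) {0..x}"
      using sol_has_integral(1)[OF zero.phi(1)[of 0 \<alpha>] that] by simp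
    from has_integral_unique[OF this has_integral_0] show ?thesis using zero.phi(3)[of \<alpha> 0] by (simp add: eq_neg_iff_add_eq_0)
  qed
  have "(zero.dphi \<alpha> 0 has_integral zero.phi \<alpha> 0 pi - of_real (sin \<alpha>)) {0..pi}"
    using sol_has_integral(2)[OF zero.phi(1)[of 0 \<alpha>] pi] zero.phi(2)[of \<alpha> 0] by simp
  then have "((\<lambda>x. - complex_of_real (cos \<alpha>)) has_integral zero.phi \<alpha> 0 pi - of_real (sin \<alpha>)) {0..pi}"
    by (rule has_integral_eq[rotated]) (use d in auto)
  moreover have "((\<lambda>x. - complex_of_real (cos \<alpha>)) has_integral (pi - 0) *\<^sub>R (- of_real (cos \<alpha>))) {0..pi}"
    by (rule has_integral_const_real[of _ 0 pi, unfolded content_real[OF pi_ge_zero]])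
  ultimately have p: "zero.phi \<alpha> 0 pi - of_real (sin \<alpha>) = (pi - 0) *\<^sub>R (- of_real (cos \<alpha>))"
    by (rule has_integral_unique)
  have chr: "std_chr m 0 = zero.phi \<alpha> 0 pi * of_real (cos \<beta>) + zero.dphi \<alpha> 0 pi * of_real (sin \<beta>)"
    by (simp add: std_chr_def zero.chr_def \<alpha>_def \<beta>_def)
  consider "m = 0" | "m = 1" | "m = 2" using m by linarith
  then show ?thesis
    unfolding chr by cases (use p d[OF pi] in \<open>auto simp: \<alpha>_def \<beta>_def std_bc_def scaleR_conv_of_real\<close>)
qed

text \<open>The reflection of j to -j - m changes only the sign of j + m/2.\<close>

lemma int_square_nat:
  fixes j :: int
  assumes "m \<le> (1::nat)"
  obtains n :: nat where "(real_of_int j + real m / 2)\<^sup>2 = (real n + real m / 2)\<^sup>2"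
proof (cases "0 \<le> j")
  case True
  then show thesis using that[of "nat j"] by simp
next
  case False
  then have "real (nat (- j - int m)) = - real_of_int j - real m" using assms by (simp add: of_nat_nat)
  then have "real (nat (- j - int m)) + real m / 2 = - (real_of_int j + real m / 2)" by simp
  then show thesis using that[of "nat (- j - int m)"] by (metis power2_minus)
qed

lemma std_chr_zeros:
  assumes m: "m \<le> 2"
  shows "std_chr m \<mu> = 0 \<longleftrightarrow> (\<exists>n::nat. \<mu> = of_real ((real n + real m / 2)\<^sup>2))"
proof (cases "\<mu> = 0")
  case True
  have "(\<exists>n::nat. (0::complex) = of_real ((real n + real m / 2)\<^sup>2)) \<longleftrightarrow> m = 0"
  proof
    assume "\<exists>n::nat. (0::complex) = of_real ((real n + real m / 2)\<^sup>2)"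
    then obtain n :: nat where "(0::complex) = of_real ((real n + real m / 2)\<^sup>2)" by blast
    then have "(real n + real m / 2)\<^sup>2 = 0" by (metis of_real_eq_0_iff)
    then show "m = 0" by (simp add: add_nonneg_eq_0_iff)
  qed (auto intro: exI[of _ 0])
  then show ?thesis using True std_chr_0[OF m] by simp
next
  case False
  define l where "l = csqrt \<mu>"
  have l: "l \<noteq> 0" "l\<^sup>2 = \<mu>" using False by (auto simp: l_def)
  have "std_chr m \<mu> = 0 \<longleftrightarrow> trig m l = 0"
    using std_chr_nonzero[OF m l(1)] l by (auto split: if_splits)
  also have "\<dots> \<longleftrightarrow> (\<exists>n::nat. \<mu> = of_real ((real n + real m / 2)\<^sup>2))"
  proof
    assume t: "trig m l = 0"
    obtain j :: int where j: "l = of_real (real_of_int j + real (m mod 2) / 2)"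
    proof (cases "m = 1")
      case True
      then obtain j :: int where "l * of_real pi = complex_of_real(j * pi) + of_real pi/2"
        using t by (auto simp: trig_def cos_eq_0)
      then have "l * of_real pi = of_real (real_of_int j + 1 / 2) * of_real pi" by (simp add: algebra_simps)
      then show thesis using that[of j] True by simp
    next
      case False
      then obtain j :: int where "l * of_real pi = complex_of_real(j * pi)"
        using t by (auto simp: trig_def sin_eq_0)
      then have "l * of_real pi = of_real (real_of_int j) * of_real pi" by simp
      then have "l = of_real (real_of_int j)" by simp
      moreover have "m mod 2 = 0" using False m by (cases "m = 0") (auto simp: le_Suc_eq numeral_2_eq_2)
      ultimately show thesis using that[of j] by simp
    qed
    obtain n :: nat where n: "(real_of_int j + real (m mod 2) / 2)\<^sup>2 = (real n + real (m mod 2) / 2)\<^sup>2"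
    proof -
      have "m mod 2 \<le> 1" by simp
      from int_square_nat[OF this, of j] show thesis using that by blast
    qed
    have \<mu>: "\<mu> = of_real ((real n + real (m mod 2) / 2)\<^sup>2)" using l(2) j n by (metis of_real_power)
    show "\<exists>n::nat. \<mu> = of_real ((real n + real m / 2)\<^sup>2)"
    proof (cases "m = 2")
      case True
      \<comment> \<open>The sine vanishes at all integers, but 0 is excluded in this branch; the
        positive integer n is therefore rewritten as (n - 1) + 1 to fit the pattern n + m/2 with m =
        2.\<close>
      then have "n \<noteq> 0" using \<mu> False by auto
      then have e: "real n + real (m mod 2) / 2 = real (n - 1) + real m / 2" using True by simp
      show ?thesis unfolding \<mu> e by (rule exI, rule refl)
    next
      case False
      then have "m mod 2 = m" using m by simp
      then show ?thesis using \<mu> by metis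
    qed
  next
    assume "\<exists>n::nat. \<mu> = of_real ((real n + real m / 2)\<^sup>2)"
    then obtain n :: nat where "\<mu> = of_real ((real n + real m / 2)\<^sup>2)" by blast
    then have "l = of_real (real n + real m / 2)"
      unfolding l_def by (simp add: of_real_sqrt[symmetric] del: of_real_add of_real_power)
    then have "cmod (trig m l) = 0" using norm_trig_near[OF m, of n 0] by simp
    then show "trig m l = 0" by simp
  qed
  finally show ?thesis .
qed

lemma std_chr_count:
  assumes m: "m \<le> 2"
  shows "card {\<mu>. std_chr m \<mu> = 0 \<and> cmod \<mu> < (radius m k)\<^sup>2} = Suc k"
proof -
  define f where "f = (\<lambda>n::nat. complex_of_real ((real n + real m / 2)\<^sup>2))"
  have lt: "cmod (f n) < (radius m k)\<^sup>2 \<longleftrightarrow> n \<le> k" for n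
  proof -
    have "cmod (f n) = (real n + real m / 2)\<^sup>2" unfolding f_def norm_of_real by simp
    moreover have "(real n + real m / 2)\<^sup>2 < (radius m k)\<^sup>2 \<longleftrightarrow> real n + real m / 2 < radius m k"
      unfolding not_le[symmetric] by (subst power_mono_iff) (auto simp: radius_def)
    moreover have "real n + real m / 2 < radius m k \<longleftrightarrow> n \<le> k" by (auto simp: radius_def)
    ultimately show ?thesis by simp
  qed
  have "{\<mu>. std_chr m \<mu> = 0 \<and> cmod \<mu> < (radius m k)\<^sup>2} = f ` {..k}"
  proof -
    have "std_chr m \<mu> = 0 \<longleftrightarrow> (\<exists>n. \<mu> = f n)" for \<mu> unfolding f_def by (rule std_chr_zeros[OF m])
    then show ?thesis using lt by auto
  qed
  moreover have "inj_on f {..k}"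
  proof (rule inj_onI)
    fix i j assume "f i = f j"
    then have "(real i + real m / 2)\<^sup>2 = (real j + real m / 2)\<^sup>2" by (simp only: f_def of_real_eq_iff)
    then have "real i + real m / 2 = real j + real m / 2" by (simp add: power2_eq_iff_nonneg)
    then show "i = j" by simp
  qed
  ultimately show ?thesis by (simp add: card_image)
qed

section \<open>Counting and asymptotics of the eigenvalues\<close>

context sl_potential
begin

context
  fixes \<alpha> \<beta> :: real
  assumes \<alpha>: "\<alpha> \<in> {0<..pi}" and \<beta>: "\<beta> \<in> {0..<pi}"
begin

lemma bc_order_le: "bc_order \<alpha> \<beta> \<le> 2" by (simp add: bc_order_def)

text \<open>The leading term is at least |A| |l| E / 4 with A = \<open>bc_coeff\<close> and E the
  exponential, and the error is at most C E. The summand 8C/|A| in L makes the error at most half of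
  that.\<close>

lemma chr_lower:
  obtains L where "1 \<le> L" "\<And>l. \<lbrakk>L \<le> cmod l; exp (\<bar>Im l\<bar> * pi) / 4 \<le> cmod (trig (bc_order \<alpha> \<beta>) l)\<rbrakk>
     \<Longrightarrow> \<bar>bc_coeff \<alpha> \<beta>\<bar> / 8 * cmod l * exp (\<bar>Im l\<bar> * pi) \<le> cmod (l ^ bc_order \<alpha> \<beta> * chr \<alpha> \<beta> (l\<^sup>2))"
proof -
  define A m C where "A = \<bar>bc_coeff \<alpha> \<beta>\<bar>" and "m = bc_order \<alpha> \<beta>" and "C = 8 * qnorm + 8"
  have A: "0 < A" using bc_coeff_nonzero[OF \<alpha> \<beta>] by (simp add: A_def)
  define L where "L = 1 + 2 * qnorm + 8 * C / A"
  have "0 \<le> 8 * C / A" using A qnorm_nonneg by (simp add: C_def)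
  then have L: "1 \<le> L" "2 * qnorm \<le> L" "8 * C / A \<le> L" using qnorm_nonneg by (auto simp: L_def)
  show thesis
  proof (rule that[OF L(1)])
    fix l assume l: "L \<le> cmod l" and t: "exp (\<bar>Im l\<bar> * pi) / 4 \<le> cmod (trig (bc_order \<alpha> \<beta>) l)"
    define E where "E = exp (\<bar>Im l\<bar> * pi)"
    have E: "0 < E" by (simp add: E_def)
    have as: "cmod (l ^ m * chr \<alpha> \<beta> (l\<^sup>2) - of_real (bc_coeff \<alpha> \<beta>) * l * trig m l) \<le> C * E"
      using chr_asymptotics[of l \<alpha> \<beta>] l L by (simp add: m_def C_def E_def)
    define P where "P = A * cmod l * E"
    define T where "T = of_real (bc_coeff \<alpha> \<beta>) * l * trig m l"
    define X where "X = l ^ m * chr \<alpha> \<beta> (l\<^sup>2)"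
    have "A * cmod l * (E / 4) \<le> cmod T"
      unfolding T_def norm_mult using t A by (auto simp: A_def E_def m_def intro!: mult_left_mono)
    then have 1: "P / 4 \<le> cmod T" by (simp add: P_def)
    have "8 * C \<le> A * L" using L(3) A by (simp add: field_simps)
    also have "\<dots> \<le> A * cmod l" using l A by (intro mult_left_mono) auto
    finally have "8 * C * E \<le> P" unfolding P_def using E by (intro mult_right_mono) auto
    then have 2: "C * E \<le> P / 8" by simp
    have "cmod T \<le> cmod X + C * E"
      using as norm_triangle_sub[of T X] unfolding T_def[symmetric] X_def[symmetric] by (simp add: norm_minus_commute)
    then have "P / 8 \<le> cmod X" using 1 2 by linarith
    then show "\<bar>bc_coeff \<alpha> \<beta>\<bar> / 8 * cmod l * exp (\<bar>Im l\<bar> * pi) \<le> cmod (l ^ bc_order \<alpha> \<beta> * chr \<alpha> \<beta> (l\<^sup>2))"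
      by (simp add: A_def[symmetric] m_def[symmetric] E_def[symmetric] X_def P_def)
  qed
qed

lemma chr_count:
  obtains K where "\<And>k. K \<le> k \<Longrightarrow> card {\<mu>. chr \<alpha> \<beta> \<mu> = 0 \<and> cmod \<mu> < (radius (bc_order \<alpha> \<beta>) k)\<^sup>2} = Suc k"
proof -
  define A m C where "A = bc_coeff \<alpha> \<beta>" and "m = bc_order \<alpha> \<beta>" and "C = 8 * qnorm + 8"
  have A: "A \<noteq> 0" using bc_coeff_nonzero[OF \<alpha> \<beta>] by (simp add: A_def)
  have m: "m \<le> 2" using bc_order_le by (simp add: m_def)
  define A0 where "A0 = (if m = 0 then -1 else 1 :: real)"
  have A0: "A0 * A0 = 1" "\<bar>A0\<bar> = 1" by (auto simp: A0_def)
  \<comment> \<open>\<open>A0\<close> is the leading coefficient of \<open>std_chr m\<close> and is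
    its own inverse, so \<open>F\<close> has exactly the leading term of \<open>chr\<close>, and the
    difference on the circle is only the asymptotic error.\<close>
  define F where "F = (\<lambda>\<mu>. of_real (A * A0) * std_chr m \<mu>)"
  have C: "8 \<le> C" using qnorm_nonneg by (simp add: C_def)
  obtain K where K: "1 + 2 * qnorm + (4 * C + 64 * \<bar>A\<bar>) / \<bar>A\<bar> < real K" using reals_Archimedean2 by blast
  show thesis
  proof (rule that[of K])
    fix k assume k: "K \<le> k"
    define R where "R = radius m k"
    have "real K \<le> R" using k radius_ge(2)[of k m] by (simp add: R_def)
    moreover have "0 \<le> (4 * C + 64 * \<bar>A\<bar>) / \<bar>A\<bar>" using C by (intro divide_nonneg_nonneg) auto
    moreover have "y0 + y < R" if "y0 + y < real K" "real K \<le> R" for y0 y using that by linarith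
    ultimately have R: "1 \<le> R" "2 * qnorm \<le> R" "(4 * C + 64 * \<bar>A\<bar>) / \<bar>A\<bar> < R"
      using K qnorm_nonneg by linarith+
    have AR: "4 * C + 64 * \<bar>A\<bar> < \<bar>A\<bar> * R" using R(3) A by (simp add: field_simps)
    have hF: "F holomorphic_on UNIV" unfolding F_def std_chr_def by (intro holomorphic_intros zero.chr_holomorphic)
    have zF: "F z = 0 \<longleftrightarrow> std_chr m z = 0" for z using A A0 by (auto simp: F_def)
    have dF: "deriv F z \<noteq> 0" if "F z = 0" for z
    proof -
      have "deriv (std_chr m) z \<noteq> 0" unfolding std_chr_def
        by (rule zero.chr_zero_simple) (use that zF std_chr_def in metis)
      moreover have "std_chr m field_differentiable at z"
        unfolding std_chr_def using zero.chr_holomorphic[of _ _ UNIV] by (auto simp: holomorphic_on_def)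
      ultimately show ?thesis unfolding F_def using A A0 by (auto simp: deriv_cmult)
    qed
    have "card {z. chr \<alpha> \<beta> z = 0 \<and> cmod z < R\<^sup>2} = card {z. F z = 0 \<and> cmod z < R\<^sup>2}"
    proof (rule rouche_simple_zeros[OF hF dF chr_holomorphic chr_zero_simple])
      show "0 < R\<^sup>2" using R by simp
      fix z :: complex assume z: "cmod z = R\<^sup>2"
      define l where "l = csqrt z"
      have l: "l\<^sup>2 = z" "cmod l = R" using z R by (auto simp: l_def norm_csqrt)
      have l0: "l \<noteq> 0" using l R by auto
      define E where "E = exp (\<bar>Im l\<bar> * pi)"
      have E: "0 < E" by (simp add: E_def)
      define T where "T = of_real A * l * trig m l"
      have 1: "cmod (l ^ m * chr \<alpha> \<beta> z - T) \<le> C * E"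
        using chr_asymptotics[of l \<alpha> \<beta>] l R by (simp add: m_def C_def E_def T_def A_def)
      have 2: "l ^ m * F z = T"
      proof -
        have "l ^ m * F z = of_real (A * A0) * (l ^ m * std_chr m (l\<^sup>2))" by (simp add: F_def l(1))
        also have "\<dots> = of_real (A * (A0 * A0)) * l * trig m l"
          unfolding std_chr_nonzero[OF m l0] by (simp add: A0_def)
        finally show ?thesis by (simp add: A0 T_def)
      qed
      have "E / 4 \<le> cmod (trig m l)" unfolding E_def by (rule cmod_trig_circle[OF m]) (use l R_def in auto)
      then have "\<bar>A\<bar> * R * (E / 4) \<le> cmod T" unfolding T_def norm_mult norm_of_real l(2) using R by (intro mult_left_mono) auto
      moreover have "C * E < \<bar>A\<bar> * R * (E / 4)"
      proof -
        have "4 * C < \<bar>A\<bar> * R" using AR by linarith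
        then have "4 * C * (E / 4) < \<bar>A\<bar> * R * (E / 4)" using E by (intro mult_strict_right_mono) auto
        then show ?thesis by simp
      qed
      ultimately have "cmod (l ^ m * chr \<alpha> \<beta> z - l ^ m * F z) < cmod (l ^ m * F z)" using 1 2 by simp
      then have "cmod (l ^ m) * cmod (chr \<alpha> \<beta> z - F z) < cmod (l ^ m) * cmod (F z)"
        by (simp only: norm_mult right_diff_distrib[symmetric])
      then show "cmod (chr \<alpha> \<beta> z - F z) < cmod (F z)" using l0 by simp
    qed
    also have "\<dots> = Suc k" unfolding zF R_def by (rule std_chr_count[OF m])
    finally show "card {\<mu>. chr \<alpha> \<beta> \<mu> = 0 \<and> cmod \<mu> < (radius (bc_order \<alpha> \<beta>) k)\<^sup>2} = Suc k"
      by (simp add: R_def m_def)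
  qed
qed

text \<open>The counts determine the increasing enumeration, so the description in
  \<open>sl_mu\<close> can be evaluated. At an eigenvalue the asymptotic formula leaves a bound for
  |A| x |sin(\<pi> d)|, where d is the deviation from n + m/2; the annulus containing the eigenvalue
  gives |d| <= 1/2, where |sin(\<pi> d)| >= |d|.\<close>

theorem eigenvalue_asymptotics:
  shows "range (\<lambda>n. complex_of_real (sl_mu q \<alpha> \<beta> n)) = {\<mu>. chr \<alpha> \<beta> \<mu> = 0}" "inj (sl_mu q \<alpha> \<beta>)"
    "\<exists>C N. \<forall>n\<ge>N. \<exists>x. sl_lambda q \<alpha> \<beta> n = of_real x \<and> \<bar>x - (real n + real (bc_order \<alpha> \<beta>) / 2)\<bar> \<le> C / real n"
proof -
  define A m C where "A = bc_coeff \<alpha> \<beta>" and "m = bc_order \<alpha> \<beta>" and "C = 8 * qnorm + 8"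
  have A: "A \<noteq> 0" using bc_coeff_nonzero[OF \<alpha> \<beta>] by (simp add: A_def)
  have m: "m \<le> 2" using bc_order_le by (simp add: m_def)
  obtain K1 where K1: "\<And>k. K1 \<le> k \<Longrightarrow> card {\<mu>. chr \<alpha> \<beta> \<mu> = 0 \<and> cmod \<mu> < (radius m k)\<^sup>2} = Suc k"
    using chr_count unfolding m_def by blast
  obtain L where L: "1 \<le> L" "\<And>l. \<lbrakk>L \<le> cmod l; exp (\<bar>Im l\<bar> * pi) / 4 \<le> cmod (trig m l)\<rbrakk>
     \<Longrightarrow> \<bar>A\<bar> / 8 * cmod l * exp (\<bar>Im l\<bar> * pi) \<le> cmod (l ^ m * chr \<alpha> \<beta> (l\<^sup>2))"
    using chr_lower unfolding m_def A_def by blast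
  define Z where "Z = {x::real. chr \<alpha> \<beta> (of_real x) = 0}"
  \<comment> \<open>A zero below -L^2 would have its square root far out on the imaginary axis,
    where \<open>chr_lower\<close> forbids it. Hence the zeros in a large disc are those real zeros
    to the left of its right boundary point.\<close>
  have neg: "- L\<^sup>2 < x" if x: "x \<in> Z" for x
  proof (rule ccontr)
    assume "\<not> - L\<^sup>2 < x"
    then have xL: "L\<^sup>2 \<le> - x" by simp
    define l where "l = \<i> * of_real (sqrt (- x))"
    have x0: "0 \<le> - x" using xL L(1) by (meson order_trans zero_le_power2)
    have l2: "l\<^sup>2 = of_real x" using x0 by (simp add: l_def power_mult_distrib flip: of_real_power)
    have lL: "L \<le> sqrt (- x)" using xL L(1) by (simp add: real_le_rsqrt)
    have nl: "cmod l = sqrt (- x)" "\<bar>Im l\<bar> = sqrt (- x)" using x0 by (auto simp: l_def norm_mult)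
    have l1: "1 \<le> \<bar>Im l\<bar>" "0 < cmod l" using nl lL L(1) by linarith+
    then have "1 * 1 \<le> pi * \<bar>Im l\<bar>" using pi_gt3 by (intro mult_mono) auto
    then have "exp (\<bar>Im l\<bar> * pi) / 4 \<le> cmod (trig m l)" by (intro cmod_trig_ge) auto
    then have "\<bar>A\<bar> / 8 * cmod l * exp (\<bar>Im l\<bar> * pi) \<le> cmod (l ^ m * chr \<alpha> \<beta> (l\<^sup>2))" using nl lL by (intro L(2)) auto
    moreover have "0 < \<bar>A\<bar> / 8 * cmod l * exp (\<bar>Im l\<bar> * pi)" using A l1 by simp
    ultimately show False using x l2 by (simp add: Z_def)
  qed
  obtain K2 :: nat where K2: "L + 2 * qnorm < real K2" using reals_Archimedean2 by blast
  define K where "K = max K1 K2"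
  define r where "r = (\<lambda>k. (radius m k)\<^sup>2)"
  have RK: "L \<le> radius m k" "2 * qnorm \<le> radius m k" if "K \<le> k" for k
    using radius_ge(2)[of k m] K2 L(1) qnorm_nonneg that by (auto simp: K_def)
  have zeros: "{\<mu>. chr \<alpha> \<beta> \<mu> = 0 \<and> cmod \<mu> < r k} = of_real ` {x\<in>Z. x < r k}" if k: "K \<le> k" for k
  proof
    show "{\<mu>. chr \<alpha> \<beta> \<mu> = 0 \<and> cmod \<mu> < r k} \<subseteq> of_real ` {x\<in>Z. x < r k}"
    proof
      fix \<mu> assume \<mu>: "\<mu> \<in> {\<mu>. chr \<alpha> \<beta> \<mu> = 0 \<and> cmod \<mu> < r k}"
      then obtain x where "\<mu> = of_real x" using chr_zero_real[of \<alpha> \<beta> \<mu>] by (auto elim: Reals_cases)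
      then show "\<mu> \<in> of_real ` {x\<in>Z. x < r k}" using \<mu> by (auto simp: Z_def)
    qed
    show "of_real ` {x\<in>Z. x < r k} \<subseteq> {\<mu>. chr \<alpha> \<beta> \<mu> = 0 \<and> cmod \<mu> < r k}"
    proof
      fix \<mu> :: complex assume "\<mu> \<in> of_real ` {x\<in>Z. x < r k}"
      then obtain x where x: "\<mu> = of_real x" "x \<in> Z" "x < r k" by auto
      have "L\<^sup>2 \<le> r k" using RK(1)[OF k] L(1) unfolding r_def by (intro power_mono) auto
      then have "\<bar>x\<bar> < r k" using x neg[OF x(2)] by auto
      then show "\<mu> \<in> {\<mu>. chr \<alpha> \<beta> \<mu> = 0 \<and> cmod \<mu> < r k}" using x by (auto simp: Z_def)
    qed
  qed
  have cardZ: "card {x\<in>Z. x < r k} = Suc k" if k: "K \<le> k" for k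
    using K1[of k] k zeros[OF k] card_image[of complex_of_real "{x\<in>Z. x < r k}"] by (simp add: K_def r_def inj_on_def)
  obtain f where f: "strict_mono f" "range f = Z" "\<And>k. K \<le> k \<Longrightarrow> r k \<le> f (Suc k) \<and> f (Suc k) < r (Suc k)"
  proof (rule enumeration[of r K Z])
    show "r i \<le> r j" if "i \<le> j" for i j
      unfolding r_def using radius_mono[OF that, of m] radius_ge(1)[of m i] by (intro power_mono) auto
    show "\<exists>k. x < r k" for x
    proof -
      obtain k :: nat where k: "\<bar>x\<bar> + 1 < real k" using reals_Archimedean2 by blast
      have R: "\<bar>x\<bar> + 1 < radius m k" using k radius_ge(2)[of k m] by linarith
      then have "radius m k * 1 \<le> radius m k * radius m k" by (intro mult_left_mono) auto
      then show ?thesis using R by (intro exI[of _ k]) (simp add: r_def power2_eq_square)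
    qed
    show "finite {x\<in>Z. x < r k}" "card {x\<in>Z. x < r k} = Suc k" if "K \<le> k" for k
      using cardZ[OF that] card_ge_0_finite[of "{x\<in>Z. x < r k}"] by auto
  qed blast
  have ran: "range (\<lambda>n. complex_of_real (f n)) = {\<mu>. chr \<alpha> \<beta> \<mu> = 0}"
  proof -
    have "range (\<lambda>n. complex_of_real (f n)) = of_real ` Z" using f(2) by (metis image_image)
    also have "\<dots> = {\<mu>. chr \<alpha> \<beta> \<mu> = 0}"
      using chr_zero_real[of \<alpha> \<beta>] by (auto simp: Z_def image_iff elim!: Reals_cases)
    finally show ?thesis .
  qed
  have mu: "sl_mu q \<alpha> \<beta> = f"
    unfolding sl_mu_def eigenvalue_iff_chr
  proof (rule the_equality)
    fix g :: "nat \<Rightarrow> real"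
    assume g: "strict_mono g \<and> range (\<lambda>n. complex_of_real (g n)) = {\<mu>. chr \<alpha> \<beta> \<mu> = 0}"
    have "complex_of_real ` range g = complex_of_real ` range f" using g ran by (simp add: image_image)
    then have "range g = range f" by (simp add: inj_image_eq_iff inj_def)
    then show "g = f" using strict_mono_range_unique g f(1) by blast
  qed (use f ran in auto)
  show "range (\<lambda>n. complex_of_real (sl_mu q \<alpha> \<beta> n)) = {\<mu>. chr \<alpha> \<beta> \<mu> = 0}" unfolding mu by (rule ran)
  show "inj (sl_mu q \<alpha> \<beta>)" unfolding mu using f(1) by (rule strict_mono_imp_inj_on)
  show "\<exists>C N. \<forall>n\<ge>N. \<exists>x. sl_lambda q \<alpha> \<beta> n = of_real x \<and> \<bar>x - (real n + real (bc_order \<alpha> \<beta>) / 2)\<bar> \<le> C / real n"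
  proof (rule exI[of _ "2 * C / \<bar>A\<bar>"], rule exI[of _ "Suc K"], intro allI impI)
    fix n assume n: "Suc K \<le> n"
    then obtain k where k: "n = Suc k" "K \<le> k" by (cases n) auto
    define x where "x = sqrt (f n)"
    have fn: "r k \<le> f n" "f n < r n" using f(3)[OF k(2)] k by auto
    have rk: "0 \<le> radius m k" "0 \<le> radius m n" using radius_ge(1)[of m] by (auto intro: order_trans[of _ "1/2"])
    have x: "radius m k \<le> x" "x < radius m n"
      using fn rk unfolding x_def r_def by (auto intro: real_le_rsqrt real_less_lsqrt)
    have x1: "1 \<le> x" "2 * qnorm \<le> x" using x RK[OF k(2)] L(1) by auto
    have fn0: "0 \<le> f n" using fn(1) by (simp add: r_def order_trans[OF zero_le_power2])
    then have "x\<^sup>2 = f n" by (simp add: x_def)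
    then have x2: "complex_of_real x ^ 2 = of_real (f n)" by (simp only: of_real_power[symmetric])
    have lam: "sl_lambda q \<alpha> \<beta> n = of_real x"
      unfolding sl_lambda_def mu x_def using fn0 by (simp add: csqrt_of_real_nonneg)
    have zero: "chr \<alpha> \<beta> ((of_real x)\<^sup>2) = 0" unfolding x2 using ran by blast
    \<comment> \<open>\<open>radius m k\<close> with n = k + 1 is n + m/2 - 1/2, and
      \<open>radius m n\<close> is n + m/2 + 1/2, so d lies between -1/2 and 1/2.\<close>
    define d where "d = x - (real n + real m / 2)"
    have "- (1/2) \<le> d" "d \<le> 1/2" using x unfolding d_def radius_def k(1) of_nat_Suc by linarith+
    then have d: "\<bar>d\<bar> \<le> 1/2" by linarith
    have "cmod (of_real A * of_real x * trig m (of_real x)) \<le> C"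
      using chr_asymptotics[of "of_real x" \<alpha> \<beta>] x1 zero by (simp add: A_def m_def C_def)
    moreover have "cmod (trig m (of_real x)) = \<bar>sin (pi * d)\<bar>"
      using norm_trig_near[OF m, of n d] by (simp add: d_def)
    ultimately have s: "\<bar>A\<bar> * x * \<bar>sin (pi * d)\<bar> \<le> C" using x1 by (simp add: norm_mult)
    have "\<bar>d\<bar> \<le> \<bar>pi * d\<bar> / 2"
    proof -
      have "2 * \<bar>d\<bar> \<le> pi * \<bar>d\<bar>" using pi_gt3 by (intro mult_right_mono) auto
      then show ?thesis by (simp add: abs_mult)
    qed
    also have "\<dots> \<le> \<bar>sin (pi * d)\<bar>"
    proof (rule sin_abs_ge_half)
      have "pi * \<bar>d\<bar> \<le> pi * (1/2)" using d by (intro mult_left_mono) auto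
      then show "\<bar>pi * d\<bar> \<le> pi / 2" by (simp add: abs_mult)
    qed
    finally have ds: "\<bar>d\<bar> \<le> \<bar>sin (pi * d)\<bar>" .
    have nx: "real n / 2 \<le> x" using x(1) k by (simp add: radius_def)
    have "\<bar>A\<bar> * (real n / 2) * \<bar>d\<bar> \<le> \<bar>A\<bar> * x * \<bar>sin (pi * d)\<bar>"
      using nx ds x1 by (intro mult_mono) auto
    then have "\<bar>A\<bar> * (real n / 2) * \<bar>d\<bar> \<le> C" using s by linarith
    moreover have "0 < \<bar>A\<bar> * (real n / 2)" using A k by simp
    ultimately have "\<bar>d\<bar> \<le> C / (\<bar>A\<bar> * (real n / 2))" by (simp only: pos_le_divide_eq mult.commute)
    also have "\<dots> = 2 * C / \<bar>A\<bar> / real n" by simp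
    finally have "\<bar>d\<bar> \<le> 2 * C / \<bar>A\<bar> / real n" .
    then show "\<exists>x. sl_lambda q \<alpha> \<beta> n = of_real x \<and> \<bar>x - (real n + real (bc_order \<alpha> \<beta>) / 2)\<bar> \<le> 2 * C / \<bar>A\<bar> / real n"
      using lam by (intro exI[of _ x]) (simp add: d_def m_def)
  qed
qed

end

end

section \<open>Cosine transforms\<close>

lemma integrable_leb_pi_iff: "integrable leb_pi f \<longleftrightarrow> f absolutely_integrable_on {0..pi}"
  for f :: "real \<Rightarrow> 'a::euclidean_space"
  unfolding set_integrable_def by (rule integrable_restrict_space) simp

lemma integrable_mult_continuous:
  fixes h k :: "real \<Rightarrow> complex"
  assumes "integrable leb_pi h" "continuous_on {0..pi} k"
  shows "integrable leb_pi (\<lambda>x. h x * k x)"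
  using absolutely_integrable_mult_continuous assms unfolding integrable_leb_pi_iff by blast

text \<open>At a simple zero of F the difference quotients of G and F have limits whose quotient
  G'/F' is the value assigned to H; continuity there removes the isolated singularity.\<close>

lemma holomorphic_simple_quotient:
  fixes G F :: "complex \<Rightarrow> complex"
  assumes G: "G holomorphic_on UNIV" and F: "F holomorphic_on UNIV"
    and simple: "\<And>z. F z = 0 \<Longrightarrow> deriv F z \<noteq> 0" and zero: "\<And>z. F z = 0 \<Longrightarrow> G z = 0"
  obtains H where "H holomorphic_on UNIV" "\<And>z. G z = H z * F z"
proof -
  define H where "H = (\<lambda>z. if F z = 0 then deriv G z / deriv F z else G z / F z)"
  have dF: "(F has_field_derivative deriv F z) (at z)" for z
    using F by (auto intro: holomorphic_derivI[of F UNIV])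
  have dG: "(G has_field_derivative deriv G z) (at z)" for z
    using G by (auto intro: holomorphic_derivI[of G UNIV])
  have cF: "(F \<longlongrightarrow> F z) (at z)" for z using DERIV_isCont[OF dF] by (simp add: isCont_def)
  have "H field_differentiable (at a)" for a
  proof (cases "F a = 0")
    case False
    have ev: "\<forall>\<^sub>F z in nhds a. F z \<noteq> 0"
      using tendsto_imp_eventually_ne[OF cF False] False by (simp add: eventually_nhds_conv_at)
    have "((\<lambda>z. G z / F z) has_field_derivative (deriv G a * F a - G a * deriv F a) / (F a * F a)) (at a)"
      by (rule DERIV_divide[OF dG dF False])
    then have "(H has_field_derivative (deriv G a * F a - G a * deriv F a) / (F a * F a)) (at a)"
      by (rule DERIV_cong_ev[THEN iffD1, rotated -1]) (use ev in \<open>auto simp: H_def elim!: eventually_mono\<close>)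
    then show ?thesis by (auto simp: field_differentiable_def)
  next
    case True
    have lF: "((\<lambda>z. (F z - F a) / (z - a)) \<longlongrightarrow> deriv F a) (at a)" using dF[of a] by (simp add: has_field_derivative_iff)
    have lG: "((\<lambda>z. (G z - G a) / (z - a)) \<longlongrightarrow> deriv G a) (at a)" using dG[of a] by (simp add: has_field_derivative_iff)
    have "\<forall>\<^sub>F z in at a. (F z - F a) / (z - a) \<noteq> 0" by (rule tendsto_imp_eventually_ne[OF lF simple[OF True]])
    then have "\<forall>\<^sub>F z in at a. F z \<noteq> 0" by eventually_elim (auto simp: True)
    then obtain r where r: "0 < r" "\<And>z. z \<noteq> a \<Longrightarrow> dist z a < r \<Longrightarrow> F z \<noteq> 0" by (auto simp: eventually_at)
    have "H holomorphic_on ball a r"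
    proof (rule no_isolated_singularity'[of "{a}"])
      fix z assume "z \<in> {a}"
      have "((\<lambda>z. ((G z - G a) / (z - a)) / ((F z - F a) / (z - a))) \<longlongrightarrow> deriv G a / deriv F a) (at a)"
        by (rule tendsto_divide[OF lG lF simple[OF True]])
      then have "(H \<longlongrightarrow> deriv G a / deriv F a) (at a)"
      proof (rule Lim_transform_eventually)
        show "\<forall>\<^sub>F z in at a. ((G z - G a) / (z - a)) / ((F z - F a) / (z - a)) = H z"
          unfolding eventually_at by (intro exI[of _ r]) (use r True zero[OF True] in \<open>auto simp: H_def\<close>)
      qed
      then show "(H \<longlongrightarrow> H z) (at z within ball a r)"
        using \<open>z \<in> {a}\<close> True by (auto simp: H_def intro: tendsto_within_subset)
    next
      have "(\<lambda>z. G z / F z) holomorphic_on (ball a r - {a})"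
        using r by (intro holomorphic_intros holomorphic_on_subset[OF G] holomorphic_on_subset[OF F]) (auto simp: dist_commute)
      then show "H holomorphic_on (ball a r - {a})"
        by (rule holomorphic_transform) (use r in \<open>auto simp: H_def dist_commute\<close>)
    qed auto
    then show ?thesis using r by (auto intro: holomorphic_on_imp_differentiable_at)
  qed
  then have "H holomorphic_on UNIV" by (simp add: holomorphic_on_def)
  moreover have "G z = H z * F z" for z using zero[of z] by (auto simp: H_def)
  ultimately show thesis using that by blast
qed

text \<open>Nothing is conjugated, so this is an entire even function of z. Inner products are
  recovered in \<open>cinner_cos_fun\<close> by conjugating \<open>h\<close> and the result.\<close>

definition cos_transform :: "(real \<Rightarrow> complex) \<Rightarrow> complex \<Rightarrow> complex" where
  "cos_transform h z = (LINT x|leb_pi. h x * cos (z * of_real x))"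

context
  fixes h :: "real \<Rightarrow> complex"
  assumes h: "integrable leb_pi h"
begin

lemma cos_transform_integrable: "integrable leb_pi (\<lambda>x. h x * cos (z * of_real x))"
  by (intro integrable_mult_continuous h continuous_intros)

lemma cos_transform_sums:
  "(\<lambda>n. (LINT x|leb_pi. h x * of_real x ^ n) * (cos_coeff n *\<^sub>R z ^ n)) sums cos_transform h z"
proof -
  define f where "f = (\<lambda>n x. h x * (cos_coeff n *\<^sub>R (z * of_real x) ^ n))"
  have fi: "integrable leb_pi (f n)" for n
    unfolding f_def by (intro integrable_mult_continuous h continuous_intros)
  have hn: "integrable leb_pi (\<lambda>x. norm (h x))" using h by simp
  have sn: "summable (\<lambda>n. norm (cos_coeff n *\<^sub>R (w::complex) ^ n))" for w by (rule summable_norm_cos)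
  have bound: "norm (f n x) \<le> norm (h x) * norm (cos_coeff n *\<^sub>R (of_real (norm z * pi) :: complex) ^ n)"
    if x: "x \<in> {0..pi}" for n x
  proof -
    have "norm z * \<bar>x\<bar> \<le> norm z * pi" using x by (intro mult_left_mono) auto
    then have "(norm z * \<bar>x\<bar>) ^ n \<le> (norm z * pi) ^ n" by (intro power_mono) auto
    then have "\<bar>cos_coeff n\<bar> * (norm z * \<bar>x\<bar>) ^ n \<le> \<bar>cos_coeff n\<bar> * (norm z * pi) ^ n" by (intro mult_left_mono) auto
    then have le: "norm (h x) * (\<bar>cos_coeff n\<bar> * (norm z * \<bar>x\<bar>) ^ n) \<le> norm (h x) * (\<bar>cos_coeff n\<bar> * (norm z * pi) ^ n)"
      by (rule mult_left_mono) simp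
    have "norm (f n x) = norm (h x) * (\<bar>cos_coeff n\<bar> * (norm z * \<bar>x\<bar>) ^ n)"
      by (simp add: f_def norm_mult norm_power)
    also note le
    also have "norm (h x) * (\<bar>cos_coeff n\<bar> * (norm z * pi) ^ n) = norm (h x) * norm (cos_coeff n *\<^sub>R (of_real (norm z * pi) :: complex) ^ n)"
      by (simp add: norm_power norm_mult)
    finally show ?thesis .
  qed
  have "(\<lambda>n. integral\<^sup>L leb_pi (f n)) sums (LINT x|leb_pi. (\<Sum>n. f n x))"
  proof (rule sums_integral)
    show "integrable leb_pi (f n)" for n by (rule fi)
    have "summable (\<lambda>n. norm (f n x))" for x
      unfolding f_def norm_mult[of "h x"] by (intro summable_mult sn)
    then show "AE x in leb_pi. summable (\<lambda>n. norm (f n x))" by simp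
    show "summable (\<lambda>n. LINT x|leb_pi. norm (f n x))"
    proof (rule summable_comparison_test')
      show "summable (\<lambda>n. (LINT x|leb_pi. norm (h x)) * norm (cos_coeff n *\<^sub>R (of_real (norm z * pi) :: complex) ^ n))"
        by (intro summable_mult sn)
      fix n
      have "(LINT x|leb_pi. norm (f n x)) \<le> (LINT x|leb_pi. norm (h x) * norm (cos_coeff n *\<^sub>R (of_real (norm z * pi) :: complex) ^ n))"
        by (rule integral_mono) (use fi hn bound in auto)
      then show "norm (LINT x|leb_pi. norm (f n x)) \<le> (LINT x|leb_pi. norm (h x)) * norm (cos_coeff n *\<^sub>R (of_real (norm z * pi) :: complex) ^ n)"
        by simp
    qed
  qed
  moreover have "(\<Sum>n. f n x) = h x * cos (z * of_real x)" for x
    using sums_mult[OF cos_converges, of "h x" "z * of_real x"] by (simp add: f_def sums_iff)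
  moreover have "integral\<^sup>L leb_pi (f n) = (LINT x|leb_pi. h x * of_real x ^ n) * (cos_coeff n *\<^sub>R z ^ n)" for n
  proof -
    have "f n = (\<lambda>x. (h x * of_real x ^ n) * (cos_coeff n *\<^sub>R z ^ n))"
      by (auto simp: f_def power_mult_distrib scaleR_conv_of_real)
    then show ?thesis by (simp only: integral_mult_left_zero)
  qed
  ultimately show ?thesis by (simp add: cos_transform_def)
qed

text \<open>Only even powers of z occur in the cosine series, so the transform is an everywhere
  convergent power series in z^2, and the branch cut of \<open>csqrt\<close> leaves no
  trace.\<close>

lemma cos_transform_csqrt_holomorphic: "(\<lambda>\<mu>. cos_transform h (csqrt \<mu>)) holomorphic_on UNIV"
proof -
  define a where "a = (\<lambda>n. (LINT x|leb_pi. h x * of_real x ^ (2 * n)) * of_real (cos_coeff (2 * n)))"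
  have "(\<lambda>n. a n * \<mu> ^ n) sums cos_transform h (csqrt \<mu>)" for \<mu>
  proof -
    define f where "f = (\<lambda>n. (LINT x|leb_pi. h x * of_real x ^ n) * (cos_coeff n *\<^sub>R csqrt \<mu> ^ n))"
    have "(\<lambda>n. f (2 * n)) sums cos_transform h (csqrt \<mu>)"
    proof (subst sums_mono_reindex)
      show "strict_mono ((*) (2::nat))" by (auto simp: strict_mono_def)
      show "f n = 0" if "n \<notin> range ((*) 2)" for n
      proof -
        have "odd n" using that by (auto elim!: evenE)
        then show ?thesis by (simp add: f_def cos_coeff_def)
      qed
      show "f sums cos_transform h (csqrt \<mu>)" unfolding f_def by (rule cos_transform_sums)
    qed
    moreover have "f (2 * n) = a n * \<mu> ^ n" for n
      by (simp add: f_def a_def scaleR_conv_of_real power_mult)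
    ultimately show ?thesis by simp
  qed
  then have "(\<lambda>\<mu>. cos_transform h (csqrt \<mu>)) holomorphic_on ball 0 r" for r
    by (intro power_series_holomorphic[of 0 r a]) simp
  then have "(\<lambda>\<mu>. cos_transform h (csqrt \<mu>)) field_differentiable (at z)" for z
    by (rule holomorphic_on_imp_differentiable_at[of _ "ball 0 (norm z + 1)"]) auto
  then show ?thesis by (simp add: holomorphic_on_def)
qed

lemma cos_transform_bound:
  "norm (cos_transform h z) \<le> (LINT x|leb_pi. norm (h x) * exp (\<bar>Im z\<bar> * x))"
    "integrable leb_pi (\<lambda>x. norm (h x) * exp (t * x))"
proof -
  have i: "integrable leb_pi (\<lambda>x. norm (h x) * exp (t * x))" for t
  proof -
    have "integrable leb_pi (\<lambda>x. h x * of_real (exp (t * x)))"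
      by (intro integrable_mult_continuous h continuous_intros)
    from integrable_norm[OF this] show ?thesis by (simp add: norm_mult)
  qed
  then show "integrable leb_pi (\<lambda>x. norm (h x) * exp (t * x))" .
  have "norm (cos_transform h z) \<le> (LINT x|leb_pi. norm (h x * cos (z * of_real x)))"
    unfolding cos_transform_def by (rule integral_norm_bound)
  also have "\<dots> \<le> (LINT x|leb_pi. norm (h x) * exp (\<bar>Im z\<bar> * x))"
  proof (rule integral_mono)
    show "integrable leb_pi (\<lambda>x. norm (h x * cos (z * of_real x)))" using cos_transform_integrable by simp
    fix x assume "x \<in> space leb_pi"
    then have "\<bar>Im (z * of_real x)\<bar> = \<bar>Im z\<bar> * x" by (simp add: abs_mult)
    then show "norm (h x * cos (z * of_real x)) \<le> norm (h x) * exp (\<bar>Im z\<bar> * x)"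
      unfolding norm_mult by (intro mult_left_mono) (metis cmod_cos_le, simp)
  qed (rule i)
  finally show "norm (cos_transform h z) \<le> (LINT x|leb_pi. norm (h x) * exp (\<bar>Im z\<bar> * x))" .
qed

text \<open>Times exp(n \<pi>) this dominates the transform at \<i> n, which is therefore of smaller
  order than exp(n \<pi>). Dominated convergence applies: the weight tends to 0 except at the single
  point x = \<pi>.\<close>

lemma weighted_integral_tendsto_0:
  "(\<lambda>n. LINT x|leb_pi. norm (h x) * exp (- (real n * (pi - x)))) \<longlonglongrightarrow> 0"
proof -
  have "(\<lambda>n. LINT x|leb_pi. norm (h x) * exp (- (real n * (pi - x)))) \<longlonglongrightarrow> (LINT x|leb_pi. 0)"
  proof (rule integral_dominated_convergence[where w = "\<lambda>x. norm (h x)"])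
    show "(\<lambda>x. norm (h x) * exp (- (real n * (pi - x)))) \<in> borel_measurable leb_pi" for n
    proof -
      have "integrable leb_pi (\<lambda>x. h x * of_real (exp (- (real n * (pi - x)))))"
        by (intro integrable_mult_continuous h continuous_intros)
      from integrable_norm[OF this] show ?thesis by (simp add: norm_mult borel_measurable_integrable)
    qed
    show "integrable leb_pi (\<lambda>x. norm (h x))" using h by simp
    have "AE x in leb_pi. x \<noteq> pi"
    proof -
      have "{pi} \<in> null_sets lebesgue" by (simp flip: negligible_iff_null_sets)
      then have "AE x in lebesgue. x \<noteq> pi" by (rule AE_I') auto
      then show ?thesis by (subst AE_restrict_space_iff) auto
    qed
    then show "AE x in leb_pi. (\<lambda>n. norm (h x) * exp (- (real n * (pi - x)))) \<longlonglongrightarrow> 0"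
    proof (rule AE_mp, intro AE_I2 impI)
      fix x assume x: "x \<in> space leb_pi" "x \<noteq> pi"
      then have "0 < pi - x" by auto
      then have "filterlim (\<lambda>n. real n * (pi - x)) at_top sequentially"
        by (intro filterlim_at_top_mult_tendsto_pos[OF tendsto_const _ filterlim_real_sequentially, THEN filterlim_cong[THEN iffD1, rotated 3]]) (auto simp: mult.commute)
      then have "(\<lambda>n. exp (- (real n * (pi - x)))) \<longlonglongrightarrow> 0"
        by (intro filterlim_compose[OF exp_at_bot] filterlim_uminus_at_bot[THEN iffD2]) auto
      then show "(\<lambda>n. norm (h x) * exp (- (real n * (pi - x)))) \<longlonglongrightarrow> 0" by (rule tendsto_mult_right_zero)
    qed
    show "AE x in leb_pi. norm (norm (h x) * exp (- (real n * (pi - x)))) \<le> norm (h x)" for n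
      by (intro AE_I2) (auto simp: mult_le_cancel_left2)
  qed simp
  then show ?thesis by simp
qed

text \<open>The functions $\Psi$ are in the variable $\mu = z^2$, and the growth conditions are stated in $z$.\<close>

theorem cos_transform_eq_0:
  assumes \<Psi>: "\<Psi> holomorphic_on UNIV" "\<And>\<mu>. \<Psi> \<mu> = 0 \<Longrightarrow> deriv \<Psi> \<mu> \<noteq> 0"
    and zero: "\<And>z. \<Psi> (z\<^sup>2) = 0 \<Longrightarrow> cos_transform h z = 0"
    and c: "0 < c" and R: "\<And>x. \<exists>k. x < R k"
    and circle: "\<And>k l. cmod l = R k \<Longrightarrow> c * exp (\<bar>Im l\<bar> * pi) \<le> cmod (\<Psi> (l\<^sup>2))"
    and axis: "\<And>t. t0 \<le> t \<Longrightarrow> c * exp (t * pi) \<le> cmod (\<Psi> ((\<i> * of_real t)\<^sup>2))"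
  shows "cos_transform h z = 0"
proof -
  define G where "G = (\<lambda>\<mu>. cos_transform h (csqrt \<mu>))"
  have G: "G holomorphic_on UNIV" unfolding G_def by (rule cos_transform_csqrt_holomorphic)
  have Gz: "G \<mu> = 0" if "\<Psi> \<mu> = 0" for \<mu> unfolding G_def by (rule zero) (simp add: that)
  have Gsq: "G (z\<^sup>2) = cos_transform h z" for z
  proof -
    have "csqrt (z\<^sup>2) = z \<or> csqrt (z\<^sup>2) = - z" by (metis power2_csqrt power2_eq_iff)
    then show ?thesis by (auto simp: G_def cos_transform_def)
  qed
  obtain H where H: "H holomorphic_on UNIV" "\<And>z. G z = H z * \<Psi> z"
    using holomorphic_simple_quotient[OF G \<Psi> Gz] by blast
  define N where "N = (LINT x|leb_pi. norm (h x))"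
  \<comment> \<open>The same exponential bounds the transform from above and \<Psi> from below, so
    it cancels. The bound \<open>N / c\<close> does not depend on the circle, and the maximum
    principle spreads it over the plane.\<close>
  have circ: "norm (H (l\<^sup>2)) \<le> N / c" if l: "cmod l = R k" for k l
  proof -
    define E where "E = exp (\<bar>Im l\<bar> * pi)"
    have E: "0 < E" by (simp add: E_def)
    have "norm (G (l\<^sup>2)) \<le> (LINT x|leb_pi. norm (h x) * exp (\<bar>Im l\<bar> * x))"
      unfolding Gsq by (rule cos_transform_bound(1))
    also have "\<dots> \<le> (LINT x|leb_pi. norm (h x) * E)"
      using h by (intro integral_mono cos_transform_bound(2)) (auto simp: E_def intro!: mult_left_mono)
    also have "\<dots> = N * E" by (simp add: N_def)
    finally have "norm (H (l\<^sup>2)) * norm (\<Psi> (l\<^sup>2)) \<le> N * E" by (simp add: H(2) norm_mult)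
    moreover have "norm (H (l\<^sup>2)) * (c * E) \<le> norm (H (l\<^sup>2)) * norm (\<Psi> (l\<^sup>2))"
      using circle[OF l] by (intro mult_left_mono) (auto simp: E_def)
    ultimately have "(norm (H (l\<^sup>2)) * c) * E \<le> N * E" by (simp add: mult.assoc)
    then have "norm (H (l\<^sup>2)) * c \<le> N" using E by simp
    then show ?thesis using c by (simp add: pos_le_divide_eq)
  qed
  have bd: "norm (H z) \<le> N / c" for z
  proof -
    obtain k where k: "norm z + 1 < R k" using R by blast
    then have R1: "1 < R k" using norm_ge_zero[of z] by linarith
    then have "R k * 1 \<le> R k * R k" by (intro mult_left_mono) auto
    then have zR: "norm z < (R k)\<^sup>2" using k by (simp add: power2_eq_square)
    show ?thesis
    proof (rule maximum_modulus_frontier[of H "ball 0 ((R k)\<^sup>2)"])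
      show "H holomorphic_on interior (ball 0 ((R k)\<^sup>2))" by (rule holomorphic_on_subset[OF H(1)]) auto
      show "continuous_on (closure (ball 0 ((R k)\<^sup>2))) H"
        by (rule holomorphic_on_imp_continuous_on[OF holomorphic_on_subset[OF H(1)]]) auto
      show "z \<in> ball 0 ((R k)\<^sup>2)" using zR by simp
      fix w assume "w \<in> frontier (ball (0::complex) ((R k)\<^sup>2))"
      then have "norm w = (R k)\<^sup>2" using R1 by (simp add: frontier_ball)
      then have "cmod (csqrt w) = R k" using R1 by (simp add: norm_csqrt)
      from circ[OF this] show "norm (H w) \<le> N / c" by simp
    qed simp
  qed
  then have "bounded (range H)" unfolding bounded_iff by blast
  then obtain d where d: "\<And>z. H z = d" using Liouville_theorem[OF H(1)] by (auto simp: constant_on_def)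
  have "norm d * c \<le> (LINT x|leb_pi. norm (h x) * exp (- (real n * (pi - x))))" if n: "max 0 t0 \<le> real n" for n
  proof -
    define l where "l = \<i> * complex_of_real (real n)"
    define E where "E = exp (real n * pi)"
    have E: "0 < E" by (simp add: E_def)
    have "norm d * (c * E) \<le> norm d * norm (\<Psi> (l\<^sup>2))"
      using axis[of "real n"] n unfolding l_def E_def by (intro mult_left_mono) auto
    also have "\<dots> = norm (G (l\<^sup>2))" by (simp add: H(2) d norm_mult)
    also have "\<dots> \<le> (LINT x|leb_pi. norm (h x) * exp (\<bar>Im l\<bar> * x))"
      unfolding Gsq by (rule cos_transform_bound(1))
    also have "\<dots> = (LINT x|leb_pi. (norm (h x) * exp (- (real n * (pi - x)))) * E)"
    proof -
      have "exp (\<bar>Im l\<bar> * x) = exp (- (real n * (pi - x))) * E" for x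
        unfolding E_def exp_add[symmetric] by (simp add: l_def algebra_simps)
      then show ?thesis by (simp add: mult.assoc)
    qed
    also have "\<dots> = (LINT x|leb_pi. norm (h x) * exp (- (real n * (pi - x)))) * E" by simp
    finally have "(norm d * c) * E \<le> (LINT x|leb_pi. norm (h x) * exp (- (real n * (pi - x)))) * E" by (simp only: mult.assoc)
    then show ?thesis using E by simp
  qed
  then have "\<forall>\<^sub>F n in sequentially. norm d * c \<le> (LINT x|leb_pi. norm (h x) * exp (- (real n * (pi - x))))"
  proof -
    obtain n0 :: nat where "max 0 t0 \<le> real n0" using real_arch_simple by blast
    then have "max 0 t0 \<le> real n" if "n0 \<le> n" for n using that by (meson of_nat_mono order_trans)
    then show ?thesis using \<open>\<And>n. max 0 t0 \<le> real n \<Longrightarrow> _ n\<close> by (intro eventually_sequentiallyI[of n0]) auto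
  qed
  then have "norm d * c \<le> 0"
    by (rule tendsto_lowerbound[OF weighted_integral_tendsto_0]) simp
  then have "norm d \<le> 0" using c by (simp add: mult_le_0_iff)
  then show ?thesis using H(2)[of "z\<^sup>2"] d Gsq by simp
qed

end

section \<open>The quotient Hilbert space\<close>

lemma L2_D:
  assumes "f \<in> L2"
  shows "f \<in> borel_measurable leb_pi" "integrable leb_pi (\<lambda>x. (cmod (f x))\<^sup>2)"
  using assms by (auto simp: L2_def)

lemma L2_I:
  assumes "f \<in> borel_measurable leb_pi" "integrable leb_pi g" "\<And>x. x \<in> {0..pi} \<Longrightarrow> (cmod (f x))\<^sup>2 \<le> g x"
  shows "f \<in> L2"
proof -
  have "integrable leb_pi (\<lambda>x. (cmod (f x))\<^sup>2)"
    by (rule Bochner_Integration.integrable_bound[OF assms(2)])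
      (use assms in \<open>auto intro!: AE_I2 order_trans[OF assms(3)] measurable_compose[OF assms(1)] borel_measurable_power\<close>)
  then show ?thesis using assms by (simp add: L2_def)
qed

lemma L2_add:
  assumes "f \<in> L2" "g \<in> L2"
  shows "(\<lambda>x. f x + g x) \<in> L2"
proof (rule L2_I)
  show "(\<lambda>x. f x + g x) \<in> borel_measurable leb_pi" using assms by (auto simp: L2_def)
  show "integrable leb_pi (\<lambda>x. 2 * (cmod (f x))\<^sup>2 + 2 * (cmod (g x))\<^sup>2)" using assms by (auto simp: L2_def)
  show "(cmod (f x + g x))\<^sup>2 \<le> 2 * (cmod (f x))\<^sup>2 + 2 * (cmod (g x))\<^sup>2" for x
  proof -
    have "(cmod (f x + g x))\<^sup>2 \<le> (cmod (f x) + cmod (g x))\<^sup>2" by (intro power_mono norm_triangle_ineq) auto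
    also have "\<dots> \<le> 2 * (cmod (f x))\<^sup>2 + 2 * (cmod (g x))\<^sup>2"
      using sum_squares_bound[of "cmod (f x)" "cmod (g x)"] by (simp add: power2_sum)
    finally show ?thesis .
  qed
qed

lemma L2_cmult:
  assumes "f \<in> L2"
  shows "(\<lambda>x. c * f x) \<in> L2"
  using assms by (auto simp: L2_def norm_mult power_mult_distrib)

lemma L2_zero: "(\<lambda>x. 0) \<in> L2"
  by (simp add: L2_def)

lemma L2_diff:
  assumes "f \<in> L2" "g \<in> L2"
  shows "(\<lambda>x. f x - g x) \<in> L2"
  using L2_add[OF assms(1) L2_cmult[OF assms(2), of "-1"]] by simp

lemma L2_sum:
  assumes "\<And>i. i \<in> I \<Longrightarrow> f i \<in> L2"
  shows "(\<lambda>x. \<Sum>i\<in>I. f i x) \<in> L2"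
  using assms by (induction I rule: infinite_finite_induct) (auto intro: L2_zero L2_add)

lemma L2_inner_integrable:
  assumes "f \<in> L2" "g \<in> L2"
  shows "integrable leb_pi (\<lambda>x. f x * cnj (g x))"
proof (rule Bochner_Integration.integrable_bound)
  show "integrable leb_pi (\<lambda>x. (cmod (f x))\<^sup>2 + (cmod (g x))\<^sup>2)" using assms by (auto simp: L2_def)
  have "cnj \<in> borel_measurable borel" by (intro borel_measurable_continuous_onI continuous_intros)
  then have "(\<lambda>x. cnj (g x)) \<in> borel_measurable leb_pi"
    by (rule measurable_compose[OF L2_D(1)[OF assms(2)]])
  then show "(\<lambda>x. f x * cnj (g x)) \<in> borel_measurable leb_pi" using assms(1) by (auto simp: L2_def)
  have "norm (f x * cnj (g x)) \<le> norm ((cmod (f x))\<^sup>2 + (cmod (g x))\<^sup>2)" for x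
  proof -
    have "2 * (cmod (f x) * cmod (g x)) \<le> (cmod (f x))\<^sup>2 + (cmod (g x))\<^sup>2"
      using sum_squares_bound[of "cmod (f x)" "cmod (g x)"] by (simp add: mult.assoc)
    moreover have "0 \<le> cmod (f x) * cmod (g x)" by simp
    ultimately have "cmod (f x) * cmod (g x) \<le> (cmod (f x))\<^sup>2 + (cmod (g x))\<^sup>2" by linarith
    then show ?thesis by (simp add: norm_mult)
  qed
  then show "AE x in leb_pi. norm (f x * cnj (g x)) \<le> norm ((cmod (f x))\<^sup>2 + (cmod (g x))\<^sup>2)" by simp
qed

lemma finite_measure_leb_pi: "finite_measure leb_pi"
  by (rule finite_measureI) (simp add: emeasure_restrict_space)

lemma L2_continuous:
  assumes "continuous_on {0..pi} f"
  shows "f \<in> L2"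
proof -
  obtain B where B: "\<And>x. x \<in> {0..pi} \<Longrightarrow> cmod (f x) \<le> B"
    using compact_imp_bounded[OF compact_continuous_image[OF assms compact_Icc]]
    unfolding bounded_iff by (metis imageI)
  show ?thesis
  proof (rule L2_I)
    show "f \<in> borel_measurable leb_pi" by (rule continuous_imp_measurable_on_sets_lebesgue[OF assms]) simp
    show "integrable leb_pi (\<lambda>x. B\<^sup>2)" by (rule finite_measure.integrable_const[OF finite_measure_leb_pi])
    show "(cmod (f x))\<^sup>2 \<le> B\<^sup>2" if "x \<in> {0..pi}" for x using B[OF that] by (intro power_mono) auto
  qed
qed

lemma L2_integrable:
  assumes "f \<in> L2"
  shows "integrable leb_pi f"
  using L2_inner_integrable[OF assms L2_continuous[of "\<lambda>_. 1"]] by simp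

definition l2_rel :: "(real \<Rightarrow> complex) \<Rightarrow> (real \<Rightarrow> complex) \<Rightarrow> bool" where
  "l2_rel f g \<longleftrightarrow> f \<in> L2 \<and> g \<in> L2 \<and> ae_eq f g"

quotient_type l2 = "real \<Rightarrow> complex" / partial: l2_rel
proof (rule part_equivpI)
  show "\<exists>f. l2_rel f f" by (intro exI[of _ "\<lambda>_. 0"]) (simp add: l2_rel_def L2_zero ae_eq_def)
  show "symp l2_rel" by (auto intro!: sympI simp: l2_rel_def ae_eq_def elim: AE_mp)
  show "transp l2_rel" by (auto intro!: transpI simp: l2_rel_def ae_eq_def elim!: AE_mp)
qed

lemma l2_inner_cong:
  assumes "l2_rel f f'" "l2_rel g g'"
  shows "l2_inner f g = l2_inner f' g'"
  unfolding l2_inner_def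
proof (rule integral_cong_AE)
  show "(\<lambda>x. f x * cnj (g x)) \<in> borel_measurable leb_pi" "(\<lambda>x. f' x * cnj (g' x)) \<in> borel_measurable leb_pi"
    using assms by (auto simp: l2_rel_def intro!: borel_measurable_integrable L2_inner_integrable)
  show "AE x in leb_pi. f x * cnj (g x) = f' x * cnj (g' x)"
    using assms unfolding l2_rel_def ae_eq_def by (auto elim!: AE_mp)
qed

lift_definition l2_cinner :: "l2 \<Rightarrow> l2 \<Rightarrow> complex" is l2_inner
  by (rule l2_inner_cong)

lift_definition l2_cscale :: "complex \<Rightarrow> l2 \<Rightarrow> l2" is "\<lambda>c f x. c * f x"
  by (auto simp: l2_rel_def L2_cmult ae_eq_def elim!: AE_mp)

text \<open>The real structure is the base, so that norms, series, bounded linear maps and the fixed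
  point theorem come from the real theory; scalar multiplication and the complex inner product are
  laid over it, with the real inner product as real part.\<close>

class complex_hilbert = real_inner + complete_space +
  fixes cscale :: "complex \<Rightarrow> 'a \<Rightarrow> 'a" (infixr "*\<^sub>C" 75)
    and cinner :: "'a \<Rightarrow> 'a \<Rightarrow> complex"
  assumes cscale_add_right: "c *\<^sub>C (x + y) = c *\<^sub>C x + c *\<^sub>C y"
    and cscale_add_left: "(c + d) *\<^sub>C x = c *\<^sub>C x + d *\<^sub>C x"
    and cscale_cscale: "c *\<^sub>C d *\<^sub>C x = (c * d) *\<^sub>C x"
    and scaleR_cscale: "r *\<^sub>R x = of_real r *\<^sub>C x"
    and cinner_add_left: "cinner (x + y) z = cinner x z + cinner y z"
    and cinner_cscale_left: "cinner (c *\<^sub>C x) y = c * cinner x y"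
    and cinner_commute: "cinner y x = cnj (cinner x y)"
    and inner_cinner: "inner x y = Re (cinner x y)"

instantiation l2 :: real_inner
begin

lift_definition zero_l2 :: l2 is "\<lambda>x. 0" by (simp add: l2_rel_def L2_zero ae_eq_def)

lift_definition plus_l2 :: "l2 \<Rightarrow> l2 \<Rightarrow> l2" is "\<lambda>f g x. f x + g x"
  by (auto simp: l2_rel_def L2_add ae_eq_def elim!: AE_mp)

definition uminus_l2 :: "l2 \<Rightarrow> l2" where "uminus_l2 x = l2_cscale (-1) x"
definition minus_l2 :: "l2 \<Rightarrow> l2 \<Rightarrow> l2" where "minus_l2 x y = x + l2_cscale (-1) y"
definition scaleR_l2 :: "real \<Rightarrow> l2 \<Rightarrow> l2" where "scaleR_l2 r x = l2_cscale (of_real r) x"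
definition inner_l2 :: "l2 \<Rightarrow> l2 \<Rightarrow> real" where "inner_l2 x y = Re (l2_cinner x y)"
definition norm_l2 :: "l2 \<Rightarrow> real" where "norm_l2 x = sqrt (inner x x)"
definition dist_l2 :: "l2 \<Rightarrow> l2 \<Rightarrow> real" where "dist_l2 x y = norm (x - y)"
definition sgn_l2 :: "l2 \<Rightarrow> l2" where "sgn_l2 x = inverse (norm x) *\<^sub>R x"
definition uniformity_l2 :: "(l2 \<times> l2) filter" where
  "uniformity_l2 = (INF e\<in>{0 <..}. principal {(x, y). dist x y < e})"
definition open_l2 :: "l2 set \<Rightarrow> bool" where
  "open_l2 U = (\<forall>x\<in>U. \<forall>\<^sub>F (x', y) in uniformity. x' = x \<longrightarrow> y \<in> U)"

lemma l2_cscale_props: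
  fixes x y :: l2
  shows "l2_cscale c (x + y) = l2_cscale c x + l2_cscale c y"
    "l2_cscale (c + d) x = l2_cscale c x + l2_cscale d x"
    "l2_cscale c (l2_cscale d x) = l2_cscale (c * d) x"
    "l2_cscale 1 x = x" "l2_cscale 0 x = 0"
  by (transfer; auto simp: l2_rel_def ae_eq_def algebra_simps intro!: L2_add L2_cmult L2_zero)+

lemma l2_cinner_props:
  fixes x y z :: l2
  shows "l2_cinner (x + y) z = l2_cinner x z + l2_cinner y z"
    "l2_cinner (l2_cscale c x) y = c * l2_cinner x y"
    "l2_cinner y x = cnj (l2_cinner x y)"
proof -
  show "l2_cinner (x + y) z = l2_cinner x z + l2_cinner y z"
  proof transfer
    fix f g h assume "l2_rel f f" "l2_rel g g" "l2_rel h h"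
    then show "l2_inner (\<lambda>x. f x + g x) h = l2_inner f h + l2_inner g h"
      unfolding l2_inner_def l2_rel_def
      by (subst Bochner_Integration.integral_add[symmetric]) (auto simp: distrib_right intro: L2_inner_integrable)
  qed
  show "l2_cinner (l2_cscale c x) y = c * l2_cinner x y"
    by transfer (simp add: l2_inner_def mult.assoc)
  show "l2_cinner y x = cnj (l2_cinner x y)"
  proof transfer
    fix f g :: "real \<Rightarrow> complex"
    have "(\<lambda>t. f t * cnj (g t)) = (\<lambda>t. cnj (g t * cnj (f t)))" by (simp add: mult.commute)
    then show "l2_inner f g = cnj (l2_inner g f)" unfolding l2_inner_def by (simp only: Bochner_Integration.integral_cnj)
  qed
qed

lemma l2_cinner_self:
  assumes "f \<in> L2"
  shows "l2_inner f f = of_real (LINT x|leb_pi. (cmod (f x))\<^sup>2)"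
  unfolding l2_inner_def complex_norm_square[symmetric] by (rule integral_complex_of_real)

lemma l2_plus_props:
  fixes x y z :: l2
  shows "x + y + z = x + (y + z)" "x + y = y + x" "0 + x = x"
  by (transfer; auto simp: l2_rel_def ae_eq_def algebra_simps intro!: L2_add L2_zero)+

lemma l2_cinner_self_zero:
  "0 \<le> Re (l2_cinner x x)" "Re (l2_cinner x x) = 0 \<longleftrightarrow> x = 0"
proof -
  show "0 \<le> Re (l2_cinner x x)"
    by transfer (simp add: l2_rel_def l2_cinner_self)
  show "Re (l2_cinner x x) = 0 \<longleftrightarrow> x = 0"
  proof transfer
    fix f assume f: "l2_rel f f"
    then have "Re (l2_inner f f) = 0 \<longleftrightarrow> (AE x in leb_pi. (cmod (f x))\<^sup>2 = 0)"
      by (simp add: l2_rel_def l2_cinner_self integral_nonneg_eq_0_iff_AE L2_D)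
    then show "Re (l2_inner f f) = 0 \<longleftrightarrow> l2_rel f (\<lambda>x. 0)"
      using f by (simp add: l2_rel_def ae_eq_def L2_zero)
  qed
qed

instance
proof
  fix x y z :: l2 and a b r :: real
  have m: "l2_cscale (-1) x + x = 0" for x :: l2
    using l2_cscale_props(2)[of "-1" 1 x] by (simp add: l2_cscale_props)
  show "dist x y = norm (x - y)" by (rule dist_l2_def)
  show "sgn x = inverse (norm x) *\<^sub>R x" by (rule sgn_l2_def)
  show "uniformity = (INF e\<in>{0 <..}. principal {(x :: l2, y). dist x y < e})" by (rule uniformity_l2_def)
  show "open U \<longleftrightarrow> (\<forall>x\<in>U. \<forall>\<^sub>F (x', y) in uniformity. x' = x \<longrightarrow> y \<in> U)" for U :: "l2 set" by (rule open_l2_def)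
  show "x + y + z = x + (y + z)" "x + y = y + x" "0 + x = x" by (rule l2_plus_props)+
  show "- x + x = 0" using m by (simp add: uminus_l2_def)
  show "x - y = x + - y" by (simp add: minus_l2_def uminus_l2_def)
  show "r *\<^sub>R (x + y) = r *\<^sub>R x + r *\<^sub>R y" "(a + b) *\<^sub>R x = a *\<^sub>R x + b *\<^sub>R x" "a *\<^sub>R b *\<^sub>R x = (a * b) *\<^sub>R x" "1 *\<^sub>R x = x"
    by (simp_all add: scaleR_l2_def l2_cscale_props)
  show "inner x y = inner y x" unfolding inner_l2_def by (subst l2_cinner_props(3)) simp
  show "inner (x + y) z = inner x z + inner y z" "inner (r *\<^sub>R x) y = r * inner x y"
    by (simp_all add: inner_l2_def scaleR_l2_def l2_cinner_props(1,2))
  show "0 \<le> inner x x" "inner x x = 0 \<longleftrightarrow> x = 0" by (simp_all add: inner_l2_def l2_cinner_self_zero)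
  show "norm x = sqrt (inner x x)" by (rule norm_l2_def)
qed

end

definition of_fun :: "(real \<Rightarrow> complex) \<Rightarrow> l2" where "of_fun f = abs_l2 f"
definition to_fun :: "l2 \<Rightarrow> real \<Rightarrow> complex" where "to_fun = rep_l2"

lemma to_fun_L2 [simp]: "to_fun x \<in> L2"
  using Quotient_rep_reflp[OF Quotient_l2] by (auto simp: to_fun_def l2_rel_def)

lemma of_fun_to_fun [simp]: "of_fun (to_fun x) = x"
  unfolding of_fun_def to_fun_def by (rule Quotient_abs_rep[OF Quotient_l2])

lemma of_fun_eq_iff: "f \<in> L2 \<Longrightarrow> g \<in> L2 \<Longrightarrow> of_fun f = of_fun g \<longleftrightarrow> ae_eq f g"
  unfolding of_fun_def using Quotient_rel[OF Quotient_l2, of f g] by (auto simp: l2_rel_def ae_eq_def)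

lemma to_fun_of_fun: "f \<in> L2 \<Longrightarrow> ae_eq (to_fun (of_fun f)) f"
  using of_fun_eq_iff[of "to_fun (of_fun f)" f] by simp

lemma l2_rel_refl: "f \<in> L2 \<Longrightarrow> l2_rel f f"
  by (simp add: l2_rel_def ae_eq_def)

lemma of_fun_add: "f \<in> L2 \<Longrightarrow> g \<in> L2 \<Longrightarrow> of_fun (\<lambda>x. f x + g x) = of_fun f + of_fun g"
  unfolding of_fun_def by (subst plus_l2.abs_eq) (auto intro: l2_rel_refl)

lemma of_fun_cscale: "f \<in> L2 \<Longrightarrow> of_fun (\<lambda>x. c * f x) = l2_cscale c (of_fun f)"
  unfolding of_fun_def by (subst l2_cscale.abs_eq) (auto intro: l2_rel_refl)

lemma of_fun_cinner: "f \<in> L2 \<Longrightarrow> g \<in> L2 \<Longrightarrow> l2_cinner (of_fun f) (of_fun g) = l2_inner f g"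
  unfolding of_fun_def by (subst l2_cinner.abs_eq) (auto intro: l2_rel_refl)

lemma of_fun_zero: "of_fun (\<lambda>x. 0) = 0"
  by (simp add: of_fun_def zero_l2_def)

lemma of_fun_diff:
  assumes "f \<in> L2" "g \<in> L2"
  shows "of_fun (\<lambda>x. f x - g x) = of_fun f - of_fun g"
  using of_fun_add[OF assms(1) L2_cmult[OF assms(2), of "-1"]] of_fun_cscale[OF assms(2), of "-1"]
  by (simp add: minus_l2_def)

lemma of_fun_sum:
  assumes "\<And>i. i \<in> I \<Longrightarrow> f i \<in> L2"
  shows "of_fun (\<lambda>x. \<Sum>i\<in>I. f i x) = (\<Sum>i\<in>I. of_fun (f i))"
  using assms
  by (induction I rule: infinite_finite_induct) (auto simp: of_fun_zero of_fun_add L2_sum)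

lemma norm_of_fun: "f \<in> L2 \<Longrightarrow> norm (of_fun f) = l2_norm f"
  by (simp add: norm_l2_def inner_l2_def of_fun_cinner l2_cinner_self l2_norm_def)

lemma l2_norm_square: "f \<in> L2 \<Longrightarrow> (LINT x|leb_pi. (cmod (f x))\<^sup>2) = (l2_norm f)\<^sup>2"
  by (simp add: l2_norm_def)

lemma nn_integral_cmod_square:
  assumes "f \<in> L2"
  shows "(\<integral>\<^sup>+x. ennreal ((cmod (f x))\<^sup>2) \<partial>leb_pi) = ennreal ((l2_norm f)\<^sup>2)"
  by (subst nn_integral_eq_integral[OF L2_D(2)[OF assms]]) (simp_all add: l2_norm_square assms)

lemma L2_I_nn:
  assumes m: "f \<in> borel_measurable leb_pi" and le: "(\<integral>\<^sup>+x. ennreal ((cmod (f x))\<^sup>2) \<partial>leb_pi) \<le> ennreal (B\<^sup>2)"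
    and B: "0 \<le> B"
  shows "f \<in> L2" "l2_norm f \<le> B"
proof -
  have "integrable leb_pi (\<lambda>x. (cmod (f x))\<^sup>2)"
  proof (rule integrableI_bounded)
    show "(\<lambda>x. (cmod (f x))\<^sup>2) \<in> borel_measurable leb_pi" using m by measurable
    show "(\<integral>\<^sup>+x. ennreal (norm ((cmod (f x))\<^sup>2)) \<partial>leb_pi) < \<infinity>" using le by (simp add: le_less_trans)
  qed
  then show f: "f \<in> L2" using m by (simp add: L2_def)
  have "(l2_norm f)\<^sup>2 \<le> B\<^sup>2" using le unfolding nn_integral_cmod_square[OF f] by (simp add: ennreal_le_iff)
  then show "l2_norm f \<le> B" using B by (rule power2_le_imp_le)
qed

text \<open>Cauchy-Schwarz against the constant 1, whose norm is the square root of \<pi>. It turns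
  summable L2 increments into summable L1 increments in the completeness proof.\<close>

lemma nn_integral_cmod_le:
  assumes f: "f \<in> L2"
  shows "(\<integral>\<^sup>+x. ennreal (cmod (f x)) \<partial>leb_pi) \<le> ennreal (sqrt pi * l2_norm f)"
proof -
  define g where "g = (\<lambda>x. complex_of_real (cmod (f x)))"
  define one where "one = (\<lambda>x::real. 1::complex)"
  have g: "g \<in> L2"
    by (rule L2_I[of _ "\<lambda>x. (cmod (f x))\<^sup>2"]) (use L2_D[OF f] in \<open>auto simp: g_def\<close>)
  have one: "one \<in> L2" unfolding one_def by (rule L2_continuous) simp
  have no: "l2_norm one = sqrt pi"
    by (simp add: l2_norm_def one_def measure_restrict_space)
  have ng: "l2_norm g = l2_norm f" by (simp add: l2_norm_def g_def)
  have "\<bar>inner (of_fun g) (of_fun one)\<bar> \<le> norm (of_fun g) * norm (of_fun one)" by (rule Cauchy_Schwarz_ineq2)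
  also have "inner (of_fun g) (of_fun one) = (LINT x|leb_pi. cmod (f x))"
  proof -
    have "l2_inner g one = of_real (LINT x|leb_pi. cmod (f x))"
      by (simp add: l2_inner_def g_def one_def)
    then show ?thesis using g one by (simp add: inner_l2_def of_fun_cinner)
  qed
  finally have "(LINT x|leb_pi. cmod (f x)) \<le> sqrt pi * l2_norm f"
    using g one by (simp add: norm_of_fun no ng mult.commute)
  moreover have "integrable leb_pi (\<lambda>x. cmod (f x))" using L2_integrable[OF f] by simp
  ultimately show ?thesis by (subst nn_integral_eq_integral) (auto intro: ennreal_leI)
qed

text \<open>A subsequence with increments of norm at most (1/2)^k converges almost everywhere,
  because the increments are summable in L1. Fatou's lemma shows that the pointwise limit is the
  limit in norm, and a Cauchy sequence follows its subsequence.\<close>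

instance l2 :: complete_space
proof
  fix X :: "nat \<Rightarrow> l2"
  assume X: "Cauchy X"
  have "\<exists>N. \<forall>m\<ge>N. \<forall>n\<ge>N. norm (X m - X n) < (1/2) ^ k" for k :: nat
    using CauchyD[OF X, of "(1/2)^k"] by simp
  then obtain N where N: "\<And>k m n. N k \<le> m \<Longrightarrow> N k \<le> n \<Longrightarrow> norm (X m - X n) < (1/2) ^ k" by metis
  \<comment> \<open>Adding k makes the indices strictly increasing; the sum of all earlier
    thresholds keeps \<open>r j\<close> above \<open>N k\<close> for every k up to j.\<close>
  define r where "r = (\<lambda>k::nat. k + (\<Sum>i\<le>k. N i))"
  have r: "strict_mono r" by (rule strict_monoI_Suc) (simp add: r_def)
  have rN: "N k \<le> r j" if "k \<le> j" for k j
    using member_le_sum[of k "{..j}" N] that by (simp add: r_def)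
  define f where "f = (\<lambda>k. to_fun (X (r k)))"
  have f: "f k \<in> L2" for k by (simp add: f_def)
  have fm: "f k \<in> borel_measurable leb_pi" for k by (rule L2_D[OF f])
  have nf: "l2_norm (\<lambda>x. f j x - f i x) = norm (X (r j) - X (r i))" for i j
    using norm_of_fun[OF L2_diff[OF f[of j] f[of i]]] of_fun_diff[OF f[of j] f[of i]] by (simp add: f_def)
  define g where "g = (\<lambda>k x. f (Suc k) x - f k x)"
  have g: "g k \<in> L2" for k unfolding g_def by (rule L2_diff[OF f f])
  have gn: "l2_norm (g k) \<le> (1/2) ^ k" for k
    unfolding g_def nf using N[of k "r (Suc k)" "r k"] rN[of k "Suc k"] rN[of k k] by simp
  have "(\<integral>\<^sup>+x. (\<Sum>k. ennreal (cmod (g k x))) \<partial>leb_pi) = (\<Sum>k. \<integral>\<^sup>+x. ennreal (cmod (g k x)) \<partial>leb_pi)"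
    using L2_D(1)[OF g] by (intro nn_integral_suminf) measurable
  also have "\<dots> \<le> (\<Sum>k. ennreal (sqrt pi * (1/2) ^ k))"
  proof (rule suminf_le)
    fix k
    have "(\<integral>\<^sup>+x. ennreal (cmod (g k x)) \<partial>leb_pi) \<le> ennreal (sqrt pi * l2_norm (g k))" by (rule nn_integral_cmod_le[OF g])
    also have "\<dots> \<le> ennreal (sqrt pi * (1/2) ^ k)" using gn by (intro ennreal_leI mult_left_mono) auto
    finally show "(\<integral>\<^sup>+x. ennreal (cmod (g k x)) \<partial>leb_pi) \<le> ennreal (sqrt pi * (1/2) ^ k)" .
  qed auto
  also have "\<dots> = ennreal (\<Sum>k. sqrt pi * (1/2) ^ k)"
    by (rule suminf_ennreal2) (auto intro!: summable_mult summable_geometric)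
  also have "\<dots> < \<infinity>" by simp
  finally have "AE x in leb_pi. (\<Sum>k. ennreal (cmod (g k x))) \<noteq> \<infinity>"
    using L2_D(1)[OF g] by (intro nn_integral_PInf_AE) auto
  then have conv: "AE x in leb_pi. convergent (\<lambda>k. f k x)"
  proof (rule AE_mp, intro AE_I2 impI)
    fix x assume "(\<Sum>k. ennreal (cmod (g k x))) \<noteq> \<infinity>"
    then have "summable (\<lambda>k. cmod (g k x))" by (intro summable_suminf_not_top) auto
    then have "summable (\<lambda>k. g k x)" by (rule summable_norm_cancel)
    then have "convergent (\<lambda>n. \<Sum>k<n. g k x)" by (simp add: summable_iff_convergent)
    then have "convergent (\<lambda>n. (\<Sum>k<n. g k x) + f 0 x)" by (intro convergent_add convergent_const)
    moreover have "(\<Sum>k<n. g k x) + f 0 x = f n x" for n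
      using sum_lessThan_telescope[of "\<lambda>k. f k x" n] by (simp add: g_def)
    ultimately show "convergent (\<lambda>k. f k x)" by simp
  qed
  define F where "F = (\<lambda>x. lim (\<lambda>k. f k x))"
  have Fm: "F \<in> borel_measurable leb_pi" unfolding F_def using fm by (intro borel_measurable_lim_metric)
  have close: "(\<lambda>x. F x - f k x) \<in> L2 \<and> l2_norm (\<lambda>x. F x - f k x) \<le> (1/2) ^ n" if k: "n \<le> k" for k n
  proof -
    have "(\<integral>\<^sup>+x. ennreal ((cmod (F x - f k x))\<^sup>2) \<partial>leb_pi)
        = (\<integral>\<^sup>+x. liminf (\<lambda>j. ennreal ((cmod (f j x - f k x))\<^sup>2)) \<partial>leb_pi)"
    proof (rule nn_integral_cong_AE, rule AE_mp[OF conv], intro AE_I2 impI)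
      fix x assume "convergent (\<lambda>k. f k x)"
      then have "(\<lambda>j. f j x) \<longlonglongrightarrow> F x" by (simp add: F_def convergent_LIMSEQ_iff)
      then have "(\<lambda>j. ennreal ((cmod (f j x - f k x))\<^sup>2)) \<longlonglongrightarrow> ennreal ((cmod (F x - f k x))\<^sup>2)"
        by (intro tendsto_ennrealI tendsto_intros)
      then show "ennreal ((cmod (F x - f k x))\<^sup>2) = liminf (\<lambda>j. ennreal ((cmod (f j x - f k x))\<^sup>2))"
        by (intro lim_imp_Liminf[symmetric]) auto
    qed
    also have "\<dots> \<le> liminf (\<lambda>j. \<integral>\<^sup>+x. ennreal ((cmod (f j x - f k x))\<^sup>2) \<partial>leb_pi)"
      using fm by (intro nn_integral_liminf) measurable
    also have "\<dots> \<le> ennreal (((1/2) ^ n)\<^sup>2)"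
    proof (rule Liminf_le)
      have "(\<integral>\<^sup>+x. ennreal ((cmod (f j x - f k x))\<^sup>2) \<partial>leb_pi) \<le> ennreal (((1/2) ^ n)\<^sup>2)" if j: "n \<le> j" for j
        unfolding nn_integral_cmod_square[OF L2_diff[OF f f]] nf
        using N[of n "r j" "r k"] rN[OF j] rN[OF k] by (intro ennreal_leI power_mono) auto
      then show "\<forall>\<^sub>F j in sequentially. (\<integral>\<^sup>+x. ennreal ((cmod (f j x - f k x))\<^sup>2) \<partial>leb_pi) \<le> ennreal (((1/2) ^ n)\<^sup>2)"
        by (rule eventually_sequentiallyI)
    qed simp
    finally show ?thesis using Fm fm by (intro conjI L2_I_nn) auto
  qed
  have FL: "F \<in> L2" using L2_add[OF close[of 0 0, THEN conjunct1] f[of 0]] by simp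
  have "(\<lambda>k. X (r k)) \<longlonglongrightarrow> of_fun F"
  proof (rule LIMSEQ_I)
    fix e :: real assume "0 < e"
    then obtain n where n: "(1/2) ^ n < e" using real_arch_pow_inv[of e "1/2"] by auto
    have "norm (X (r k) - of_fun F) < e" if k: "n \<le> k" for k
    proof -
      have "norm (of_fun F - of_fun (f k)) = l2_norm (\<lambda>x. F x - f k x)"
        using norm_of_fun[OF L2_diff[OF FL f[of k]]] of_fun_diff[OF FL f[of k]] by simp
      then show ?thesis using close[OF k] n by (simp add: f_def norm_minus_commute)
    qed
    then show "\<exists>no. \<forall>k\<ge>no. norm (X (r k) - of_fun F) < e" by blast
  qed
  then have "(X \<circ> r) \<longlonglongrightarrow> of_fun F" by (simp add: o_def)
  then show "convergent X" using Cauchy_converges_subseq[OF X r] by (auto simp: convergent_def)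
qed

instantiation l2 :: complex_hilbert
begin

definition cscale_l2 :: "complex \<Rightarrow> l2 \<Rightarrow> l2" where "cscale_l2 = l2_cscale"
definition cinner_l2 :: "l2 \<Rightarrow> l2 \<Rightarrow> complex" where "cinner_l2 = l2_cinner"

instance
  by standard (simp_all add: cscale_l2_def cinner_l2_def l2_cscale_props scaleR_l2_def inner_l2_def l2_cinner_props(1,2), rule l2_cinner_props)

end

section \<open>Riesz bases and Bari's theorem\<close>

subclass (in complex_hilbert) banach ..

lemma cscale_one [simp]: "1 *\<^sub>C x = x"
  using scaleR_cscale[of 1 x] by simp

lemma cscale_zero_left [simp]: "0 *\<^sub>C x = 0"
  using scaleR_cscale[of 0 x] by simp

lemma cscale_diff_right: "c *\<^sub>C (x - y) = c *\<^sub>C x - c *\<^sub>C y"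
  by (metis add_diff_cancel cscale_add_right diff_add_cancel)

lemma cinner_add_right: "cinner x (y + z) = cinner x y + cinner x z"
  using cinner_commute[of x "y + z"] cinner_commute[of x y] cinner_commute[of x z] by (simp add: cinner_add_left)

lemma cinner_cscale_right: "cinner x (c *\<^sub>C y) = cnj c * cinner x y"
  using cinner_commute[of x "c *\<^sub>C y"] cinner_commute[of x y] by (simp add: cinner_cscale_left)

lemma cinner_zero_right [simp]: "cinner x 0 = 0"
  using cinner_add_right[of x 0 0] by simp

lemma cinner_diff_left: "cinner (x - y) z = cinner x z - cinner y z"
  by (metis add_diff_cancel cinner_add_left diff_add_cancel)

lemma cinner_self: "cinner x x = of_real ((norm x)\<^sup>2)"
proof (rule complex_eqI)
  show "Re (cinner x x) = Re (of_real ((norm x)\<^sup>2))" by (simp add: inner_cinner[symmetric] power2_norm_eq_inner)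
  have "Im (cinner x x) = - Im (cinner x x)" by (metis cinner_commute cnj.simps(2))
  then show "Im (cinner x x) = Im (of_real ((norm x)\<^sup>2))" by simp
qed

lemma norm_cscale: "norm (c *\<^sub>C x) = cmod c * norm x"
proof (rule power2_eq_imp_eq)
  have "complex_of_real ((norm (c *\<^sub>C x))\<^sup>2) = c * cnj c * cinner x x"
    unfolding cinner_self[symmetric] by (simp add: cinner_cscale_left cinner_cscale_right)
  also have "\<dots> = of_real ((cmod c * norm x)\<^sup>2)"
    by (simp add: complex_norm_square[symmetric] cinner_self power_mult_distrib)
  finally show "(norm (c *\<^sub>C x))\<^sup>2 = (cmod c * norm x)\<^sup>2" by (simp only: of_real_eq_iff)
qed auto

text \<open>The real Cauchy-Schwarz inequality after turning x by the phase that makes the inner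
  product nonnegative.\<close>

lemma cinner_bound: "cmod (cinner x y) \<le> norm x * norm y"
proof (cases "cinner x y = 0")
  case False
  define c where "c = cnj (cinner x y) / of_real (cmod (cinner x y))"
  have c: "cmod c = 1" using False by (simp add: c_def norm_divide)
  have n: "cnj (cinner x y) * cinner x y = of_real (cmod (cinner x y)) * of_real (cmod (cinner x y))"
    using complex_norm_square[of "cinner x y"] by (simp add: power2_eq_square mult.commute)
  have "c * cinner x y = (cnj (cinner x y) * cinner x y) / of_real (cmod (cinner x y))" by (simp add: c_def)
  also have "\<dots> = of_real (cmod (cinner x y))" unfolding n using False by simp
  finally have "c * cinner x y = of_real (cmod (cinner x y))" .
  then have "cmod (cinner x y) = inner (c *\<^sub>C x) y" by (simp add: inner_cinner cinner_cscale_left)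
  also have "\<dots> \<le> norm (c *\<^sub>C x) * norm y" by (rule norm_cauchy_schwarz)
  finally show ?thesis by (simp add: norm_cscale c)
qed simp

lemma bounded_linear_cinner_left: "bounded_linear (\<lambda>x. cinner x (y :: 'a :: complex_hilbert))"
proof (rule bounded_linear_intro)
  show "cinner (x + z) y = cinner x y + cinner z y" for x z by (rule cinner_add_left)
  show "cinner (r *\<^sub>R x) y = r *\<^sub>R cinner x y" for r x by (simp add: scaleR_cscale cinner_cscale_left scaleR_conv_of_real)
  show "norm (cinner x y) \<le> norm x * norm y" for x by (rule cinner_bound)
qed

lemma cinner_sum_left: "cinner (\<Sum>i\<in>I. f i) (y :: 'a :: complex_hilbert) = (\<Sum>i\<in>I. cinner (f i) y)"
  by (rule linear_sum[OF bounded_linear.linear[OF bounded_linear_cinner_left]])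

definition orthonormal :: "(nat \<Rightarrow> 'a::complex_hilbert) \<Rightarrow> bool" where
  "orthonormal e \<longleftrightarrow> (\<forall>m n. cinner (e m) (e n) = (if m = n then 1 else 0))"

definition complete_system :: "(nat \<Rightarrow> 'a::complex_hilbert) \<Rightarrow> bool" where
  "complete_system f \<longleftrightarrow> (\<forall>x. (\<forall>n. cinner x (f n) = 0) \<longrightarrow> x = 0)"

lemma orthonormal_norm:
  assumes "orthonormal e" "finite I"
  shows "(norm (\<Sum>i\<in>I. c i *\<^sub>C e i))\<^sup>2 = (\<Sum>i\<in>I. (cmod (c i))\<^sup>2)"
proof -
  define v where "v = (\<Sum>i\<in>I. c i *\<^sub>C e i)"
  have coeff: "cinner v (e j) = c j" if "j \<in> I" for j
  proof -
    have "cinner v (e j) = (\<Sum>i\<in>I. if i = j then c i else 0)"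
      unfolding v_def cinner_sum_left using assms(1) by (intro sum.cong) (auto simp: cinner_cscale_left orthonormal_def)
    then show ?thesis using that assms(2) by simp
  qed
  have "complex_of_real ((norm v)\<^sup>2) = (\<Sum>i\<in>I. c i * cinner (e i) v)"
    unfolding cinner_self[symmetric] by (subst v_def) (simp add: cinner_sum_left cinner_cscale_left)
  also have "\<dots> = (\<Sum>i\<in>I. of_real ((cmod (c i))\<^sup>2))"
  proof (rule sum.cong)
    fix i assume "i \<in> I"
    then have "cinner (e i) v = cnj (c i)" using coeff cinner_commute[of "e i" v] by simp
    then show "c i * cinner (e i) v = of_real ((cmod (c i))\<^sup>2)" by (simp only: complex_norm_square)
  qed simp
  finally show ?thesis unfolding v_def by (simp only: of_real_sum[symmetric] of_real_eq_iff)
qed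

lemma bessel:
  assumes "orthonormal e"
  shows "(\<Sum>n<N. (cmod (cinner x (e n)))\<^sup>2) \<le> (norm x)\<^sup>2"
proof -
  define v where "v = (\<Sum>n<N. cinner x (e n) *\<^sub>C e n)"
  have nv: "(norm v)\<^sup>2 = (\<Sum>n<N. (cmod (cinner x (e n)))\<^sup>2)" unfolding v_def by (rule orthonormal_norm[OF assms]) simp
  have "cinner v x = (\<Sum>n<N. of_real ((cmod (cinner x (e n)))\<^sup>2))"
    unfolding v_def cinner_sum_left cinner_cscale_left complex_norm_square
    by (intro sum.cong) (use cinner_commute in \<open>auto\<close>)
  then have "inner v x = (norm v)\<^sup>2" by (simp add: inner_cinner nv flip: of_real_sum)
  then have "(norm v)\<^sup>2 \<le> norm v * norm x" using norm_cauchy_schwarz[of v x] by simp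
  then have "norm v \<le> norm x" by (cases "norm v = 0") (auto simp: power2_eq_square)
  then show ?thesis using nv by (metis norm_ge_zero power_mono)
qed

lemma bessel_summable:
  assumes "orthonormal e"
  shows "summable (\<lambda>n. (cmod (cinner x (e n)))\<^sup>2)"
  by (rule summableI_nonneg_bounded[OF _ bessel[OF assms]]) simp

lemma riesz_fischer:
  assumes e: "orthonormal e" and c: "summable (\<lambda>n. (cmod (c n))\<^sup>2)"
  shows "summable (\<lambda>n. c n *\<^sub>C e n)"
  unfolding summable_Cauchy
proof (intro allI impI)
  fix \<epsilon> :: real assume \<epsilon>: "0 < \<epsilon>"
  then have "0 < \<epsilon>\<^sup>2" by simp
  then obtain N where N: "\<And>m n. N \<le> m \<Longrightarrow> norm (\<Sum>i\<in>{m..<n}. (cmod (c i))\<^sup>2) < \<epsilon>\<^sup>2"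
    using c unfolding summable_Cauchy by blast
  have "norm (\<Sum>i\<in>{m..<n}. c i *\<^sub>C e i) < \<epsilon>" if "N \<le> m" for m n
  proof (rule power2_less_imp_less)
    show "(norm (\<Sum>i\<in>{m..<n}. c i *\<^sub>C e i))\<^sup>2 < \<epsilon>\<^sup>2"
      using N[OF that, of n] by (simp add: orthonormal_norm[OF e])
  qed (use \<epsilon> in simp)
  then show "\<exists>N. \<forall>m\<ge>N. \<forall>n. norm (\<Sum>i\<in>{m..<n}. c i *\<^sub>C e i) < \<epsilon>" by blast
qed

lemma orthonormal_coeff:
  assumes e: "orthonormal e" and s: "(\<lambda>n. c n *\<^sub>C e n) sums x"
  shows "cinner x (e n) = c n"
proof -
  have "(\<lambda>k. cinner (c k *\<^sub>C e k) (e n)) sums cinner x (e n)"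
    by (rule bounded_linear.sums[OF bounded_linear_cinner_left s])
  moreover have "cinner (c k *\<^sub>C e k) (e n) = (if k = n then c k else 0)" for k
    using e by (simp add: cinner_cscale_left orthonormal_def)
  ultimately have "(\<lambda>k. if k = n then c k else 0) sums cinner x (e n)" by simp
  then show ?thesis using sums_single[of n c] sums_unique2 by blast
qed

lemma orthonormal_expansion:
  assumes e: "orthonormal e" "complete_system e"
  shows "(\<lambda>n. cinner x (e n) *\<^sub>C e n) sums x"
proof -
  obtain y where y: "(\<lambda>n. cinner x (e n) *\<^sub>C e n) sums y"
    using riesz_fischer[OF e(1) bessel_summable[OF e(1)]] by (auto simp: summable_def)
  have "cinner (x - y) (e n) = 0" for n using orthonormal_coeff[OF e(1) y, of n] by (simp add: cinner_diff_left)
  then have "x - y = 0" using e(2) unfolding complete_system_def by blast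
  then show ?thesis using y by simp
qed

text \<open>The last clause is the boundedness of the inverse, stated as a lower bound so that no
  appeal to the open mapping theorem is made.\<close>

definition clinear_iso :: "('a::complex_hilbert \<Rightarrow> 'a) \<Rightarrow> bool" where
  "clinear_iso T \<longleftrightarrow> (\<forall>x y. T (x + y) = T x + T y) \<and> (\<forall>c x. T (c *\<^sub>C x) = c *\<^sub>C T x) \<and>
     (\<exists>K. \<forall>x. norm (T x) \<le> K * norm x) \<and> bij T \<and> (\<exists>K. \<forall>x. norm x \<le> K * norm (T x))"

lemma clinear_isoI:
  assumes "\<And>x y. T (x + y) = T x + T y" "\<And>c x. T (c *\<^sub>C x) = c *\<^sub>C T x"
    "\<And>x. norm (T x) \<le> K * norm x" "\<And>y. \<exists>x. T x = y" "\<And>x. norm x \<le> L * norm (T x)"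
  shows "clinear_iso T"
proof -
  have diff: "T (x - y) = T x - T y" for x y
    using assms(1)[of "x - y" y] by simp
  have "x = y" if "T x = T y" for x y
    using assms(5)[of "x - y"] that by (simp add: diff)
  then have "inj T" by (rule injI)
  moreover have "surj T" using assms(4) by (metis surjI)
  ultimately show ?thesis unfolding clinear_iso_def bij_def using assms by blast
qed

lemma clinear_isoD:
  assumes "clinear_iso T"
  shows "T (x + y) = T x + T y" "T (c *\<^sub>C x) = c *\<^sub>C T x" "bij T" "bounded_linear T" "T (x - y) = T x - T y"
proof -
  show a: "T (x + y) = T x + T y" and s: "T (c *\<^sub>C x) = c *\<^sub>C T x" and "bij T" for x y c
    using assms by (auto simp: clinear_iso_def)
  show "T (x - y) = T x - T y" using a[of "x - y" y] by simp
  obtain K where "\<And>x. norm (T x) \<le> K * norm x" using assms by (auto simp: clinear_iso_def)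
  then show "bounded_linear T"
    by (intro bounded_linear_intro[of T K]) (auto simp: a s scaleR_cscale mult.commute)
qed

lemma clinear_iso_comp:
  assumes S: "clinear_iso S" and T: "clinear_iso T"
  shows "clinear_iso (\<lambda>x. T (S x))"
proof -
  obtain K1 K2 where K: "\<And>x. norm (S x) \<le> K1 * norm x" "\<And>x. norm x \<le> K2 * norm (S x)"
    using S unfolding clinear_iso_def by blast
  obtain L1 L2 where L: "\<And>x. norm (T x) \<le> L1 * norm x" "\<And>x. norm x \<le> L2 * norm (T x)"
    using T unfolding clinear_iso_def by blast
  show ?thesis
  proof (rule clinear_isoI)
    show "T (S (x + y)) = T (S x) + T (S y)" for x y by (simp add: clinear_isoD(1)[OF S] clinear_isoD(1)[OF T])
    show "T (S (c *\<^sub>C x)) = c *\<^sub>C T (S x)" for c x by (simp add: clinear_isoD(2)[OF S] clinear_isoD(2)[OF T])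
    show "norm (T (S x)) \<le> (\<bar>L1\<bar> * \<bar>K1\<bar>) * norm x" for x
    proof -
      have "norm (T (S x)) \<le> \<bar>L1\<bar> * norm (S x)" by (rule order_trans[OF L(1)]) (simp add: mult_right_mono)
      also have "\<dots> \<le> \<bar>L1\<bar> * (\<bar>K1\<bar> * norm x)"
        by (intro mult_left_mono order_trans[OF K(1)]) (simp_all add: mult_right_mono)
      finally show ?thesis by (simp add: mult.assoc)
    qed
    show "norm x \<le> (\<bar>K2\<bar> * \<bar>L2\<bar>) * norm (T (S x))" for x
    proof -
      have "norm x \<le> \<bar>K2\<bar> * norm (S x)" by (rule order_trans[OF K(2)]) (simp add: mult_right_mono)
      also have "\<dots> \<le> \<bar>K2\<bar> * (\<bar>L2\<bar> * norm (T (S x)))"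
        by (intro mult_left_mono order_trans[OF L(2)]) (simp_all add: mult_right_mono)
      finally show ?thesis by (simp add: mult.assoc)
    qed
    show "\<exists>x. T (S x) = y" for y
      using clinear_isoD(3)[OF S] clinear_isoD(3)[OF T] by (metis bij_pointE)
  qed
qed

definition riesz_basis :: "(nat \<Rightarrow> 'a::complex_hilbert) \<Rightarrow> bool" where
  "riesz_basis f \<longleftrightarrow> (\<exists>e T. orthonormal e \<and> complete_system e \<and> clinear_iso T \<and> (\<forall>n. T (e n) = f n))"

text \<open>The operator is $x \mapsto x + \sum_n \langle x, e_n\rangle d_n$, a Neumann-type perturbation of the
  identity.\<close>

lemma small_perturbation:
  fixes e d :: "nat \<Rightarrow> 'a::complex_hilbert"
  assumes e: "orthonormal e" and d: "summable (\<lambda>n. (norm (d n))\<^sup>2)" and less: "(\<Sum>n. (norm (d n))\<^sup>2) < 1"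
  obtains T where "clinear_iso T" "\<And>n. T (e n) = e n + d n"
proof -
  define \<rho> where "\<rho> = sqrt (\<Sum>n. (norm (d n))\<^sup>2)"
  have \<rho>: "0 \<le> \<rho>" "\<rho> < 1" using less d by (auto simp: \<rho>_def suminf_nonneg real_sqrt_lt_1_iff)
  \<comment> \<open>Cauchy-Schwarz combined with Bessel's inequality: the perturbation has norm at
    most \<rho> < 1, which gives convergence of its series, the lower bound and, by a fixed point,
    surjectivity.\<close>
  have fin: "(\<Sum>n<N. norm (cinner x (e n) *\<^sub>C d n)) \<le> \<rho> * norm x" for x N
  proof -
    have "(\<Sum>n<N. norm (cinner x (e n) *\<^sub>C d n)) = (\<Sum>n<N. \<bar>cmod (cinner x (e n))\<bar> * \<bar>norm (d n)\<bar>)"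
      by (simp add: norm_cscale)
    also have "\<dots> \<le> L2_set (\<lambda>n. cmod (cinner x (e n))) {..<N} * L2_set (\<lambda>n. norm (d n)) {..<N}"
      by (rule L2_set_mult_ineq)
    also have "\<dots> \<le> norm x * \<rho>"
    proof (rule mult_mono)
      show "L2_set (\<lambda>n. cmod (cinner x (e n))) {..<N} \<le> norm x"
        unfolding L2_set_def using bessel[OF e, of x N] by (intro real_le_lsqrt) auto
      show "L2_set (\<lambda>n. norm (d n)) {..<N} \<le> \<rho>"
        unfolding L2_set_def \<rho>_def by (intro real_sqrt_le_mono sum_le_suminf d) auto
    qed (auto simp: L2_set_nonneg)
    finally show ?thesis by (simp add: mult.commute)
  qed
  define K where "K = (\<lambda>x. \<Sum>n. cinner x (e n) *\<^sub>C d n)"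
  have sn: "summable (\<lambda>n. norm (cinner x (e n) *\<^sub>C d n))" for x
    by (rule summableI_nonneg_bounded[OF _ fin]) simp
  have s: "(\<lambda>n. cinner x (e n) *\<^sub>C d n) sums K x" for x
    unfolding K_def by (rule summable_sums[OF summable_norm_cancel[OF sn]])
  have Kb: "norm (K x) \<le> \<rho> * norm x" for x
    unfolding K_def by (rule order_trans[OF summable_norm[OF sn] suminf_le_const[OF sn fin]])
  have Ka: "K (x + y) = K x + K y" for x y
    using sums_unique2[OF s[of "x + y"]] sums_add[OF s[of x] s[of y]]
    by (simp add: cinner_add_left cscale_add_left)
  have Kc: "K (c *\<^sub>C x) = c *\<^sub>C K x" for c x
  proof -
    have bl: "bounded_linear (\<lambda>z::'a. c *\<^sub>C z)"
      by (rule bounded_linear_intro[of _ "cmod c"])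
        (auto simp: cscale_add_right norm_cscale scaleR_cscale cscale_cscale mult.commute)
    have "(\<lambda>n. c *\<^sub>C cinner x (e n) *\<^sub>C d n) sums (c *\<^sub>C K x)" by (rule bounded_linear.sums[OF bl s])
    then show ?thesis using sums_unique2[OF s[of "c *\<^sub>C x"]] by (simp add: cinner_cscale_left cscale_cscale)
  qed
  have Kd: "K x - K y = K (x - y)" for x y using Ka[of "x - y" y] by simp
  show thesis
  proof (rule that[of "\<lambda>x. x + K x"])
    show "clinear_iso (\<lambda>x. x + K x)"
    proof (rule clinear_isoI)
      show "norm (x + K x) \<le> (1 + \<rho>) * norm x" for x
        using norm_triangle_ineq[of x "K x"] Kb[of x] by (simp add: algebra_simps)
      show "norm x \<le> (1 / (1 - \<rho>)) * norm (x + K x)" for x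
      proof -
        have "norm x \<le> norm (x + K x) + norm (K x)" using norm_triangle_ineq4[of "x + K x" "K x"] by simp
        then have "norm x * (1 - \<rho>) \<le> norm (x + K x)" using Kb[of x] by (simp add: algebra_simps)
        then show ?thesis using \<rho> by (simp add: pos_le_divide_eq)
      qed
      show "\<exists>x. x + K x = y" for y
      proof -
        have "\<exists>!x. y - K x = x"
        proof (rule banach_fix_type[OF \<rho>], intro allI)
          fix x z
          have "dist (y - K x) (y - K z) = norm (K (x - z))"
            by (simp add: dist_norm Kd[symmetric] norm_minus_commute)
          then show "dist (y - K x) (y - K z) \<le> \<rho> * dist x z" using Kb[of "x - z"] by (simp add: dist_norm)
        qed
        then obtain x where "y - K x = x" by blast
        then show ?thesis by (intro exI[of _ x]) (metis diff_add_cancel)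
      qed
    qed (auto simp: Ka Kc cscale_add_right algebra_simps)
    fix n
    have "(\<lambda>k. if k = n then d k else 0) sums K (e n)"
      using s[of "e n"] e by (simp add: orthonormal_def if_distrib[of "\<lambda>c. c *\<^sub>C _"] eq_commute[of n] cong: if_cong)
    then have "K (e n) = d n" using sums_single[of n d] sums_unique2 by blast
    then show "e n + K (e n) = e n + d n" by simp
  qed
qed

text \<open>The representing vector has coefficients conjugate to l(e n). Testing the functional on
  their own partial sums bounds the sum of squares, so the series converges by
  \<open>riesz_fischer\<close>.\<close>

lemma functional_representation:
  fixes e :: "nat \<Rightarrow> 'a::complex_hilbert" and l :: "'a \<Rightarrow> complex"
  assumes e: "orthonormal e" "complete_system e" and l: "bounded_linear l" "\<And>c x. l (c *\<^sub>C x) = c * l x"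
  obtains h where "\<And>x. l x = cinner x h"
proof -
  obtain K where K: "\<And>x. norm (l x) \<le> norm x * K" "0 \<le> K" using bounded_linear.nonneg_bounded[OF l(1)] by blast
  have "(\<Sum>n<N. (cmod (cnj (l (e n))))\<^sup>2) \<le> K\<^sup>2" for N
  proof -
    define v where "v = (\<Sum>n<N. cnj (l (e n)) *\<^sub>C e n)"
    define s where "s = (\<Sum>n<N. (cmod (cnj (l (e n))))\<^sup>2)"
    have nv: "(norm v)\<^sup>2 = s" unfolding v_def s_def by (rule orthonormal_norm[OF e(1)]) simp
    have "l v = (\<Sum>n<N. cnj (l (e n)) * l (e n))"
      unfolding v_def by (simp add: linear_sum[OF bounded_linear.linear[OF l(1)]] l(2))
    also have "\<dots> = of_real s"
      unfolding s_def of_real_sum complex_norm_square by simp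
    finally have lv: "l v = of_real s" .
    have "0 \<le> s" by (simp add: s_def sum_nonneg)
    then have "cmod (l v) = (norm v)\<^sup>2" unfolding nv lv norm_of_real by simp
    then have "norm v \<le> K" using K(1)[of v] K(2) by (cases "norm v = 0") (auto simp: power2_eq_square)
    then show ?thesis unfolding s_def[symmetric] nv[symmetric] by (intro power_mono) auto
  qed
  then have "summable (\<lambda>n. (cmod (cnj (l (e n))))\<^sup>2)" by (intro summableI_nonneg_bounded) auto
  then have "summable (\<lambda>n. cnj (l (e n)) *\<^sub>C e n)" by (rule riesz_fischer[OF e(1)])
  then obtain h where h: "(\<lambda>n. cnj (l (e n)) *\<^sub>C e n) sums h" by (auto simp: summable_def)
  have he: "cinner (e n) h = l (e n)" for n
    using orthonormal_coeff[OF e(1) h, of n] cinner_commute[of "e n" h] by simp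
  have "l x = cinner x h" for x
  proof -
    have "(\<lambda>n. l (cinner x (e n) *\<^sub>C e n)) sums l x"
      by (rule bounded_linear.sums[OF l(1) orthonormal_expansion[OF e]])
    moreover have "(\<lambda>n. cinner (cinner x (e n) *\<^sub>C e n) h) sums cinner x h"
      by (rule bounded_linear.sums[OF bounded_linear_cinner_left orthonormal_expansion[OF e]])
    ultimately show ?thesis by (simp add: l(2) cinner_cscale_left he sums_unique2)
  qed
  then show thesis using that by blast
qed

text \<open>The map S adds to x the vector u - e N multiplied by the N-th coordinate of x. It sends
  e N to u, fixes the other basis vectors and multiplies the N-th coordinate by a =
  \<open>cinner u (e N)\<close>; for nonzero a it is invertible by an explicit formula of the same
  kind.\<close>

lemma exchange_one:
  fixes e :: "nat \<Rightarrow> 'a::complex_hilbert"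
  assumes e: "orthonormal e" and T: "clinear_iso T" and u: "cinner u (e N) \<noteq> 0"
  obtains T' where "clinear_iso T'" "T' (e N) = T u" "\<And>n. n \<noteq> N \<Longrightarrow> T' (e n) = T (e n)"
proof -
  define w where "w = u - e N"
  define a where "a = cinner u (e N)"
  define S where "S = (\<lambda>x. x + cinner x (e N) *\<^sub>C w)"
  have eN: "cinner (e N) (e N) = 1" "norm (e N) = 1"
  proof -
    show "cinner (e N) (e N) = 1" using e by (simp add: orthonormal_def)
    then have "complex_of_real ((norm (e N))\<^sup>2) = of_real 1" unfolding cinner_self by simp
    then have "(norm (e N))\<^sup>2 = 1" by (simp only: of_real_eq_iff)
    then show "norm (e N) = 1" by (simp add: power2_eq_1_iff) (metis norm_ge_zero not_numeral_le_zero le_minus_one_simps(3))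
  qed
  have wN: "cinner w (e N) = a - 1" by (simp add: w_def a_def cinner_diff_left eN)
  have SN: "cinner (S x) (e N) = a * cinner x (e N)" for x
    by (simp add: S_def cinner_add_left cinner_cscale_left wN algebra_simps)
  have a: "a \<noteq> 0" using u by (simp add: a_def)
  have inv: "S y - (cinner (S y) (e N) / a) *\<^sub>C w = y" for y
    unfolding SN using a by (simp add: S_def)
  have nb: "norm (x + c *\<^sub>C w) \<le> norm x + cmod c * norm w" for x c
    using norm_triangle_ineq[of x "c *\<^sub>C w"] by (simp add: norm_cscale)
  have cb: "cmod (cinner x (e N)) \<le> norm x" for x using cinner_bound[of x "e N"] eN by simp
  have "clinear_iso S"
  proof (rule clinear_isoI)
    show "norm (S x) \<le> (1 + norm w) * norm x" for x
    proof -
      have "norm (S x) \<le> norm x + cmod (cinner x (e N)) * norm w" unfolding S_def by (rule nb)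
      also have "\<dots> \<le> norm x + norm x * norm w" by (intro add_left_mono mult_right_mono cb) auto
      finally show ?thesis by (simp add: algebra_simps)
    qed
    show "norm x \<le> (1 + norm w / cmod a) * norm (S x)" for x
    proof -
      have "norm x = norm (S x - (cinner (S x) (e N) / a) *\<^sub>C w)" by (simp only: inv)
      also have "\<dots> \<le> norm (S x) + norm ((cinner (S x) (e N) / a) *\<^sub>C w)" by (rule norm_triangle_ineq4)
      also have "\<dots> = norm (S x) + cmod (cinner (S x) (e N)) * (norm w / cmod a)"
        by (simp add: norm_cscale norm_divide)
      also have "\<dots> \<le> norm (S x) + norm (S x) * (norm w / cmod a)"
        by (intro add_left_mono mult_right_mono cb) auto
      finally show ?thesis by (simp add: algebra_simps)
    qed
    show "\<exists>x. S x = y" for y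
    proof -
      define x where "x = y - (cinner y (e N) / a) *\<^sub>C w"
      have "cinner x (e N) = cinner y (e N) / a"
        using a by (simp add: x_def cinner_diff_left cinner_cscale_left wN field_simps)
      then have "S x = y" by (simp add: S_def x_def)
      then show ?thesis by blast
    qed
  qed (auto simp: S_def cinner_add_left cinner_cscale_left cscale_add_left cscale_add_right cscale_cscale)
  then have "clinear_iso (\<lambda>x. T (S x))" using T by (rule clinear_iso_comp)
  moreover have "S (e N) = u" by (simp add: S_def eN w_def)
  moreover have "S (e n) = e n" if "n \<noteq> N" for n using e that by (simp add: S_def orthonormal_def)
  ultimately show thesis using that[of "\<lambda>x. T (S x)"] by simp
qed

text \<open>Induction on the number of elements that do not come from $T$. Completeness excludes that the functional
  picking the $N$-th coordinate of $T^{-1}$ vanishes on $f_0,\dots,f_N$, so some $f_j$ can take the place of $T e_N$.\<close>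

lemma exchange:
  fixes e f :: "nat \<Rightarrow> 'a::complex_hilbert"
  assumes e: "orthonormal e" "complete_system e"
  shows "\<lbrakk>clinear_iso T; complete_system (\<lambda>n. if n < N then f n else T (e n))\<rbrakk>
    \<Longrightarrow> riesz_basis (\<lambda>n. if n < N then f n else T (e n))"
proof (induction N arbitrary: f T)
  case 0
  then show ?case using e by (auto simp: riesz_basis_def)
next
  case (Suc N)
  note T = Suc.prems(1)
  define g where "g = (\<lambda>n. if n < Suc N then f n else T (e n))"
  have bT: "bij T" using T by (rule clinear_isoD)
  define l where "l = (\<lambda>y. cinner (inv T y) (e N))"
  have invT: "inv T (T x) = x" "T (inv T x) = x" for x
    using bT by (auto simp: bij_is_inj bij_is_surj surj_f_inv_f)
  have inv_add: "inv T (x + y) = inv T x + inv T y" for x y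
    by (metis clinear_isoD(1)[OF T] invT)
  have inv_c: "inv T (c *\<^sub>C x) = c *\<^sub>C inv T x" for c x
    by (metis clinear_isoD(2)[OF T] invT)
  obtain K where K: "\<And>x. norm x \<le> K * norm (T x)" using T unfolding clinear_iso_def by blast
  have "bounded_linear l"
  proof (rule bounded_linear_intro)
    show "norm (l x) \<le> norm x * (K * norm (e N))" for x
    proof -
      have "norm (l x) \<le> norm (inv T x) * norm (e N)" unfolding l_def by (rule cinner_bound)
      also have "\<dots> \<le> (K * norm x) * norm (e N)" using K[of "inv T x"] by (intro mult_right_mono) (auto simp: invT)
      finally show ?thesis by (simp add: mult_ac)
    qed
  qed (auto simp: l_def inv_add inv_c cinner_add_left cinner_cscale_left scaleR_cscale scaleR_conv_of_real)
  then obtain h where h: "\<And>x. l x = cinner x h"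
    using functional_representation[OF e] by (metis l_def inv_c cinner_cscale_left)
  have hT: "cinner (T (e n)) h = (if n = N then 1 else 0)" for n
    unfolding h[symmetric] l_def invT using e(1) by (simp add: orthonormal_def)
  have "h \<noteq> 0"
  proof
    assume "h = 0"
    then show False using hT[of N] by simp
  qed
  then obtain j where j: "cinner h (g j) \<noteq> 0" using Suc.prems(2) unfolding complete_system_def g_def by blast
  then have j': "cinner (g j) h \<noteq> 0" using cinner_commute[of h "g j"] by auto
  have jN: "j < Suc N"
  proof (rule ccontr)
    assume "\<not> j < Suc N"
    then show False using j' hT[of j] by (simp add: g_def)
  qed
  then have "cinner (inv T (f j)) (e N) \<noteq> 0" using j' unfolding h[symmetric] l_def by (simp add: g_def)
  then obtain T' where T': "clinear_iso T'" "T' (e N) = f j" "\<And>n. n \<noteq> N \<Longrightarrow> T' (e n) = T (e n)"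
    using exchange_one[OF e(1) T] by (metis invT(2))
  \<comment> \<open>The transposition of j and N puts f j at position N, where T' produces it, and f
    N at position j. Only positions below N then differ from T', which is the shape of the induction
    hypothesis.\<close>
  define \<pi> where "\<pi> = (\<lambda>n. if n = j then N else if n = N then j else n)"
  have \<pi>: "\<pi> (\<pi> n) = n" for n by (simp add: \<pi>_def)
  have g\<pi>: "(\<lambda>n. if n < N then (f(j := f N)) n else T' (e n)) = (\<lambda>n. g (\<pi> n))"
  proof
    fix n
    show "(if n < N then (f(j := f N)) n else T' (e n)) = g (\<pi> n)"
      using jN T' by (cases "n = N"; cases "n = j") (auto simp: g_def \<pi>_def less_Suc_eq)
  qed
  have "complete_system (\<lambda>n. g (\<pi> n))"
    using Suc.prems(2) \<pi> unfolding complete_system_def g_def[symmetric] by metis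
  then have "riesz_basis (\<lambda>n. g (\<pi> n))"
    using Suc.IH[OF T'(1), of "f(j := f N)"] unfolding g\<pi> by blast
  then obtain e' S where S: "orthonormal e'" "complete_system e'" "clinear_iso S" "\<And>n. S (e' n) = g (\<pi> n)"
    unfolding riesz_basis_def by blast
  have "orthonormal (\<lambda>n. e' (\<pi> n))"
    using S(1) \<pi> unfolding orthonormal_def by metis
  moreover have "complete_system (\<lambda>n. e' (\<pi> n))"
    using S(2) \<pi> unfolding complete_system_def by metis
  moreover have "S (e' (\<pi> n)) = g n" for n by (simp add: S(4) \<pi>)
  ultimately have "riesz_basis g" using S(3) unfolding riesz_basis_def by blast
  then show ?case by (simp add: g_def)
qed

text \<open>Setting the first N differences to zero makes the remaining ones quadratically small, so
  \<open>small_perturbation\<close> yields an isomorphism that already produces f n for n >= N. The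
  finitely many other vectors are brought in by \<open>exchange\<close>, which uses completeness of
  f.\<close>

theorem bari:
  fixes e f :: "nat \<Rightarrow> 'a::complex_hilbert"
  assumes e: "orthonormal e" "complete_system e" and close: "summable (\<lambda>n. (norm (f n - e n))\<^sup>2)" and tot: "complete_system f"
  shows "riesz_basis f"
proof -
  obtain N where N: "norm (\<Sum>i. (norm (f (i + N) - e (i + N)))\<^sup>2) < 1"
    using suminf_exist_split[OF zero_less_one close] by blast
  define d where "d = (\<lambda>n. if n < N then 0 else f n - e n)"
  have d: "(norm (d n))\<^sup>2 = (if n < N then 0 else (norm (f n - e n))\<^sup>2)" for n by (simp add: d_def)
  have sd: "summable (\<lambda>n. (norm (d n))\<^sup>2)"
    by (rule summable_comparison_test'[OF close, of 0]) (simp add: d)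
  have "(\<Sum>n. (norm (d n))\<^sup>2) = (\<Sum>i. (norm (d (i + N)))\<^sup>2) + (\<Sum>i<N. (norm (d i))\<^sup>2)"
    by (rule suminf_split_initial_segment[OF sd])
  also have "\<dots> = (\<Sum>i. (norm (f (i + N) - e (i + N)))\<^sup>2)" by (simp add: d)
  finally have "(\<Sum>n. (norm (d n))\<^sup>2) < 1" using N by simp
  then obtain T where T: "clinear_iso T" "\<And>n. T (e n) = e n + d n"
    using small_perturbation[OF e(1) sd] by blast
  have "(\<lambda>n. if n < N then f n else T (e n)) = f" by (auto simp: T d_def)
  then show ?thesis using exchange[OF e T(1), of N f] tot by simp
qed

section \<open>Transfer to square-integrable functions\<close>

lemma l2_sums_iff:
  assumes f: "\<And>n. f n \<in> L2" and g: "g \<in> L2"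
  shows "l2_sums f c g \<longleftrightarrow> (\<lambda>n. c n *\<^sub>C of_fun (f n)) sums of_fun g"
proof -
  have s: "(\<lambda>x. \<Sum>n<N. c n * f n x) \<in> L2" for N by (intro L2_sum L2_cmult f)
  have eq: "l2_norm (\<lambda>x. g x - (\<Sum>n<N. c n * f n x)) = norm ((\<Sum>n<N. c n *\<^sub>C of_fun (f n)) - of_fun g)" for N
  proof -
    have "l2_norm (\<lambda>x. g x - (\<Sum>n<N. c n * f n x)) = norm (of_fun g - of_fun (\<lambda>x. \<Sum>n<N. c n * f n x))"
      using norm_of_fun[OF L2_diff[OF g s]] of_fun_diff[OF g s] by simp
    also have "of_fun (\<lambda>x. \<Sum>n<N. c n * f n x) = (\<Sum>n<N. c n *\<^sub>C of_fun (f n))"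
      by (simp add: of_fun_sum L2_cmult f of_fun_cscale cscale_l2_def)
    finally show ?thesis by (simp add: norm_minus_commute)
  qed
  show ?thesis
    unfolding l2_sums_def sums_def eq tendsto_norm_zero_iff LIM_zero_iff by (rule refl)
qed

lemma l2_orthonormal_basis_to_fun:
  assumes e: "orthonormal e" "complete_system e"
  shows "l2_orthonormal_basis (\<lambda>n. to_fun (e n))"
  unfolding l2_orthonormal_basis_def l2_basis_def
proof (intro conjI allI ballI)
  fix g assume g: "g \<in> L2"
  have iff: "l2_sums (\<lambda>n. to_fun (e n)) c g \<longleftrightarrow> (\<lambda>n. c n *\<^sub>C e n) sums of_fun g" for c
    using l2_sums_iff[of "\<lambda>n. to_fun (e n)" g c] g by simp
  show "\<exists>!c. l2_sums (\<lambda>n. to_fun (e n)) c g"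
    unfolding iff
  proof (rule ex1I)
    show "(\<lambda>n. cinner (of_fun g) (e n) *\<^sub>C e n) sums of_fun g" by (rule orthonormal_expansion[OF e])
    fix c assume "(\<lambda>n. c n *\<^sub>C e n) sums of_fun g"
    then show "c = (\<lambda>n. cinner (of_fun g) (e n))" using orthonormal_coeff[OF e(1)] by auto
  qed
next
  fix m n
  have "l2_inner (to_fun (e m)) (to_fun (e n)) = cinner (e m) (e n)"
    using of_fun_cinner[of "to_fun (e m)" "to_fun (e n)"] by (simp add: cinner_l2_def)
  then show "l2_inner (to_fun (e m)) (to_fun (e n)) = (if m = n then 1 else 0)"
    using e(1) by (simp add: orthonormal_def)
qed simp

definition lift_operator :: "(l2 \<Rightarrow> l2) \<Rightarrow> (real \<Rightarrow> complex) \<Rightarrow> (real \<Rightarrow> complex)" where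
  "lift_operator T f = to_fun (T (of_fun f))"

lemma l2_bounded_operator_lift:
  assumes "\<And>x y. T (x + y) = T x + T y" "\<And>c x. T (c *\<^sub>C x) = c *\<^sub>C T x" "\<And>x. norm (T x) \<le> K * norm x"
  shows "l2_bounded_operator (lift_operator T)"
proof -
  have of_fun_lift: "of_fun (lift_operator T f) = T (of_fun f)" for f by (simp add: lift_operator_def)
  have L: "lift_operator T f \<in> L2" for f by (simp add: lift_operator_def)
  show ?thesis
    unfolding l2_bounded_operator_def
  proof (intro conjI ballI allI exI[of _ K])
    fix f assume f: "f \<in> L2"
    show "lift_operator T f \<in> L2" by (rule L)
    show "l2_norm (lift_operator T f) \<le> K * l2_norm f"
      using assms(3)[of "of_fun f"] norm_of_fun[OF L, of f] norm_of_fun[OF f] by (simp add: of_fun_lift)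
    show "ae_eq (lift_operator T (\<lambda>x. c * f x)) (\<lambda>x. c * lift_operator T f x)" for c
      by (subst of_fun_eq_iff[symmetric])
        (simp_all add: L L2_cmult of_fun_lift of_fun_cscale f assms flip: cscale_l2_def)
    show "ae_eq (lift_operator T (\<lambda>x. f x + g x)) (\<lambda>x. lift_operator T f x + lift_operator T g x)" if g: "g \<in> L2" for g
      by (subst of_fun_eq_iff[symmetric]) (simp_all add: L L2_add of_fun_lift of_fun_add f g assms)
  qed
qed

theorem l2_riesz_basisI:
  assumes f: "\<And>n. f n \<in> L2" and r: "riesz_basis (\<lambda>n. of_fun (f n))"
  shows "l2_riesz_basis f"
proof -
  obtain e T where e: "orthonormal e" "complete_system e" and T: "clinear_iso T" and Te: "\<And>n. T (e n) = of_fun (f n)"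
    using r unfolding riesz_basis_def by blast
  obtain K L where K: "\<And>x. norm (T x) \<le> K * norm x" and L: "\<And>x. norm x \<le> L * norm (T x)"
    using T unfolding clinear_iso_def by blast
  have bT: "bij T" using T by (rule clinear_isoD)
  have invT: "inv T (T x) = x" "T (inv T x) = x" for x
    using bT by (auto simp: bij_is_inj bij_is_surj surj_f_inv_f)
  have A: "l2_bounded_operator (lift_operator T)"
    by (rule l2_bounded_operator_lift[OF clinear_isoD(1,2)[OF T] K])
  have B: "l2_bounded_operator (lift_operator (inv T))"
  proof (rule l2_bounded_operator_lift)
    show "inv T (x + y) = inv T x + inv T y" for x y by (metis clinear_isoD(1)[OF T] invT)
    show "inv T (c *\<^sub>C x) = c *\<^sub>C inv T x" for c x by (metis clinear_isoD(2)[OF T] invT)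
    show "norm (inv T x) \<le> L * norm x" for x using L[of "inv T x"] by (simp add: invT)
  qed
  have inverse: "ae_eq (lift_operator (inv T) (lift_operator T g)) g \<and> ae_eq (lift_operator T (lift_operator (inv T) g)) g"
    if "g \<in> L2" for g
    using to_fun_of_fun[OF that] by (simp add: lift_operator_def invT)
  show ?thesis
    unfolding l2_riesz_basis_def l2_invertible_operator_def
  proof (rule exI[of _ "\<lambda>n. to_fun (e n)"], rule exI[of _ "lift_operator T"], intro conjI allI)
    show "l2_orthonormal_basis (\<lambda>n. to_fun (e n))" by (rule l2_orthonormal_basis_to_fun[OF e])
    show "l2_bounded_operator (lift_operator T)" by (rule A)
    show "\<exists>B. l2_bounded_operator B \<and> (\<forall>f\<in>L2. ae_eq (B (lift_operator T f)) f \<and> ae_eq (lift_operator T (B f)) f)"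
      using B inverse by blast
    fix n
    show "f n \<in> L2" by (rule f)
    show "ae_eq (f n) (lift_operator T (to_fun (e n)))"
      by (subst of_fun_eq_iff[symmetric]) (simp_all add: f lift_operator_def Te)
  qed
qed

text \<open>If f 0 had an expansion in the later elements, the lower bound for T would carry it back
  to an expansion of e 0 in e 1, e 2, ...; the inner product with e 0 would give 0 = 1.\<close>

lemma riesz_basis_remove_not_basis:
  assumes f: "\<And>n. f n \<in> L2" and r: "riesz_basis (\<lambda>n. of_fun (f n))"
  shows "\<not> l2_basis (\<lambda>n. f (Suc n))"
proof
  assume "l2_basis (\<lambda>n. f (Suc n))"
  then obtain c where "l2_sums (\<lambda>n. f (Suc n)) c (f 0)" using f unfolding l2_basis_def by blast
  then have s: "(\<lambda>n. c n *\<^sub>C of_fun (f (Suc n))) sums of_fun (f 0)"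
    using l2_sums_iff[of "\<lambda>n. f (Suc n)" "f 0" c] f by simp
  obtain e T where e: "orthonormal e" and T: "clinear_iso T" and Te: "\<And>n. T (e n) = of_fun (f n)"
    using r unfolding riesz_basis_def by blast
  obtain L where L: "\<And>x. norm x \<le> L * norm (T x)" using T unfolding clinear_iso_def by blast
  have lin: "T (\<Sum>n<N. c n *\<^sub>C e (Suc n)) = (\<Sum>n<N. c n *\<^sub>C of_fun (f (Suc n)))" for N
    by (simp add: linear_sum[OF bounded_linear.linear[OF clinear_isoD(4)[OF T]]] clinear_isoD(2)[OF T] Te)
  have "(\<lambda>n. c n *\<^sub>C e (Suc n)) sums e 0"
    unfolding sums_def
  proof (rule LIM_zero_cancel, rule Lim_null_comparison)
    show "\<forall>\<^sub>F N in sequentially. norm ((\<Sum>n<N. c n *\<^sub>C e (Suc n)) - e 0) \<le> L * norm ((\<Sum>n<N. c n *\<^sub>C of_fun (f (Suc n))) - of_fun (f 0))"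
      using L[of "(\<Sum>n<N. c n *\<^sub>C e (Suc n)) - e 0" for N] by (simp add: clinear_isoD(5)[OF T] lin Te)
    have "(\<lambda>N. (\<Sum>n<N. c n *\<^sub>C of_fun (f (Suc n))) - of_fun (f 0)) \<longlonglongrightarrow> 0"
      using s unfolding sums_def by (rule LIM_zero)
    then show "(\<lambda>N. L * norm ((\<Sum>n<N. c n *\<^sub>C of_fun (f (Suc n))) - of_fun (f 0))) \<longlonglongrightarrow> 0"
      by (intro tendsto_mult_right_zero tendsto_norm_zero)
  qed
  then have "(\<lambda>n. cinner (c n *\<^sub>C e (Suc n)) (e 0)) sums cinner (e 0) (e 0)"
    by (rule bounded_linear.sums[OF bounded_linear_cinner_left])
  then have "(\<lambda>n. 0) sums (1::complex)" using e by (simp add: cinner_cscale_left orthonormal_def)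
  then show False using sums_unique2[OF sums_zero] by force
qed

lemma riesz_basis_cscale:
  assumes c: "c \<noteq> 0" and r: "riesz_basis (\<lambda>n. c *\<^sub>C f n)"
  shows "riesz_basis f"
proof -
  obtain e T where e: "orthonormal e" "complete_system e" and T: "clinear_iso T" and Te: "\<And>n. T (e n) = c *\<^sub>C f n"
    using r unfolding riesz_basis_def by blast
  have "clinear_iso (\<lambda>x::'a. inverse c *\<^sub>C x)"
  proof (rule clinear_isoI)
    show "norm (inverse c *\<^sub>C x) \<le> cmod (inverse c) * norm x" for x :: 'a by (simp add: norm_cscale)
    show "norm x \<le> cmod c * norm (inverse c *\<^sub>C x)" for x :: 'a using c by (simp add: norm_cscale norm_inverse flip: mult.assoc)
    show "\<exists>x. inverse c *\<^sub>C x = y" for y :: 'a using c by (intro exI[of _ "c *\<^sub>C y"]) (simp add: cscale_cscale)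
  qed (simp_all add: cscale_add_right cscale_cscale mult.commute)
  then have "clinear_iso (\<lambda>x. inverse c *\<^sub>C T x)" by (rule clinear_iso_comp[OF T])
  then show ?thesis
    using e c Te unfolding riesz_basis_def
    by (intro exI[of _ e] exI[of _ "\<lambda>x. inverse c *\<^sub>C T x"]) (simp add: cscale_cscale)
qed

section \<open>Cosine systems\<close>

lemma integral_cos:
  fixes k :: real
  assumes "sin (k * pi) = 0"
  shows "integral {0..pi} (\<lambda>x. cos (k * x)) = (if k = 0 then pi else 0)"
proof (cases "k = 0")
  case False
  have "((\<lambda>x. cos (k * x)) has_integral sin (k * pi) / k - sin (k * 0) / k) {0..pi}"
    using False by (intro fundamental_theorem_of_calculus)
      (auto intro!: derivative_eq_intros simp flip: has_real_derivative_iff_has_vector_derivative)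
  then show ?thesis using assms False by (simp add: integral_unique)
qed simp

definition cosine :: "real \<Rightarrow> nat \<Rightarrow> real \<Rightarrow> complex" where
  "cosine \<sigma> n x = of_real (cos ((real n + \<sigma>) * x))"

text \<open>Normalizing factors: the squared norm is \<pi> at frequency 0 and \<pi>/2 at the other
  frequencies considered.\<close>

definition cosine_scale :: "real \<Rightarrow> nat \<Rightarrow> real" where
  "cosine_scale \<sigma> n = (if real n + \<sigma> = 0 then 1 / sqrt pi else sqrt (2 / pi))"

lemma cosine_L2: "cosine \<sigma> n \<in> L2"
  unfolding cosine_def by (intro L2_continuous continuous_intros)

text \<open>By the product formula the integral involves only the frequencies a - b and a + b, which
  are integers for both values of the shift, so their cosines integrate to 0 unless the frequency is
  0.\<close>

lemma l2_inner_cosine: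
  assumes \<sigma>: "\<sigma> = 0 \<or> \<sigma> = 1/2"
  shows "l2_inner (cosine \<sigma> m) (cosine \<sigma> n) = of_real (if m = n then (if real n + \<sigma> = 0 then pi else pi / 2) else 0)"
proof -
  define a b where "a = real m + \<sigma>" and "b = real n + \<sigma>"
  obtain j :: int where j: "a - b = of_int j" using that[of "int m - int n"] by (simp add: a_def b_def)
  obtain k :: int where k: "a + b = of_int k"
    using \<sigma> that[of "int m + int n + (if \<sigma> = 0 then 0 else 1)"] by (auto simp: a_def b_def)
  have s: "sin ((a - b) * pi) = 0" "sin ((a + b) * pi) = 0" unfolding j k by (simp_all add: sin_zero_iff_int2)
  have ci: "(\<lambda>x. cos (c * x)) integrable_on {0..pi}" for c :: real
    by (intro integrable_continuous_interval continuous_intros)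
  have "l2_inner (cosine \<sigma> m) (cosine \<sigma> n) = of_real (LINT x|leb_pi. cos (a * x) * cos (b * x))"
    by (simp add: l2_inner_def cosine_def a_def b_def flip: of_real_mult)
  also have "(LINT x|leb_pi. cos (a * x) * cos (b * x)) = integral {0..pi} (\<lambda>x. cos (a * x) * cos (b * x))"
    by (intro lebesgue_integral_eq_integral, unfold integrable_leb_pi_iff)
      (auto intro!: absolutely_integrable_continuous_real continuous_intros)
  also have "\<dots> = integral {0..pi} (\<lambda>x. (cos ((a - b) * x) + cos ((a + b) * x)) / 2)"
    by (simp add: cos_times_cos algebra_simps)
  also have "\<dots> = (integral {0..pi} (\<lambda>x. cos ((a - b) * x)) + integral {0..pi} (\<lambda>x. cos ((a + b) * x))) / 2"
    by (simp add: Henstock_Kurzweil_Integration.integral_add[OF ci ci])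
  also have "\<dots> = ((if a - b = 0 then pi else 0) + (if a + b = 0 then pi else 0)) / 2"
    unfolding integral_cos[OF s(1)] integral_cos[OF s(2)] ..
  also have "\<dots> = (if m = n then (if real n + \<sigma> = 0 then pi else pi / 2) else 0)"
    using \<sigma> by (auto simp: a_def b_def add_nonneg_eq_0_iff)
  finally show ?thesis .
qed

definition cosine_basis :: "real \<Rightarrow> nat \<Rightarrow> l2" where
  "cosine_basis \<sigma> n = of_real (cosine_scale \<sigma> n) *\<^sub>C of_fun (cosine \<sigma> n)"

lemma orthonormal_cosine_basis:
  assumes \<sigma>: "\<sigma> = 0 \<or> \<sigma> = 1/2"
  shows "orthonormal (cosine_basis \<sigma>)"
  unfolding orthonormal_def
proof (intro allI)
  fix m n
  have "cinner (of_fun (cosine \<sigma> m)) (of_fun (cosine \<sigma> n)) = l2_inner (cosine \<sigma> m) (cosine \<sigma> n)"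
    using of_fun_cinner[OF cosine_L2 cosine_L2] by (simp add: cinner_l2_def)
  then have eq: "cinner (cosine_basis \<sigma> m) (cosine_basis \<sigma> n) =
      of_real (cosine_scale \<sigma> m * cosine_scale \<sigma> n) * l2_inner (cosine \<sigma> m) (cosine \<sigma> n)"
    by (simp add: cosine_basis_def cinner_cscale_left cinner_cscale_right)
  have "cosine_scale \<sigma> n * cosine_scale \<sigma> n * (if real n + \<sigma> = 0 then pi else pi / 2) = 1"
  proof (cases "real n + \<sigma> = 0")
    case True
    have "1 / sqrt pi * (1 / sqrt pi) * pi = 1" by (simp add: real_sqrt_mult_self)
    then show ?thesis using True by (simp add: cosine_scale_def)
  next
    case False
    have "sqrt (2 / pi) * sqrt (2 / pi) = 2 / pi" by (rule real_sqrt_mult_self[THEN trans]) simp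
    then have "sqrt (2 / pi) * sqrt (2 / pi) * (pi / 2) = 1" by simp
    then show ?thesis using False by (simp only: cosine_scale_def if_False)
  qed
  then show "cinner (cosine_basis \<sigma> m) (cosine_basis \<sigma> n) = (if m = n then 1 else 0)"
    unfolding eq l2_inner_cosine[OF \<sigma>] of_real_mult[symmetric] by (cases "m = n") (simp_all only: if_True if_False of_real_1 mult_zero_right of_real_0 refl)
qed

lemma AE_leb_pi_iff: "(AE x in leb_pi. P x) \<longleftrightarrow> (\<exists>N. negligible N \<and> (\<forall>x\<in>{0..pi} - N. P x))"
proof -
  have "(AE x in leb_pi. P x) \<longleftrightarrow> (AE x in lebesgue. x \<in> {0..pi} \<longrightarrow> P x)"
    by (rule AE_restrict_space_iff) simp
  also have "\<dots> \<longleftrightarrow> (\<exists>N. negligible N \<and> (\<forall>x\<in>{0..pi} - N. P x))"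
    unfolding eventually_ae_filter_negligible
  proof (intro iffI; elim exE conjE)
    fix N assume "negligible N" "{x. \<not> (x \<in> {0..pi} \<longrightarrow> P x)} \<subseteq> N"
    then show "\<exists>N. negligible N \<and> (\<forall>x\<in>{0..pi} - N. P x)" by (intro exI[of _ N]) auto
  next
    fix N assume "negligible N" "\<forall>x\<in>{0..pi} - N. P x"
    then show "\<exists>N. negligible N \<and> {x. \<not> (x \<in> {0..pi} \<longrightarrow> P x)} \<subseteq> N" by (intro exI[of _ N]) auto
  qed
  finally show ?thesis .
qed

section \<open>A function is determined by its cosine moments\<close>

text \<open>The factor cos(n x) is kept for arbitrary n so that the induction closes: a further
  factor cos x is absorbed by splitting it into the frequencies n - 1 and n + 1. The case n = 0
  gives all polynomials in cos x.\<close>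

lemma cosine_moments_zero_imp_power_moments:
  fixes u :: "real \<Rightarrow> real"
  assumes u: "u absolutely_integrable_on {0..pi}"
    and z: "\<And>n::nat. integral {0..pi} (\<lambda>x. u x * cos (real n * x)) = 0"
  shows "integral {0..pi} (\<lambda>x. u x * (cos (real n * x) * cos x ^ i)) = 0"
proof (induction i arbitrary: n)
  case 0 then show ?case using z by simp
next
  case (Suc i)
  have ii: "(\<lambda>x. u x * (cos (real n * x) * cos x ^ i)) integrable_on {0..pi}" for n
  proof -
    have "continuous_on {0..pi} (\<lambda>x. cos (real n * x) * cos x ^ i)" by (intro continuous_intros)
    then have "(\<lambda>x. (cos (real n * x) * cos x ^ i) * u x) absolutely_integrable_on {0..pi}"
      by (intro absolutely_integrable_bounded_measurable_product[OF bilinear_times _ _ _ u]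
          continuous_imp_measurable_on_sets_lebesgue compact_imp_bounded compact_continuous_image) auto
    then show ?thesis by (simp add: set_lebesgue_integral_eq_integral(1) mult.commute)
  qed
  show ?case
  proof (cases n)
    case 0
    then show ?thesis using Suc.IH[of 1] by (simp add: mult.assoc)
  next
    case (Suc k)
    have e: "u x * (cos (real n * x) * cos x ^ Suc i) =
        (u x * (cos (real (Suc n) * x) * cos x ^ i) + u x * (cos (real k * x) * cos x ^ i)) * (1/2)" for x
    proof -
      have "cos (real n * x) * cos x = (cos (real n * x - x) + cos (real n * x + x)) / 2" by (rule cos_times_cos)
      moreover have "real n * x - x = real k * x" "real n * x + x = real (Suc n) * x"
        using Suc by (simp_all add: algebra_simps)
      ultimately have c: "cos (real n * x) * cos x = (cos (real k * x) + cos (real (Suc n) * x)) / 2" by simp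
      have "u x * (cos (real n * x) * cos x ^ Suc i) = u x * ((cos (real n * x) * cos x) * cos x ^ i)" by simp
      then show ?thesis unfolding c by (simp add: algebra_simps add_divide_distrib)
    qed
    have "integral {0..pi} (\<lambda>x. u x * (cos (real n * x) * cos x ^ Suc i)) =
        integral {0..pi} (\<lambda>x. (u x * (cos (real (Suc n) * x) * cos x ^ i) + u x * (cos (real k * x) * cos x ^ i)) * (1/2))"
      unfolding e ..
    also have "\<dots> = (integral {0..pi} (\<lambda>x. u x * (cos (real (Suc n) * x) * cos x ^ i)) + integral {0..pi} (\<lambda>x. u x * (cos (real k * x) * cos x ^ i))) * (1/2)"
      by (simp only: integral_mult_left Henstock_Kurzweil_Integration.integral_add[OF ii ii])
    finally show ?thesis by (simp only: Suc.IH add_0_left mult_zero_left)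
  qed
qed

text \<open>A continuous function on [0,\<pi>] is a continuous function of cos x, through arccos,
  and is therefore uniformly close to a polynomial in cos x, against which u integrates to
  0.\<close>

lemma cosine_moments_zero_continuous:
  fixes u \<phi> :: "real \<Rightarrow> real"
  assumes u: "u absolutely_integrable_on {0..pi}"
    and z: "\<And>n::nat. integral {0..pi} (\<lambda>x. u x * cos (real n * x)) = 0"
    and \<phi>: "continuous_on {0..pi} \<phi>"
  shows "integral {0..pi} (\<lambda>x. u x * \<phi> x) = 0"
proof -
  have uc: "(\<lambda>x. u x * k x) absolutely_integrable_on {0..pi}" if "continuous_on {0..pi} k" for k :: "real \<Rightarrow> real"
  proof -
    have "(\<lambda>x. k x * u x) absolutely_integrable_on {0..pi}"
      using that by (intro absolutely_integrable_bounded_measurable_product[OF bilinear_times _ _ _ u]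
          continuous_imp_measurable_on_sets_lebesgue compact_imp_bounded compact_continuous_image) auto
    then show ?thesis by (simp add: mult.commute)
  qed
  define M where "M = integral {0..pi} (\<lambda>x. \<bar>u x\<bar>)"
  have ui: "(\<lambda>x. \<bar>u x\<bar>) integrable_on {0..pi}" using u by (simp add: absolutely_integrable_on_def)
  have "\<bar>integral {0..pi} (\<lambda>x. u x * \<phi> x)\<bar> \<le> e * M" if e: "0 < e" for e
  proof -
    have "continuous_on {-1..1} (\<lambda>y. \<phi> (arccos y))"
      by (rule continuous_on_compose2[OF \<phi> continuous_on_arccos']) (auto simp: arccos_lbound arccos_ubound)
    then obtain g where g: "real_polynomial_function g" "\<And>y. y \<in> {-1..1} \<Longrightarrow> \<bar>\<phi> (arccos y) - g y\<bar> < e"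
      using Stone_Weierstrass_real_polynomial_function[of "{-1..1::real}" "\<lambda>y. \<phi> (arccos y)" e] e by auto
    obtain a n where a: "g = (\<lambda>y. \<Sum>i\<le>n. a i * y ^ i)" using g(1) unfolding real_polynomial_function_iff_sum by blast
    have gc: "continuous_on {0..pi} (\<lambda>x. g (cos x))" unfolding a by (intro continuous_intros)
    have "integral {0..pi} (\<lambda>x. u x * g (cos x)) = integral {0..pi} (\<lambda>x. \<Sum>i\<le>n. a i * (u x * (cos (real 0 * x) * cos x ^ i)))"
      by (simp add: a sum_distrib_left mult_ac)
    also have "\<dots> = (\<Sum>i\<le>n. integral {0..pi} (\<lambda>x. a i * (u x * (cos (real 0 * x) * cos x ^ i))))"
      by (intro integral_sum integrable_on_mult_right set_lebesgue_integral_eq_integral(1) uc continuous_intros) auto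
    also have "\<dots> = 0"
      by (intro sum.neutral ballI) (simp only: integral_mult_right cosine_moments_zero_imp_power_moments[OF u z] mult_zero_right)
    finally have 0: "integral {0..pi} (\<lambda>x. u x * g (cos x)) = 0" .
    have "integral {0..pi} (\<lambda>x. u x * \<phi> x) = integral {0..pi} (\<lambda>x. u x * \<phi> x - u x * g (cos x))"
      using 0 Henstock_Kurzweil_Integration.integral_diff[OF set_lebesgue_integral_eq_integral(1)[OF uc[OF \<phi>]] set_lebesgue_integral_eq_integral(1)[OF uc[OF gc]]]
      by simp
    also have "norm \<dots> \<le> integral {0..pi} (\<lambda>x. e * \<bar>u x\<bar>)"
    proof (rule integral_norm_bound_integral)
      show "(\<lambda>x. u x * \<phi> x - u x * g (cos x)) integrable_on {0..pi}"
        by (intro integrable_diff set_lebesgue_integral_eq_integral(1) uc \<phi> gc)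
      show "(\<lambda>x. e * \<bar>u x\<bar>) integrable_on {0..pi}" by (intro integrable_on_mult_right ui)
      fix x assume x: "x \<in> {0..pi}"
      have "\<bar>\<phi> (arccos (cos x)) - g (cos x)\<bar> < e" by (rule g(2)) simp
      then have le: "\<bar>\<phi> x - g (cos x)\<bar> \<le> e" using x by (simp add: arccos_cos)
      have "norm (u x * \<phi> x - u x * g (cos x)) = \<bar>u x\<bar> * \<bar>\<phi> x - g (cos x)\<bar>"
        by (simp add: right_diff_distrib[symmetric] abs_mult)
      also have "\<dots> \<le> \<bar>u x\<bar> * e" using le by (rule mult_left_mono) simp
      finally show "norm (u x * \<phi> x - u x * g (cos x)) \<le> e * \<bar>u x\<bar>" by (simp only: mult.commute)
    qed
    also have "\<dots> = e * M" by (simp add: M_def)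
    finally show ?thesis by simp
  qed
  note bound = this
  have M: "0 \<le> M" unfolding M_def by (rule integral_nonneg[OF ui]) auto
  have "\<bar>integral {0..pi} (\<lambda>x. u x * \<phi> x)\<bar> \<le> 0"
  proof (rule field_le_epsilon)
    fix d :: real assume d: "0 < d"
    have "\<bar>integral {0..pi} (\<lambda>x. u x * \<phi> x)\<bar> \<le> d / (M + 1) * M" using bound[of "d / (M + 1)"] d M by simp
    also have "\<dots> \<le> d" using d M by (simp add: field_simps)
    finally show "\<bar>integral {0..pi} (\<lambda>x. u x * \<phi> x)\<bar> \<le> 0 + d" by simp
  qed
  then show ?thesis by simp
qed

text \<open>Continuous ramps converge pointwise to the indicator of [0,t), so the indefinite
  integral of u vanishes identically; almost everywhere its derivative is u.\<close>

lemma cosine_moments_zero_ae: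
  fixes u :: "real \<Rightarrow> real"
  assumes u: "u absolutely_integrable_on {0..pi}"
    and z: "\<And>n::nat. integral {0..pi} (\<lambda>x. u x * cos (real n * x)) = 0"
  shows "AE x in leb_pi. u x = 0"
proof -
  have ui: "u integrable_on {0..pi}" "(\<lambda>x. \<bar>u x\<bar>) integrable_on {0..pi}" using u by (auto simp: absolutely_integrable_on_def)
  have zero: "integral {0..t} u = 0" if t: "t \<in> {0..pi}" for t
  proof -
    define \<phi> where "\<phi> = (\<lambda>k x. max 0 (min 1 (real k * (t - x))))"
    have c: "continuous_on {0..pi} (\<phi> k)" for k unfolding \<phi>_def by (intro continuous_intros)
    have ai: "(\<lambda>x. \<phi> k x * u x) absolutely_integrable_on {0..pi}" for k
      by (intro absolutely_integrable_bounded_measurable_product[OF bilinear_times _ _ _ u]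
          continuous_imp_measurable_on_sets_lebesgue compact_imp_bounded compact_continuous_image c) auto
    have "(\<lambda>k. integral {0..pi} (\<lambda>x. \<phi> k x * u x)) \<longlonglongrightarrow> integral {0..pi} (\<lambda>x. if x \<in> {0..<t} then u x else 0)"
    proof (rule dominated_convergence(2)[OF set_lebesgue_integral_eq_integral(1)[OF ai] ui(2)])
      fix k x
      have "\<bar>\<phi> k x\<bar> \<le> 1" by (simp add: \<phi>_def)
      then show "norm (\<phi> k x * u x) \<le> \<bar>u x\<bar>" by (simp add: abs_mult mult_left_le_one_le)
    next
      fix x assume x: "x \<in> {0..pi}"
      show "(\<lambda>k. \<phi> k x * u x) \<longlonglongrightarrow> (if x \<in> {0..<t} then u x else 0)"
      proof (rule tendsto_eventually)
        show "\<forall>\<^sub>F k in sequentially. \<phi> k x * u x = (if x \<in> {0..<t} then u x else 0)"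
        proof (cases "x < t")
          case True
          obtain n :: nat where n: "1 / (t - x) \<le> real n" using real_arch_simple by blast
          have "\<phi> k x = 1" if "n \<le> k" for k
          proof -
            have "1 / (t - x) \<le> real k" using n that by (meson of_nat_mono order_trans)
            then have "1 \<le> real k * (t - x)" using True by (simp add: pos_divide_le_eq)
            then show ?thesis by (simp add: \<phi>_def)
          qed
          then show ?thesis using True x by (intro eventually_sequentiallyI[of n]) auto
        next
          case False
          then have "real k * (t - x) \<le> 0" for k by (intro mult_nonneg_nonpos) auto
          then have "\<phi> k x = 0" for k unfolding \<phi>_def by (intro max_absorb1 min.coboundedI2)
          then show ?thesis using False by simp
        qed
      qed
    qed
    moreover have "integral {0..pi} (\<lambda>x. \<phi> k x * u x) = 0" for k
      using cosine_moments_zero_continuous[OF u z c] by (simp add: mult.commute)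
    ultimately have "integral {0..pi} (\<lambda>x. if x \<in> {0..<t} then u x else 0) = 0"
      by (simp add: LIMSEQ_const_iff)
    also have "integral {0..pi} (\<lambda>x. if x \<in> {0..<t} then u x else 0) = integral {0..pi} (\<lambda>x. if x \<in> {0..t} then u x else 0)"
      by (rule integral_spike[of "{t}"]) auto
    also have "\<dots> = integral ({0..t} \<inter> {0..pi}) u" by (rule integral_restrict_Int)
    also have "{0..t} \<inter> {0..pi} = {0..t}" using t by auto
    finally show ?thesis .
  qed
  obtain N where N: "negligible N" "\<And>x. x \<in> {0<..<pi} - N \<Longrightarrow> ((\<lambda>x. integral {0..x} u) has_vector_derivative u x) (at x)"
    using has_vector_derivative_integral_ae[OF ui(1)] by blast
  have "u x = 0" if x: "x \<in> {0..pi} - (N \<union> {0,pi})" for x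
  proof -
    have xi: "x \<in> {0<..<pi}" using x by auto
    have "((\<lambda>x. integral {0..x} u) has_vector_derivative 0) (at x)"
    proof (rule has_vector_derivative_transform_within_open[OF has_vector_derivative_const])
      show "open {0<..<pi}" "x \<in> {0<..<pi}" using xi by auto
      show "0 = integral {0..y} u" if "y \<in> {0<..<pi}" for y using zero[of y] that by simp
    qed
    then show ?thesis using N(2)[of x] x xi vector_derivative_unique_at by blast
  qed
  then show ?thesis unfolding AE_leb_pi_iff using N(1) by (intro exI[of _ "N \<union> {0,pi}"]) (auto simp: negligible_Un)
qed

lemma cos_transform_zero_ae:
  assumes h: "integrable leb_pi h" and z: "\<And>n::nat. cos_transform h (of_nat n) = 0"
  shows "AE x in leb_pi. h x = 0"
proof -
  have i: "integrable leb_pi (\<lambda>x. h x * of_real (cos (real n * x)))" for n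
    by (intro integrable_mult_continuous h continuous_intros)
  have c: "(LINT x|leb_pi. h x * of_real (cos (real n * x))) = 0" for n
    using z[of n] by (simp add: cos_transform_def cos_of_real[symmetric] del: cos_of_real)
  have R: "integral {0..pi} (\<lambda>x. Re (h x) * cos (real n * x)) = 0" for n
  proof -
    have "integrable leb_pi (\<lambda>x. Re (h x * of_real (cos (real n * x))))" using i by (rule integrable_Re)
    from lebesgue_integral_eq_integral[OF this]
    show ?thesis using integral_Re[OF i[of n]] c[of n] by simp
  qed
  have I: "integral {0..pi} (\<lambda>x. Im (h x) * cos (real n * x)) = 0" for n
  proof -
    have "integrable leb_pi (\<lambda>x. Im (h x * of_real (cos (real n * x))))" using i by (rule integrable_Im)
    from lebesgue_integral_eq_integral[OF this]
    show ?thesis using integral_Im[OF i[of n]] c[of n] by simp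
  qed
  have "AE x in leb_pi. Re (h x) = 0"
    by (rule cosine_moments_zero_ae[OF _ R]) (use integrable_Re[OF h] in \<open>simp add: integrable_leb_pi_iff\<close>)
  moreover have "AE x in leb_pi. Im (h x) = 0"
    by (rule cosine_moments_zero_ae[OF _ I]) (use integrable_Im[OF h] in \<open>simp add: integrable_leb_pi_iff\<close>)
  ultimately show ?thesis by eventually_elim (simp add: complex_eq_iff)
qed

definition cos_fun :: "complex \<Rightarrow> real \<Rightarrow> complex" where "cos_fun z x = cos (z * of_real x)"

lemma cos_fun_L2: "cos_fun z \<in> L2"
  unfolding cos_fun_def by (intro L2_continuous continuous_intros)

lemma cinner_cos_fun:
  "cinner x (of_fun (cos_fun z)) = cnj (cos_transform (\<lambda>t. cnj (to_fun x t)) z)"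
proof -
  have "cinner x (of_fun (cos_fun z)) = l2_inner (to_fun x) (cos_fun z)"
    using of_fun_cinner[OF to_fun_L2 cos_fun_L2, of x z] by (simp add: cinner_l2_def)
  also have "\<dots> = (LINT t|leb_pi. cnj (cnj (to_fun x t) * cos (z * of_real t)))" by (simp add: l2_inner_def cos_fun_def)
  also have "\<dots> = cnj (cos_transform (\<lambda>t. cnj (to_fun x t)) z)" unfolding cos_transform_def by (rule Bochner_Integration.integral_cnj)
  finally show ?thesis .
qed

lemma cnj_to_fun_integrable: "integrable leb_pi (\<lambda>t. cnj (to_fun x t))"
  using L2_integrable[OF to_fun_L2[of x]] by simp

text \<open>Orthogonality to the system means that the transform of the conjugate function vanishes
  at every \<open>l n\<close>. Once it vanishes identically it vanishes at the integers, where the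
  cosine moments determine the function.\<close>

lemma complete_system_cos_fun:
  assumes "\<And>h z. \<lbrakk>integrable leb_pi h; \<And>n. cos_transform h (l n) = 0\<rbrakk> \<Longrightarrow> cos_transform h z = 0"
  shows "complete_system (\<lambda>n. of_fun (cos_fun (l n)))"
  unfolding complete_system_def
proof (intro allI impI)
  fix x assume "\<forall>n. cinner x (of_fun (cos_fun (l n))) = 0"
  then have "cos_transform (\<lambda>t. cnj (to_fun x t)) (l n) = 0" for n by (simp add: cinner_cos_fun)
  then have "cos_transform (\<lambda>t. cnj (to_fun x t)) z = 0" for z using assms cnj_to_fun_integrable by blast
  then have "AE t in leb_pi. cnj (to_fun x t) = 0" by (intro cos_transform_zero_ae cnj_to_fun_integrable)
  then have "ae_eq (to_fun x) (\<lambda>t. 0)" by (simp add: ae_eq_def)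
  then have "of_fun (to_fun x) = of_fun (\<lambda>t. 0)" by (subst of_fun_eq_iff) (simp_all add: L2_zero)
  then show "x = 0" by (simp add: of_fun_zero)
qed

lemma cosine_eq_cos_fun: "cosine \<sigma> n = cos_fun (of_real (real n + \<sigma>))"
  by (rule ext) (simp only: cosine_def cos_fun_def of_real_mult[symmetric] cos_of_real)

lemma cosine_scale_pos: "0 \<le> \<sigma> \<Longrightarrow> 0 < cosine_scale \<sigma> n"
  by (simp add: cosine_scale_def)

text \<open>For the shift 1/2, multiplying h by cos(x/2) moves the frequencies to the integers: the
  transform of the product at n is the mean of those of h at n + 1/2 and n - 1/2, and evenness
  covers -1/2. The factor is positive except at x = \<pi>, so h itself vanishes almost
  everywhere.\<close>

lemma complete_system_cosine_basis:
  assumes \<sigma>: "\<sigma> = 0 \<or> \<sigma> = 1/2"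
  shows "complete_system (cosine_basis \<sigma>)"
proof -
  have tr: "cos_transform h z = 0" if h: "integrable leb_pi h" and zero: "\<And>n. cos_transform h (of_real (real n + \<sigma>)) = 0" for h z
  proof -
    define k where "k = (\<lambda>x. h x * of_real (cos (\<sigma> * x)))"
    have k: "integrable leb_pi k" unfolding k_def by (intro integrable_mult_continuous h continuous_intros)
    have "cos_transform k (of_nat n) = 0" for n
    proof -
      have e: "k x * cos (of_nat n * of_real x) =
          (h x * cos (of_real (real n + \<sigma>) * of_real x) + h x * cos (of_real (real n - \<sigma>) * of_real x)) / 2" for x
      proof -
        have "cos (\<sigma> * x) * cos (real n * x) = (cos (real n * x - \<sigma> * x) + cos (real n * x + \<sigma> * x)) / 2"
          by (subst mult.commute) (rule cos_times_cos)
        then have "cos (\<sigma> * x) * cos (real n * x) = (cos ((real n - \<sigma>) * x) + cos ((real n + \<sigma>) * x)) / 2"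
          by (simp add: algebra_simps)
        then have "complex_of_real (cos (\<sigma> * x) * cos (real n * x)) = of_real ((cos ((real n - \<sigma>) * x) + cos ((real n + \<sigma>) * x)) / 2)"
          by (simp only:)
        then show ?thesis
          by (simp add: k_def cos_of_real[symmetric] del: cos_of_real) (simp add: algebra_simps add_divide_distrib)
      qed
      have i: "integrable leb_pi (\<lambda>x. h x * cos (w * of_real x))" for w by (rule cos_transform_integrable[OF h])
      have "cos_transform k (of_nat n) = (cos_transform h (of_real (real n + \<sigma>)) + cos_transform h (of_real (real n - \<sigma>))) / 2"
        unfolding cos_transform_def e by (simp add: Bochner_Integration.integral_add[OF i i])
      moreover have "cos_transform h (of_real (real n - \<sigma>)) = 0"
      proof (cases "\<sigma> = 0")
        case True then show ?thesis using zero[of n] by simp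
      next
        case False
        then have s: "\<sigma> = 1/2" using \<sigma> by simp
        show ?thesis
        proof (cases n)
          case 0
          have "cos_transform h (- w) = cos_transform h w" for w by (simp add: cos_transform_def)
          from this[of "of_real \<sigma>"] show ?thesis using zero[of 0] 0 by simp
        next
          case (Suc j)
          then have e2: "real n - \<sigma> = real j + \<sigma>" using s by simp
          show ?thesis unfolding e2 by (rule zero)
        qed
      qed
      ultimately show ?thesis using zero[of n] by simp
    qed
    then have "AE x in leb_pi. k x = 0" by (rule cos_transform_zero_ae[OF k])
    moreover have "AE x in leb_pi. x \<noteq> pi" unfolding AE_leb_pi_iff by (intro exI[of _ "{pi}"]) auto
    ultimately have "AE x in leb_pi. h x = 0"
    proof (rule AE_mp[OF AE_conjI], intro AE_I2 impI)
      fix x assume x: "x \<in> space leb_pi" "k x = 0 \<and> x \<noteq> pi"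
      have "0 < cos (\<sigma> * x)"
      proof (cases "\<sigma> = 0")
        case False
        then have s: "\<sigma> = 1/2" using \<sigma> by simp
        have "0 \<le> x" "x \<le> pi" "x \<noteq> pi" using x by auto
        then show ?thesis unfolding s using pi_gt_zero by (intro cos_gt_zero_pi) linarith+
      qed simp
      then show "h x = 0" using x by (simp add: k_def)
    qed
    then have "cos_transform h z = (LINT x|leb_pi. 0)"
      unfolding cos_transform_def
      using borel_measurable_integrable[OF cos_transform_integrable[OF h]] by (intro integral_cong_AE) auto
    then show ?thesis by simp
  qed
  have cs: "complete_system (\<lambda>n. of_fun (cos_fun (of_real (real n + \<sigma>))))"
    by (rule complete_system_cos_fun) (rule tr)
  have \<sigma>0: "0 \<le> \<sigma>" using \<sigma> by auto
  have "cinner x (cosine_basis \<sigma> n) = of_real (cosine_scale \<sigma> n) * cinner x (of_fun (cos_fun (of_real (real n + \<sigma>))))" for x n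
    by (simp add: cosine_basis_def cinner_cscale_right cosine_eq_cos_fun)
  then show ?thesis using cs cosine_scale_pos[OF \<sigma>0] unfolding complete_system_def by (simp add: less_imp_neq[THEN not_sym])
qed

text \<open>All cosines are scaled by the one factor that normalizes positive frequencies. As the
  cosine is Lipschitz, the squared distance to \<open>cosine_basis\<close> is then O(1/n^2), and
  initial indices do not affect summability. \<open>bari\<close> applies, and
  \<open>riesz_basis_cscale\<close> removes the factor.\<close>

theorem riesz_basis_cos_fun:
  assumes \<sigma>: "\<sigma> = 0 \<or> \<sigma> = 1/2"
    and close: "\<And>n. N \<le> n \<Longrightarrow> \<exists>x. l n = of_real x \<and> \<bar>x - (real n + \<sigma>)\<bar> \<le> C / real n"
    and tot: "\<And>h z. \<lbrakk>integrable leb_pi h; \<And>n. cos_transform h (l n) = 0\<rbrakk> \<Longrightarrow> cos_transform h z = 0"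
  shows "riesz_basis (\<lambda>n. of_fun (cos_fun (l n)))"
proof -
  define s where "s = complex_of_real (sqrt (2 / pi))"
  have s0: "s \<noteq> 0" by (simp add: s_def)
  define f where "f = (\<lambda>n. s *\<^sub>C of_fun (cos_fun (l n)))"
  have bound: "(norm (f n - cosine_basis \<sigma> n))\<^sup>2 \<le> (cmod s)\<^sup>2 * (pi * (C * pi)\<^sup>2) * (1 / real n ^ 2)" if n: "max 1 N \<le> n" for n
  proof -
    obtain x where x: "l n = of_real x" "\<bar>x - (real n + \<sigma>)\<bar> \<le> C / real n" using close[of n] n by auto
    have "real n + \<sigma> \<noteq> 0" using n \<sigma> by auto
    then have "f n - cosine_basis \<sigma> n = s *\<^sub>C of_fun (\<lambda>t. cos_fun (l n) t - cosine \<sigma> n t)"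
      by (simp add: f_def cosine_basis_def cosine_scale_def s_def of_fun_diff[OF cos_fun_L2 cosine_L2] cscale_diff_right)
    then have "(norm (f n - cosine_basis \<sigma> n))\<^sup>2 = (cmod s)\<^sup>2 * (l2_norm (\<lambda>t. cos_fun (l n) t - cosine \<sigma> n t))\<^sup>2"
      by (simp add: norm_cscale norm_of_fun[OF L2_diff[OF cos_fun_L2 cosine_L2]] power_mult_distrib)
    also have "(l2_norm (\<lambda>t. cos_fun (l n) t - cosine \<sigma> n t))\<^sup>2 \<le> pi * (C * pi / real n)\<^sup>2"
    proof -
      have "(l2_norm (\<lambda>t. cos_fun (l n) t - cosine \<sigma> n t))\<^sup>2 = (LINT t|leb_pi. (cmod (cos_fun (l n) t - cosine \<sigma> n t))\<^sup>2)"
        by (simp add: l2_norm_square L2_diff cos_fun_L2 cosine_L2)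
      also have "\<dots> \<le> (LINT t|leb_pi. (C * pi / real n)\<^sup>2)"
      proof (rule integral_mono)
        show "integrable leb_pi (\<lambda>t. (cmod (cos_fun (l n) t - cosine \<sigma> n t))\<^sup>2)"
          by (rule L2_D(2)[OF L2_diff[OF cos_fun_L2 cosine_L2]])
        show "integrable leb_pi (\<lambda>t. (C * pi / real n)\<^sup>2)" by (rule finite_measure.integrable_const[OF finite_measure_leb_pi])
        fix t assume "t \<in> space leb_pi"
        then have t: "0 \<le> t" "t \<le> pi" by auto
        have "cmod (cos_fun (l n) t - cosine \<sigma> n t) = \<bar>cos (x * t) - cos ((real n + \<sigma>) * t)\<bar>"
          unfolding cos_fun_def cosine_def x(1) of_real_mult[symmetric] cos_of_real of_real_diff[symmetric] norm_of_real ..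
        also have "\<dots> \<le> \<bar>x * t - (real n + \<sigma>) * t\<bar>"
        proof -
          have "\<bar>cos a - cos b\<bar> \<le> \<bar>a - b\<bar>" for a b :: real
          proof -
            have "\<bar>cos a - cos b\<bar> = 2 * \<bar>sin ((a + b) / 2)\<bar> * \<bar>sin ((b - a) / 2)\<bar>" by (simp add: cos_diff_cos abs_mult)
            also have "\<dots> \<le> 2 * 1 * \<bar>(b - a) / 2\<bar>" by (intro mult_mono abs_sin_x_le_abs_x) auto
            finally show ?thesis by simp
          qed
          then show ?thesis .
        qed
        also have "\<dots> = \<bar>x - (real n + \<sigma>)\<bar> * t" using t by (simp add: left_diff_distrib[symmetric] abs_mult)
        also have "\<dots> \<le> C / real n * pi" using x(2) t by (intro mult_mono) auto
        finally show "(cmod (cos_fun (l n) t - cosine \<sigma> n t))\<^sup>2 \<le> (C * pi / real n)\<^sup>2" by (intro power_mono) auto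
      qed
      also have "\<dots> = pi * (C * pi / real n)\<^sup>2" by (simp add: measure_restrict_space)
      finally show ?thesis .
    qed
    finally show ?thesis by (simp add: power_divide mult_left_mono mult.assoc)
  qed
  have "summable (\<lambda>n. (norm (f n - cosine_basis \<sigma> n))\<^sup>2)"
  proof (rule summable_comparison_test')
    show "summable (\<lambda>n. (cmod s)\<^sup>2 * (pi * (C * pi)\<^sup>2) * (1 / real n ^ 2))"
      using inverse_power_summable[of 2, where 'a = real] by (intro summable_mult) (simp add: inverse_eq_divide)
    show "norm ((norm (f n - cosine_basis \<sigma> n))\<^sup>2) \<le> (cmod s)\<^sup>2 * (pi * (C * pi)\<^sup>2) * (1 / real n ^ 2)" if "max 1 N \<le> n" for n
      using bound[OF that] by simp
  qed
  moreover have "complete_system f"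
  proof -
    have "cinner x (f n) = cnj s * cinner x (of_fun (cos_fun (l n)))" for x n by (simp add: f_def cinner_cscale_right)
    moreover have "complete_system (\<lambda>n. of_fun (cos_fun (l n)))" by (rule complete_system_cos_fun) (rule tot)
    ultimately show ?thesis using s0 unfolding complete_system_def by simp
  qed
  ultimately have "riesz_basis f"
    by (intro bari[OF orthonormal_cosine_basis[OF \<sigma>] complete_system_cosine_basis[OF \<sigma>]])
  then show ?thesis unfolding f_def by (rule riesz_basis_cscale[OF s0])
qed

section \<open>Completeness of the eigenvalue cosines\<close>

lemma sl_lambda_power2: "(sl_lambda q \<alpha> \<beta> n)\<^sup>2 = of_real (sl_mu q \<alpha> \<beta> n)"
  by (simp add: sl_lambda_def)

lemma cos_transform_even: "z\<^sup>2 = w\<^sup>2 \<Longrightarrow> cos_transform h z = cos_transform h w"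
  by (auto simp: power2_eq_iff cos_transform_def)

lemma radius_unbounded: "\<exists>k. x < radius m (k + K)"
proof -
  obtain n :: nat where "x < real n" using reals_Archimedean2 by blast
  moreover have "real n \<le> radius m (n + K)" by (simp add: radius_def)
  ultimately show ?thesis by (meson less_le_trans)
qed

context sl_potential
begin

context
  fixes \<alpha> \<beta> :: real
  assumes \<alpha>: "\<alpha> \<in> {0<..pi}" and \<beta>: "\<beta> \<in> {0..<pi}"
begin

lemma chr_zero_lambda:
  assumes "chr \<alpha> \<beta> (z\<^sup>2) = 0"
  obtains n where "z\<^sup>2 = (sl_lambda q \<alpha> \<beta> n)\<^sup>2"
  using assms eigenvalue_asymptotics(1)[OF \<alpha> \<beta>] that unfolding sl_lambda_power2 by blast

text \<open>Covers both regions used in \<open>cos_transform_eq_0\<close>, the circles and the far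
  imaginary axis. Cancelling powers of |l| leaves |l|^(1-m) in front of the exponential: enough for
  m <= 1, one power short for m = 2.\<close>

lemma chr_growth:
  obtains L c where "1 \<le> L" "0 < c"
    "\<And>l. \<lbrakk>L \<le> cmod l; (\<exists>k. cmod l = radius (bc_order \<alpha> \<beta>) k) \<or> 1 \<le> \<bar>Im l\<bar>\<rbrakk>
      \<Longrightarrow> c * cmod l * exp (\<bar>Im l\<bar> * pi) \<le> cmod l ^ bc_order \<alpha> \<beta> * cmod (chr \<alpha> \<beta> (l\<^sup>2))"
proof -
  obtain L where L: "1 \<le> L" "\<And>l. \<lbrakk>L \<le> cmod l; exp (\<bar>Im l\<bar> * pi) / 4 \<le> cmod (trig (bc_order \<alpha> \<beta>) l)\<rbrakk>
     \<Longrightarrow> \<bar>bc_coeff \<alpha> \<beta>\<bar> / 8 * cmod l * exp (\<bar>Im l\<bar> * pi) \<le> cmod (l ^ bc_order \<alpha> \<beta> * chr \<alpha> \<beta> (l\<^sup>2))"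
    using chr_lower[OF \<alpha> \<beta>] by blast
  show thesis
  proof (rule that[OF L(1)])
    show "0 < \<bar>bc_coeff \<alpha> \<beta>\<bar> / 8" using bc_coeff_nonzero[OF \<alpha> \<beta>] by simp
    fix l assume l: "L \<le> cmod l" "(\<exists>k. cmod l = radius (bc_order \<alpha> \<beta>) k) \<or> 1 \<le> \<bar>Im l\<bar>"
    have "exp (\<bar>Im l\<bar> * pi) / 4 \<le> cmod (trig (bc_order \<alpha> \<beta>) l)"
      using l(2)
    proof
      assume "\<exists>k. cmod l = radius (bc_order \<alpha> \<beta>) k"
      then show ?thesis using cmod_trig_circle bc_order_le[OF \<alpha> \<beta>] by blast
    next
      assume "1 \<le> \<bar>Im l\<bar>"
      then have "1 * 1 \<le> pi * \<bar>Im l\<bar>" using pi_gt3 by (intro mult_mono) auto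
      then show ?thesis by (intro cmod_trig_ge) simp
    qed
    from L(2)[OF l(1) this]
    show "\<bar>bc_coeff \<alpha> \<beta>\<bar> / 8 * cmod l * exp (\<bar>Im l\<bar> * pi) \<le> cmod l ^ bc_order \<alpha> \<beta> * cmod (chr \<alpha> \<beta> (l\<^sup>2))"
      by (simp only: norm_mult norm_power)
  qed
qed

lemma cos_lambda_complete:
  assumes m: "bc_order \<alpha> \<beta> \<le> 1" and h: "integrable leb_pi h"
    and zero: "\<And>n. cos_transform h (sl_lambda q \<alpha> \<beta> n) = 0"
  shows "cos_transform h z = 0"
proof -
  obtain L c where L: "1 \<le> L" "0 < c" "\<And>l. \<lbrakk>L \<le> cmod l; (\<exists>k. cmod l = radius (bc_order \<alpha> \<beta>) k) \<or> 1 \<le> \<bar>Im l\<bar>\<rbrakk>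
      \<Longrightarrow> c * cmod l * exp (\<bar>Im l\<bar> * pi) \<le> cmod l ^ bc_order \<alpha> \<beta> * cmod (chr \<alpha> \<beta> (l\<^sup>2))"
    using chr_growth by blast
  have lower: "c * exp (\<bar>Im l\<bar> * pi) \<le> cmod (chr \<alpha> \<beta> (l\<^sup>2))"
    if l: "L \<le> cmod l" "(\<exists>k. cmod l = radius (bc_order \<alpha> \<beta>) k) \<or> 1 \<le> \<bar>Im l\<bar>" for l
  proof -
    have l1: "1 \<le> cmod l" using l(1) L(1) by simp
    then have "cmod l ^ bc_order \<alpha> \<beta> \<le> cmod l ^ 1" by (rule power_increasing[OF m])
    then have "cmod l ^ bc_order \<alpha> \<beta> * cmod (chr \<alpha> \<beta> (l\<^sup>2)) \<le> cmod l * cmod (chr \<alpha> \<beta> (l\<^sup>2))"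
      by (intro mult_right_mono) auto
    then have "cmod l * (c * exp (\<bar>Im l\<bar> * pi)) \<le> cmod l * cmod (chr \<alpha> \<beta> (l\<^sup>2))"
      using L(3)[OF l] by (simp only: mult_ac)
    moreover have "0 < cmod l" using l1 by linarith
    ultimately show ?thesis by (simp only: mult_le_cancel_left_pos)
  qed
  obtain K :: nat where K: "L < real K" using reals_Archimedean2 by blast
  show ?thesis
  proof (rule cos_transform_eq_0[OF h chr_holomorphic chr_zero_simple _ L(2), where R = "\<lambda>k. radius (bc_order \<alpha> \<beta>) (k + K)" and ?t0.0 = L])
    fix z assume "chr \<alpha> \<beta> (z\<^sup>2) = 0"
    then obtain n where "z\<^sup>2 = (sl_lambda q \<alpha> \<beta> n)\<^sup>2" by (rule chr_zero_lambda)
    then show "cos_transform h z = 0" using zero cos_transform_even by metis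
  next
    show "\<exists>k. x < radius (bc_order \<alpha> \<beta>) (k + K)" for x by (rule radius_unbounded)
    fix k l assume l: "cmod l = radius (bc_order \<alpha> \<beta>) (k + K)"
    have "L \<le> cmod l" using radius_ge(2)[of "k + K" "bc_order \<alpha> \<beta>"] K unfolding l by simp
    then show "c * exp (\<bar>Im l\<bar> * pi) \<le> cmod (chr \<alpha> \<beta> (l\<^sup>2))" using l by (intro lower) auto
  next
    fix t assume t: "L \<le> t"
    have "c * exp (\<bar>Im (\<i> * of_real t)\<bar> * pi) \<le> cmod (chr \<alpha> \<beta> ((\<i> * of_real t)\<^sup>2))"
      by (rule lower) (use t L(1) in \<open>auto simp: norm_mult\<close>)
    then show "c * exp (t * pi) \<le> cmod (chr \<alpha> \<beta> ((\<i> * of_real t)\<^sup>2))" using t L(1) by simp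
  qed
qed

text \<open>For |l| >= 2|w| the factor l^2 - w^2 has modulus at least |l|^2/2, which makes up for
  the missing power of l. As w^2 is not an eigenvalue, the added zero is simple and leaves the
  others simple.\<close>

lemma cos_lambda_complete_augmented:
  assumes m: "bc_order \<alpha> \<beta> = 2" and h: "integrable leb_pi h"
    and w: "\<And>n. w\<^sup>2 \<noteq> (sl_lambda q \<alpha> \<beta> n)\<^sup>2" "cos_transform h w = 0"
    and zero: "\<And>n. cos_transform h (sl_lambda q \<alpha> \<beta> n) = 0"
  shows "cos_transform h z = 0"
proof -
  obtain L c where L: "1 \<le> L" "0 < c" "\<And>l. \<lbrakk>L \<le> cmod l; (\<exists>k. cmod l = radius 2 k) \<or> 1 \<le> \<bar>Im l\<bar>\<rbrakk>
      \<Longrightarrow> c * cmod l * exp (\<bar>Im l\<bar> * pi) \<le> cmod l ^ 2 * cmod (chr \<alpha> \<beta> (l\<^sup>2))"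
    using chr_growth unfolding m by blast
  define \<Psi> where "\<Psi> = (\<lambda>\<mu>. (\<mu> - w\<^sup>2) * chr \<alpha> \<beta> \<mu>)"
  define L' where "L' = L + 2 * cmod w"
  have L': "L \<le> L'" "1 \<le> L'" using L(1) norm_ge_zero[of w] unfolding L'_def by linarith+
  have lower: "c / 2 * exp (\<bar>Im l\<bar> * pi) \<le> cmod (\<Psi> (l\<^sup>2))"
    if l: "L' \<le> cmod l" "(\<exists>k. cmod l = radius 2 k) \<or> 1 \<le> \<bar>Im l\<bar>" for l
  proof -
    define X E where "X = cmod (chr \<alpha> \<beta> (l\<^sup>2))" and "E = exp (\<bar>Im l\<bar> * pi)"
    have l1: "1 \<le> cmod l" "L \<le> cmod l" "2 * cmod w \<le> cmod l" using l(1) L(1) norm_ge_zero[of w] unfolding L'_def by linarith+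
    have "(2 * cmod w)\<^sup>2 \<le> (cmod l)\<^sup>2" using l1(3) by (intro power_mono) auto
    then have "4 * (cmod w)\<^sup>2 \<le> (cmod l)\<^sup>2" by (simp add: power_mult_distrib)
    then have "(cmod w)\<^sup>2 \<le> (cmod l)\<^sup>2 / 2" using zero_le_power2[of "cmod w"] by linarith
    moreover have "(cmod l)\<^sup>2 - (cmod w)\<^sup>2 \<le> cmod (l\<^sup>2 - w\<^sup>2)"
      using norm_triangle_ineq2[of "l\<^sup>2" "w\<^sup>2"] by (simp only: norm_power)
    ultimately have "(cmod l)\<^sup>2 / 2 \<le> cmod (l\<^sup>2 - w\<^sup>2)" by linarith
    then have "(cmod l)\<^sup>2 / 2 * X \<le> cmod (\<Psi> (l\<^sup>2))"
      unfolding \<Psi>_def norm_mult X_def by (rule mult_right_mono) simp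
    moreover have "c * cmod l * E \<le> (cmod l)\<^sup>2 * X" using L(3)[OF l1(2) l(2)] by (simp only: X_def E_def)
    moreover have "c * E * 1 \<le> c * E * cmod l" using l1 L(2) by (intro mult_left_mono) (auto simp: E_def)
    ultimately have "c * E / 2 \<le> cmod (\<Psi> (l\<^sup>2))" by (simp add: mult_ac)
    then show ?thesis by (simp add: E_def)
  qed
  have c2: "0 < c / 2" using L(2) by simp
  have hol: "\<Psi> holomorphic_on UNIV" unfolding \<Psi>_def by (intro holomorphic_intros chr_holomorphic)
  have chrw: "chr \<alpha> \<beta> (w\<^sup>2) \<noteq> 0" using w(1) chr_zero_lambda[of w] by blast
  have deriv: "deriv \<Psi> \<mu> \<noteq> 0" if "\<Psi> \<mu> = 0" for \<mu>
  proof -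
    have "(chr \<alpha> \<beta> has_field_derivative deriv (chr \<alpha> \<beta>) \<mu>) (at \<mu>)"
      by (rule holomorphic_derivI[OF chr_holomorphic open_UNIV]) simp
    then have "(\<Psi> has_field_derivative chr \<alpha> \<beta> \<mu> + (\<mu> - w\<^sup>2) * deriv (chr \<alpha> \<beta>) \<mu>) (at \<mu>)"
      unfolding \<Psi>_def by (auto intro!: derivative_eq_intros)
    then have "deriv \<Psi> \<mu> = chr \<alpha> \<beta> \<mu> + (\<mu> - w\<^sup>2) * deriv (chr \<alpha> \<beta>) \<mu>" by (rule DERIV_imp_deriv)
    then show ?thesis using that chrw chr_zero_simple[of \<alpha> \<beta> \<mu>] by (auto simp: \<Psi>_def)
  qed
  obtain K :: nat where K: "L' < real K" using reals_Archimedean2 by blast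
  show ?thesis
  proof (rule cos_transform_eq_0[OF h hol deriv _ c2, where R = "\<lambda>k. radius 2 (k + K)" and ?t0.0 = L'])
    fix z assume "\<Psi> (z\<^sup>2) = 0"
    then consider "z\<^sup>2 = w\<^sup>2" | "chr \<alpha> \<beta> (z\<^sup>2) = 0" by (auto simp: \<Psi>_def)
    then show "cos_transform h z = 0"
    proof cases
      case 1 then show ?thesis using w(2) cos_transform_even by metis
    next
      case 2
      then obtain n where "z\<^sup>2 = (sl_lambda q \<alpha> \<beta> n)\<^sup>2" by (rule chr_zero_lambda)
      then show ?thesis using zero cos_transform_even by metis
    qed
  next
    show "\<exists>k. x < radius 2 (k + K)" for x by (rule radius_unbounded)
    fix k l assume l: "cmod l = radius 2 (k + K)"
    have "L' \<le> cmod l" using radius_ge(2)[of "k + K" 2] K unfolding l by simp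
    then show "c / 2 * exp (\<bar>Im l\<bar> * pi) \<le> cmod (\<Psi> (l\<^sup>2))" using l by (intro lower) auto
  next
    fix t assume t: "L' \<le> t"
    have "c / 2 * exp (\<bar>Im (\<i> * of_real t)\<bar> * pi) \<le> cmod (\<Psi> ((\<i> * of_real t)\<^sup>2))"
      by (rule lower) (use t L'(2) in \<open>auto simp: norm_mult\<close>)
    then show "c / 2 * exp (t * pi) \<le> cmod (\<Psi> ((\<i> * of_real t)\<^sup>2))" using t L'(2) by simp
  qed
qed

end

section \<open>Riesz bases of eigenvalue cosines\<close>

lemma riesz_basis_cos_lambda:
  assumes \<alpha>: "\<alpha> \<in> {0<..pi}" and \<beta>: "\<beta> \<in> {0..<pi}" and ne: "(\<alpha>, \<beta>) \<noteq> (pi, 0)"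
  shows "riesz_basis (\<lambda>n. of_fun (cos_fun (sl_lambda q \<alpha> \<beta> n)))"
proof -
  have m: "bc_order \<alpha> \<beta> \<le> 1" using ne by (auto simp: bc_order_def)
  obtain C N where CN: "\<forall>n\<ge>N. \<exists>x. sl_lambda q \<alpha> \<beta> n = of_real x \<and> \<bar>x - (real n + real (bc_order \<alpha> \<beta>) / 2)\<bar> \<le> C / real n"
    using eigenvalue_asymptotics(3)[OF \<alpha> \<beta>] by blast
  show ?thesis
  proof (rule riesz_basis_cos_fun)
    show "real (bc_order \<alpha> \<beta>) / 2 = 0 \<or> real (bc_order \<alpha> \<beta>) / 2 = 1 / 2" using m by (auto simp: le_Suc_eq)
    show "\<exists>x. sl_lambda q \<alpha> \<beta> n = of_real x \<and> \<bar>x - (real n + real (bc_order \<alpha> \<beta>) / 2)\<bar> \<le> C / real n" if "N \<le> n" for n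
      using CN that by blast
    show "cos_transform h z = 0" if "integrable leb_pi h" "\<And>n. cos_transform h (sl_lambda q \<alpha> \<beta> n) = 0" for h z
      by (rule cos_lambda_complete[OF \<alpha> \<beta> m that])
  qed
qed

text \<open>Putting w in front moves the k-th root, which is close to k + 1, to position k + 1. The
  comparison system is therefore the cosines of integer frequency, with shift 0.\<close>

lemma riesz_basis_cos_lambda_augmented:
  assumes w: "\<And>n. w\<^sup>2 \<noteq> (sl_lambda q pi 0 n)\<^sup>2"
  shows "riesz_basis (\<lambda>n. of_fun (cos_fun (case_nat w (sl_lambda q pi 0) n)))"
proof -
  have ab: "pi \<in> {0<..pi}" "0 \<in> {0..<pi}" by auto
  have m: "bc_order pi 0 = 2" by (simp add: bc_order_def)
  obtain C N where CN: "\<And>n. N \<le> n \<Longrightarrow> \<exists>x. sl_lambda q pi 0 n = of_real x \<and> \<bar>x - (real n + 1)\<bar> \<le> C / real n"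
    using eigenvalue_asymptotics(3)[OF ab] unfolding m by auto
  show ?thesis
  proof (rule riesz_basis_cos_fun[where \<sigma> = 0])
    \<comment> \<open>Starting at 2 keeps k = n - 1 positive, so that n <= 2k and an error C/k turns
      into 2|C|/n.\<close>
    fix n assume n: "max 2 (Suc N) \<le> n"
    then obtain k where k: "n = Suc k" "N \<le> k" "1 \<le> k" by (cases n) auto
    obtain x where x: "sl_lambda q pi 0 k = of_real x" "\<bar>x - (real k + 1)\<bar> \<le> C / real k" using CN[OF k(2)] by blast
    have "C / real k \<le> \<bar>C\<bar> / real k" using k(3) by (simp add: divide_right_mono)
    also have "\<dots> \<le> 2 * \<bar>C\<bar> / real n"
    proof -
      have "\<bar>C\<bar> * real n \<le> \<bar>C\<bar> * (2 * real k)" using k by (intro mult_left_mono) auto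
      then show ?thesis using k by (simp add: field_simps)
    qed
    finally show "\<exists>x. case_nat w (sl_lambda q pi 0) n = of_real x \<and> \<bar>x - (real n + 0)\<bar> \<le> 2 * \<bar>C\<bar> / real n"
      using x k(1) by (intro exI[of _ x]) (simp add: add.commute)
  next
    fix h z assume h: "integrable leb_pi h" and zero: "\<And>n. cos_transform h (case_nat w (sl_lambda q pi 0) n) = 0"
    show "cos_transform h z = 0"
      by (rule cos_lambda_complete_augmented[OF ab m h w]) (use zero[of 0] zero[of "Suc n" for n] in auto)
  qed simp
qed

end

theorem theorem1p1:
  fixes q :: "real \<Rightarrow> real"
  assumes "q absolutely_integrable_on {0..pi}"
  shows "(\<forall>\<alpha>\<in>{0<..pi}. \<forall>\<beta>\<in>{0..<pi}. (\<alpha>, \<beta>) \<noteq> (pi, 0) \<longrightarrow>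
            l2_riesz_basis (\<lambda>n x. cos (sl_lambda q \<alpha> \<beta> n * of_real x))) \<and>
         \<not> l2_basis (\<lambda>n x. cos (sl_lambda q pi 0 n * of_real x)) \<and>
         (\<forall>l::complex. (\<forall>n. l\<^sup>2 \<noteq> (sl_lambda q pi 0 n)\<^sup>2) \<longrightarrow>
            l2_riesz_basis (case_nat (\<lambda>x. cos (l * of_real x))
                                     (\<lambda>n x. cos (sl_lambda q pi 0 n * of_real x))))"
proof -
  interpret sl_potential q by unfold_locales (rule assms)
  have sys: "(\<lambda>n x. cos (sl_lambda q \<alpha> \<beta> n * of_real x)) = (\<lambda>n. cos_fun (sl_lambda q \<alpha> \<beta> n))" for \<alpha> \<beta>
    by (simp add: cos_fun_def fun_eq_iff)
  have aug: "case_nat (\<lambda>x. cos (l * of_real x)) (\<lambda>n x. cos (sl_lambda q pi 0 n * of_real x)) =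
      (\<lambda>n. cos_fun (case_nat l (sl_lambda q pi 0) n))" for l
    by (auto simp: cos_fun_def fun_eq_iff split: nat.split)
  \<comment> \<open>any non-real square will do, since the eigenvalues are real\<close>
  have ne: "(csqrt \<i>)\<^sup>2 \<noteq> (sl_lambda q pi 0 n)\<^sup>2" for n
    unfolding sl_lambda_power2 power2_csqrt by (simp add: complex_eq_iff)
  have "\<not> l2_basis (\<lambda>n. cos_fun (case_nat (csqrt \<i>) (sl_lambda q pi 0) (Suc n)))"
    by (rule riesz_basis_remove_not_basis[OF cos_fun_L2 riesz_basis_cos_lambda_augmented[OF ne]])
  then have "\<not> l2_basis (\<lambda>n. cos_fun (sl_lambda q pi 0 n))" by simp
  then show ?thesis
    unfolding aug unfolding sys
  proof (intro conjI ballI allI impI)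
    show "l2_riesz_basis (\<lambda>n. cos_fun (sl_lambda q \<alpha> \<beta> n))"
      if "\<alpha> \<in> {0<..pi}" "\<beta> \<in> {0..<pi}" "(\<alpha>, \<beta>) \<noteq> (pi, 0)" for \<alpha> \<beta>
      by (rule l2_riesz_basisI[OF cos_fun_L2 riesz_basis_cos_lambda[OF that]])
    show "l2_riesz_basis (\<lambda>n. cos_fun (case_nat l (sl_lambda q pi 0) n))"
      if "\<forall>n. l\<^sup>2 \<noteq> (sl_lambda q pi 0 n)\<^sup>2" for l
      by (rule l2_riesz_basisI[OF cos_fun_L2 riesz_basis_cos_lambda_augmented]) (use that in blast)
  qed
qed

end
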